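(* Let $n\ge 2$ be an integer or $n=\infty$, let $\omega\in\Omega_+$ be an infinite word which is either aperiodic or periodic, and let $T=(T_1,\ldots,T_n)$ be the bilateral weighted shift on $\mathcal{K}_\omega$ with weights $\Lambda=\{\lambda_u\}_{u\in\mathbb{F}_\omega}$, all $\lambda_u>0$. The following assertions are equivalent: (i) The algebra $\mathfrak{S}_{\omega,\Lambda}$ has non-trivial reducing subspaces. (ii) The operators $T=(T_1,\ldots,T_n)$ have non-trivial joint reducing subspaces. (iii) The pair $(\omega,\Lambda)$ is doubly-periodic; that is, the word $\omega$ is periodic and the weights $\Lambda$ are periodic. Furthermore, suppose that $\omega=v_0v_0v_0\cdots$ is periodic (with $v_0\in\mathbb{F}_n^+$ primitive) and the weights $\Lambda$ are of period $k$. For $0\le r<k$ set $$P_r=\sum_{u\in\mathbb{G}_r^{(0)}}\oplus\, Q_{\mathcal{J}_{u,k}}=\sum_{u\in\mathbb{G}_r^{(0)}}\oplus\, u(S)\,Q_{\mathcal{J}_{\phi,k}}\,u(S)^* .$$ Then every reducing subspace $\mathcal{H}\subseteq\mathcal{K}_\omega$ for $\mathfrak{S}_{\omega,\Lambda}$ (equivalently, every joint reducing subspace for $T$) satisfies $$\mathcal{H}=\sum_{u\in\mathbb{F}_{\omega,k}}\oplus\, Q_{\mathcal{J}_{u,k}}\mathcal{H}=\sum_{r=0}^{k-1}\oplus\, P_r\mathcal{H},$$ where the projections $P_r$, $0\le r<k$, commute with the orthogonal projection $P_{\mathcal{H}}$ onto $\mathcal{H}$; moreover $P_0\mathcal{H}$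 is contained in $\mathcal{K}_{\omega,k}$ and its image $U_{\omega,k}P_0\mathcal{H}$ is a reducing subspace for $\mathfrak{S}_\omega$. Conversely, every reducing subspace $\mathcal{H}'$ for $\mathfrak{S}_\omega$ generates a reducing subspace for $\mathfrak{S}_{\omega,\Lambda}$ in this way: there is a reducing subspace $\mathcal{H}$ for $\mathfrak{S}_{\omega,\Lambda}$, decomposed as $\mathcal{H}=\sum_{u\in\mathbb{F}_{\omega,k}}\oplus\, Q_{\mathcal{J}_{u,k}}\mathcal{H}=\sum_{r=0}^{k-1}\oplus\, P_r\mathcal{H}$, with $P_0\mathcal{H}=U_{\omega,k}^*\mathcal{H}'$.
   Context: Words and spaces. $\mathbb{F}_n^+$ is the unital free semigroup on the letters $\{1,2,\ldots,n\}$ (on $\{1,2,\ldots\}$ if $n=\infty$), with unit the empty word $\phi$; $|w|$ is the length of $w\in\mathbb{F}_n^+$. $\Omega_+$ is the set of infinite words $\omega=i_1i_2i_3\cdots$ in these letters; $\omega_0=\phi$ and $\omega_m=i_1i_2\cdots i_m$ for $m\ge1$. $\omega$ is eventually periodic if $\omega=xv_0v_0v_0\cdots$ for some $x,v_0\in\mathbb{F}_n^+$, $v_0\neq\phi$; periodic if one can take $x=\phi$; aperiodic if it is not eventually periodic. A word is primitive if it is nonempty and not a power (with exponent $\ge 2$) of another element of $\mathbb{F}_n^+$; a periodic $\omega$ is always written $\omega=v_0v_0v_0\cdots$ with $v_0$ primitive. $\mathbb{F}_\omega$ is the set of elements of the free group on the $n$ generators that are given by reduced words of the form $u=v\omega_m^{-1}$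 with $v\in\mathbb{F}_n^+$, $m\ge0$; it is closed under left multiplication by $\mathbb{F}_n^+$. $\mathcal{K}_\omega=\ell^2(\mathbb{F}_\omega)$ is the Hilbert space with orthonormal basis $\{\xi_u:u\in\mathbb{F}_\omega\}$. Shifts. The bilateral weighted shift on $\mathcal{K}_\omega$ with weights $\Lambda=\{\lambda_u\}_{u\in\mathbb{F}_\omega}$ is the $n$-tuple of (bounded) operators $T=(T_1,\ldots,T_n)$ with $T_i\xi_u=\lambda_{iu}\xi_{iu}$ for $u\in\mathbb{F}_\omega$, $1\le i\le n$. $\mathfrak{S}_{\omega,\Lambda}$ is the unital weak-operator-topology closed (nonselfadjoint) algebra generated by $T_1,\ldots,T_n$. The unweighted shift ($\lambda_u\equiv1$) is denoted $S=(S_1,\ldots,S_n)$ and its algebra $\mathfrak{S}_\omega$. For $w=j_1\cdots j_p\in\mathbb{F}_n^+$, $w(S)=S_{j_1}\cdots S_{j_p}$ ($\phi(S)=I$), and for $u=v\omega_m^{-1}\in\mathbb{F}_\omega$ (reduced), $u(S)=v(S)\,\omega_m(S)^*$. A closed subspace reduces an operator, family or algebra if its orthogonal projection commutes with each of the operators in question; it is non-trivial if it is neither $\{0\}$ nor $\mathcal{K}_\omega$. Periodicity. Let $\omega=v_0v_0\cdots=i_1i_2\cdots$ be periodic and $k\ge1$. Put $i_0=i_{|v_0|}$. The principal component is $$\mathbb{F}_{\omega,k}=\{v\omega_m^{-1}: v\in\mathbb{F}_n^+\setminus\mathbb{F}_n^+i_m,\ 0\le m<k|v_0|\}.$$ Put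 $\mathcal{J}_{\phi,k}=\{(v_0^k)^l:l\in\mathbb{Z}\}$ and $\mathcal{J}_{u,k}=u\mathcal{J}_{\phi,k}$ for $u\in\mathbb{F}_{\omega,k}$ (products in the free group). These sets form a partition $\mathbb{F}_\omega=\bigcup_{u\in\mathbb{F}_{\omega,k}}\mathcal{J}_{u,k}$. The weights $\Lambda$ (equivalently the shift $T$) are of period $k$ if $\lambda_{iv}=\lambda_u$ for all $v\in\mathbb{F}_\omega$ and $1\le i\le n$, where $u$ is the unique element of $\mathbb{F}_{\omega,k}$ with $iv\in\mathcal{J}_{u,k}$; they are periodic if they are of period $k$ for some $k\ge1$. For $\mathcal{J}\subseteq\mathbb{F}_\omega$, $Q_{\mathcal{J}}$ is the orthogonal projection onto the closed span of $\{\xi_v:v\in\mathcal{J}\}$. Further decomposition. For $0\le r<k$, $$\mathbb{G}_r^{(0)}=\{v\omega_m^{-1}: v\in\mathbb{F}_n^+\setminus\mathbb{F}_n^+i_m,\ r|v_0|\le m<(r+1)|v_0|\},$$ so that $\mathbb{F}_{\omega,k}=\mathbb{G}_0^{(0)}\cup\cdots\cup\mathbb{G}_{k-1}^{(0)}$ is a partition; note that $\mathbb{G}_0^{(0)}=\mathbb{F}_{\omega,1}$. Let $\mathcal{K}_{\omega,k}$ be the closed span of $\{\xi_{uv_0^{kl}}:u\in\mathbb{G}_0^{(0)},\ l\in\mathbb{Z}\}$, and let $U_{\omega,k}:\mathcal{K}_{\omega,k}\to\mathcal{K}_\omega$ be the unitary with $U_{\omega,k}\xi_{uv_0^{kl}}=\xi_{uv_0^{l}}$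 for $u\in\mathbb{G}_0^{(0)}$, $l\in\mathbb{Z}$. (It is onto because $\{uv_0^l:u\in\mathbb{G}_0^{(0)},\,l\in\mathbb{Z}\}=\mathbb{F}_\omega$.)
   Formalization: The decomposition of every reducing subspace H and the commutation of the P_r with P_H are stated only when k is the least period of Λ; for a non-minimal k they fail (e.g. Λ≡1, k=2, H a spectral subspace of right translation by v_0). *)

theory Defs
  imports "HOL-Analysis.Analysis" "HOL-Algebra.Coset" "HOL-Library.Stream"
    "HOL-Library.Extended_Nat"
begin

section \<open>Words and the free group\<close>

definition letters :: "enat \<Rightarrow> nat set" where
  "letters n = {i. 1 \<le> i \<and> enat i \<le> n}"

definition primitive :: "nat list \<Rightarrow> bool" where
  "primitive w \<longleftrightarrow> w \<noteq> [] \<and> \<not> (\<exists>x j. 2 \<le> j \<and> w = concat (replicate j x))"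

definition eventually_periodic :: "nat stream \<Rightarrow> bool" where
  "eventually_periodic \<omega> \<longleftrightarrow> (\<exists>x v0. v0 \<noteq> [] \<and> \<omega> = x @- cycle v0)"

definition periodic_word :: "nat stream \<Rightarrow> bool" where
  "periodic_word \<omega> \<longleftrightarrow> (\<exists>v0. v0 \<noteq> [] \<and> \<omega> = cycle v0)"

text \<open>The free group consists of reduced words in signed letters: \<open>(i, True)\<close> is the generator
  \<open>i\<close> and \<open>(i, False)\<close> is its inverse.\<close>

type_synonym fgword = "(nat \<times> bool) list"

definition flip :: "nat \<times> bool \<Rightarrow> nat \<times> bool" where
  "flip a = (fst a, \<not> snd a)"

definition freduced :: "fgword \<Rightarrow> bool" where
  "freduced w \<longleftrightarrow> successively (\<lambda>a b. b \<noteq> flip a) w"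

fun rcons :: "nat \<times> bool \<Rightarrow> fgword \<Rightarrow> fgword" where
  "rcons a [] = [a]"
| "rcons a (b # w) = (if b = flip a then w else a # b # w)"

definition free_group :: "nat set \<Rightarrow> fgword monoid" where
  "free_group A =
    \<lparr>carrier = {w. fst ` set w \<subseteq> A \<and> freduced w}, monoid.mult = foldr rcons, one = []\<rparr>"

abbreviation FG :: "enat \<Rightarrow> fgword monoid" where
  "FG n \<equiv> free_group (letters n)"

lemma flip_flip [simp]: "flip (flip a) = a"
  by (simp add: flip_def)

lemma freduced_rcons: "freduced w \<Longrightarrow> freduced (rcons a w)"
  by (cases w) (auto simp: freduced_def successively_Cons)

lemma set_rcons: "fst ` set (rcons a w) \<subseteq> insert (fst a) (fst ` set w)"
  by (cases w) auto

lemma rcons_flip: "freduced w \<Longrightarrow> rcons a (rcons (flip a) w) = w"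
proof (cases w)
  case (Cons b v)
  assume "freduced w"
  with Cons show ?thesis by (cases v) (auto simp: freduced_def flip_def)
qed simp

lemma freduced_mult: "freduced v \<Longrightarrow> freduced (foldr rcons u v)"
  by (induction u) (auto intro: freduced_rcons)

lemma set_mult_freduced: "fst ` set (foldr rcons u v) \<subseteq> fst ` set u \<union> fst ` set v"
proof (induction u)
  case (Cons a u)
  have "fst ` set (foldr rcons (a # u) v) \<subseteq> insert (fst a) (fst ` set (foldr rcons u v))"
    using set_rcons by simp
  also have "\<dots> \<subseteq> fst ` set (a # u) \<union> fst ` set v"
    using Cons.IH by (simp add: subset_insertI2)
  finally show ?case .
qed simp

lemma rcons_mult:
  assumes "freduced v" "freduced w"
  shows "foldr rcons (rcons a v) w = rcons a (foldr rcons v w)"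
  using assms by (cases v) (auto simp: rcons_flip freduced_mult)

lemma mult_assoc_freduced:
  assumes "freduced v" "freduced w"
  shows "foldr rcons (foldr rcons u v) w = foldr rcons u (foldr rcons v w)"
  using assms by (induction u) (auto simp: rcons_mult freduced_mult)

lemma mult_one_freduced: "freduced w \<Longrightarrow> foldr rcons w [] = w"
proof (induction w)
  case (Cons a w)
  then show ?case by (cases w) (auto simp: freduced_def)
qed simp

lemma mult_inverse: "freduced w \<Longrightarrow> foldr rcons (rev (map flip u)) (foldr rcons u w) = w"
proof (induction u)
  case (Cons a u)
  then show ?case using rcons_flip[of "foldr rcons u w" "flip a"] by (simp add: freduced_mult)
qed simp

lemma group_free_group: "Group.group (free_group A)"
proof (rule groupI)
  fix x assume x: "x \<in> carrier (free_group A)"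
  define y where "y = foldr rcons (rev (map flip x)) []"
  have "fst ` set (rev (map flip x)) \<subseteq> A"
    using x by (auto simp: flip_def free_group_def)
  then have "fst ` set y \<subseteq> A"
    unfolding y_def using set_mult_freduced[of "rev (map flip x)" "[]"] by auto
  then have y: "y \<in> carrier (free_group A)"
    by (simp add: y_def free_group_def freduced_mult freduced_def[of "[]"])
  have rx: "freduced x" using x by (simp add: free_group_def)
  have "foldr rcons y x = foldr rcons (rev (map flip x)) (foldr rcons [] x)"
    unfolding y_def by (rule mult_assoc_freduced) (auto simp: rx freduced_def[of "[]"])
  also have "\<dots> = foldr rcons (rev (map flip x)) (foldr rcons x [])"
    using rx by (simp add: mult_one_freduced)
  also have "\<dots> = []"
    by (rule mult_inverse) (simp add: freduced_def)
  finally show "\<exists>y\<in>carrier (free_group A). y \<otimes>\<^bsub>free_group A\<^esub> x = \<one>\<^bsub>free_group A\<^esub>"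
    using y by (auto simp: free_group_def)
next
  fix x y assume "x \<in> carrier (free_group A)" "y \<in> carrier (free_group A)"
  then have "fst ` set x \<union> fst ` set y \<subseteq> A" "freduced y"
    by (simp_all add: free_group_def)
  then show "x \<otimes>\<^bsub>free_group A\<^esub> y \<in> carrier (free_group A)"
    using subset_trans[OF set_mult_freduced[of x y]] by (simp add: free_group_def freduced_mult)
qed (auto simp: free_group_def mult_assoc_freduced freduced_def[of "[]"])

text \<open>\<open>pos v\<close> is the free group element \<open>v\<close>, and \<open>neg w\<close> is the reduced word of \<open>w\<inverse>\<close>.\<close>

definition pos :: "nat list \<Rightarrow> fgword" where
  "pos v = map (\<lambda>i. (i, True)) v"

definition neg :: "nat list \<Rightarrow> fgword" where
  "neg w = rev (map (\<lambda>i. (i, False)) w)"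

definition F_omega :: "enat \<Rightarrow> nat stream \<Rightarrow> fgword set" where
  "F_omega n \<omega> = {u \<in> carrier (FG n). \<exists>v\<in>lists (letters n). \<exists>m. u = pos v @ neg (stake m \<omega>)}"


section \<open>The space of square summable functions, and operators on it\<close>

text \<open>Vectors of \<open>\<ell>\<^sup>2(X)\<close> are extended by zero outside \<open>X\<close>. Hilbert spaces are represented by their
  carriers, and an operator from \<open>D\<close> to \<open>E\<close> is extensional, i.e. undefined outside \<open>D\<close>, so that
  two operators are equal iff they agree on \<open>D\<close>.\<close>

type_synonym 'a vec = "'a \<Rightarrow> complex"
type_synonym 'a oper = "'a vec \<Rightarrow> 'a vec"

definition ell2 :: "'a set \<Rightarrow> 'a vec set" where
  "ell2 X = {f. (\<forall>x. x \<notin> X \<longrightarrow> f x = 0) \<and> (\<lambda>x. (cmod (f x))\<^sup>2) summable_on UNIV}"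

definition cinner :: "'a vec \<Rightarrow> 'a vec \<Rightarrow> complex" where
  "cinner f g = (\<Sum>\<^sub>\<infinity>x. f x * cnj (g x))"

definition l2norm :: "'a vec \<Rightarrow> real" where
  "l2norm f = sqrt (\<Sum>\<^sub>\<infinity>x. (cmod (f x))\<^sup>2)"

definition ket :: "'a \<Rightarrow> 'a vec" where
  "ket u = (\<lambda>x. if x = u then 1 else 0)"

definition l2_topology :: "'a vec set \<Rightarrow> 'a vec topology" where
  "l2_topology K = Metric_space.mtopology K (\<lambda>f g. l2norm (\<lambda>x. f x - g x))"

definition closed_subspace :: "'a vec set \<Rightarrow> 'a vec set \<Rightarrow> bool" where
  "closed_subspace K M \<longleftrightarrow>
    M \<subseteq> K \<and> (\<lambda>x. 0) \<in> M \<and>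
    (\<forall>f\<in>M. \<forall>g\<in>M. (\<lambda>x. f x + g x) \<in> M) \<and>
    (\<forall>c. \<forall>f\<in>M. (\<lambda>x. c * f x) \<in> M) \<and>
    closedin (l2_topology K) M"

definition closed_span :: "'a vec set \<Rightarrow> 'a vec set \<Rightarrow> 'a vec set" where
  "closed_span K B = closed_subspace K hull B"

definition bop :: "'a vec set \<Rightarrow> 'a vec set \<Rightarrow> 'a oper set" where
  "bop D E = {A \<in> D \<rightarrow>\<^sub>E E.
    (\<forall>f\<in>D. \<forall>g\<in>D. A (\<lambda>x. f x + g x) = (\<lambda>x. A f x + A g x)) \<and>
    (\<forall>c. \<forall>f\<in>D. A (\<lambda>x. c * f x) = (\<lambda>x. c * A f x)) \<and>
    (\<exists>C. \<forall>f\<in>D. l2norm (A f) \<le> C * l2norm f)}"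

definition adj :: "'a vec set \<Rightarrow> 'a vec set \<Rightarrow> 'a oper \<Rightarrow> 'a oper" where
  "adj D E A = (THE B. B \<in> bop E D \<and> (\<forall>f\<in>D. \<forall>g\<in>E. cinner (A f) g = cinner f (B g)))"

definition unitary :: "'a vec set \<Rightarrow> 'a vec set \<Rightarrow> 'a oper \<Rightarrow> bool" where
  "unitary D E U \<longleftrightarrow>
    U \<in> bop D E \<and> U ` D = E \<and> (\<forall>f\<in>D. \<forall>g\<in>D. cinner (U f) (U g) = cinner f g)"

text \<open>The orthogonal projection of \<open>K\<close> onto a closed subspace \<open>M\<close>.\<close>

definition proj :: "'a vec set \<Rightarrow> 'a vec set \<Rightarrow> 'a oper" where
  "proj K M = (\<lambda>f\<in>K. THE g. g \<in> M \<and> (\<forall>h\<in>M. cinner (\<lambda>x. f x - g x) h = 0))"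

definition commute :: "'a vec set \<Rightarrow> 'a oper \<Rightarrow> 'a oper \<Rightarrow> bool" where
  "commute K A B \<longleftrightarrow> compose K A B = compose K B A"

definition reduces :: "'a vec set \<Rightarrow> 'a vec set \<Rightarrow> 'a oper set \<Rightarrow> bool" where
  "reduces K M \<A> \<longleftrightarrow> closed_subspace K M \<and> (\<forall>A\<in>\<A>. commute K (proj K M) A)"

definition nontrivial :: "'a vec set \<Rightarrow> 'a vec set \<Rightarrow> bool" where
  "nontrivial K M \<longleftrightarrow> M \<noteq> {\<lambda>x. 0} \<and> M \<noteq> K"

text \<open>The weak operator topology is the initial topology on the bounded operators for the functions
  \<open>A \<mapsto> \<langle>A f, g\<rangle>\<close> with \<open>f, g \<in> K\<close>.\<close>

definition wot :: "'a vec set \<Rightarrow> 'a oper topology" where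
  "wot K = pullback_topology (bop K K) (\<lambda>A. \<lambda>(f, g)\<in>K \<times> K. cinner (A f) g)
    (product_topology (\<lambda>_. euclidean) (K \<times> K))"

definition wot_closed_unital_algebra :: "'a vec set \<Rightarrow> 'a oper set \<Rightarrow> bool" where
  "wot_closed_unital_algebra K \<A> \<longleftrightarrow>
    \<A> \<subseteq> bop K K \<and> (\<lambda>f\<in>K. f) \<in> \<A> \<and>
    (\<forall>A\<in>\<A>. \<forall>B\<in>\<A>. compose K A B \<in> \<A> \<and> (\<lambda>f\<in>K. \<lambda>x. A f x + B f x) \<in> \<A>) \<and>
    (\<forall>c. \<forall>A\<in>\<A>. (\<lambda>f\<in>K. \<lambda>x. c * A f x) \<in> \<A>) \<and>
    closedin (wot K) \<A>"

definition wot_algebra :: "'a vec set \<Rightarrow> 'a oper set \<Rightarrow> 'a oper set" where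
  "wot_algebra K \<S> = wot_closed_unital_algebra K hull \<S>"

text \<open>\<open>H\<close> is the orthogonal direct sum of the closed subspaces \<open>M u\<close>, \<open>u \<in> I\<close>.\<close>

definition orth_sum :: "'a vec set \<Rightarrow> 'i set \<Rightarrow> ('i \<Rightarrow> 'a vec set) \<Rightarrow> 'a vec set \<Rightarrow> bool" where
  "orth_sum K I M H \<longleftrightarrow>
    (\<forall>u\<in>I. closed_subspace K (M u)) \<and>
    (\<forall>u\<in>I. \<forall>w\<in>I. u \<noteq> w \<longrightarrow> (\<forall>f\<in>M u. \<forall>g\<in>M w. cinner f g = 0)) \<and>
    H = closed_span K (\<Union>u\<in>I. M u)"

text \<open>\<open>P\<close> is the sum, in the strong operator topology, of the mutually orthogonal
  projections \<open>A u\<close>, \<open>u \<in> I\<close>.\<close>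

definition has_orth_proj_sum ::
  "'a vec set \<Rightarrow> 'i set \<Rightarrow> ('i \<Rightarrow> 'a oper) \<Rightarrow> 'a oper \<Rightarrow> bool" where
  "has_orth_proj_sum K I A P \<longleftrightarrow>
    P \<in> bop K K \<and>
    (\<forall>u\<in>I. \<exists>M. closed_subspace K M \<and> A u = proj K M) \<and>
    (\<forall>u\<in>I. \<forall>w\<in>I. u \<noteq> w \<longrightarrow> (\<forall>f\<in>K. A u (A w f) = (\<lambda>x. 0))) \<and>
    (\<forall>f\<in>K. ((\<lambda>F. l2norm (\<lambda>x. P f x - (\<Sum>u\<in>F. A u f x))) \<longlongrightarrow> 0) (finite_subsets_at_top I))"


section \<open>Shifts\<close>

definition K_omega :: "enat \<Rightarrow> nat stream \<Rightarrow> fgword vec set" where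
  "K_omega n \<omega> = ell2 (F_omega n \<omega>)"

definition weighted_shift ::
  "enat \<Rightarrow> nat stream \<Rightarrow> (fgword \<Rightarrow> real) \<Rightarrow> (nat \<Rightarrow> fgword oper) \<Rightarrow> bool" where
  "weighted_shift n \<omega> \<Lambda> T \<longleftrightarrow>
    (\<forall>i\<in>letters n. T i \<in> bop (K_omega n \<omega>) (K_omega n \<omega>) \<and>
      (\<forall>u\<in>F_omega n \<omega>. let iu = pos [i] \<otimes>\<^bsub>FG n\<^esub> u in
        T i (ket u) = (\<lambda>x. complex_of_real (\<Lambda> iu) * ket iu x)))"

lemma pos_Cons_mult_closed:
  assumes \<omega>: "\<omega> \<in> streams (letters n)" and i: "i \<in> letters n" and u: "u \<in> F_omega n \<omega>"
  shows "rcons (i, True) u \<in> F_omega n \<omega>"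
proof -
  have carr: "rcons (i, True) u \<in> carrier (FG n)"
    using u i set_rcons[of "(i, True)" u]
    by (auto simp: F_omega_def free_group_def freduced_rcons)
  obtain v m where v: "v \<in> lists (letters n)" and uv: "u = pos v @ neg (stake m \<omega>)"
    using u by (auto simp: F_omega_def)
  have "\<exists>v\<in>lists (letters n). \<exists>m. rcons (i, True) u = pos v @ neg (stake m \<omega>)"
  proof (cases "\<exists>u'. u = (i, False) # u'")
    case True
    then obtain u' where u': "u = (i, False) # u'" by blast
    have "v = []" using uv u' by (cases v) (auto simp: pos_def)
    with uv u' have eq: "neg (stake m \<omega>) = (i, False) # u'" by (simp add: pos_def)
    then obtain k where m: "m = Suc k" by (cases m) (auto simp: neg_def)
    have "u' = neg (stake k \<omega>)"
      using eq unfolding m stake_Suc by (simp add: neg_def)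
    then have "rcons (i, True) u = pos [] @ neg (stake k \<omega>)"
      by (simp add: u' pos_def flip_def)
    then show ?thesis by blast
  next
    case False
    then have "rcons (i, True) u = (i, True) # u"
      by (cases u) (auto simp: flip_def)
    then have "rcons (i, True) u = pos (i # v) @ neg (stake m \<omega>)"
      by (simp add: uv pos_def)
    moreover have "i # v \<in> lists (letters n)" using v i by simp
    ultimately show ?thesis by blast
  qed
  with carr show ?thesis by (auto simp: F_omega_def)
qed

lemma unweighted_shift_exists:
  assumes \<omega>: "\<omega> \<in> streams (letters n)"
  shows "\<exists>S. weighted_shift n \<omega> (\<lambda>_. 1) S"
proof -
  define F where "F = F_omega n \<omega>"
  define \<mu> where "\<mu> i = rcons (i, True)" for i :: nat
  define S where "S i = (\<lambda>f\<in>ell2 F. \<lambda>w. if w \<in> \<mu> i ` F then f (inv_into F (\<mu> i) w) else 0)"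
    for i
  have "S i \<in> bop (ell2 F) (ell2 F) \<and> (\<forall>u\<in>F. S i (ket u) = ket (\<mu> i u))"
    if i: "i \<in> letters n" for i
  proof -
    have sub: "\<mu> i ` F \<subseteq> F"
      using pos_Cons_mult_closed[OF \<omega> i] by (auto simp: F_def \<mu>_def)
    have red: "freduced u" if "u \<in> F" for u
      using that by (auto simp: F_def F_omega_def free_group_def)
    have inj: "inj_on (\<mu> i) F"
    proof (rule inj_onI)
      fix u w assume "u \<in> F" "w \<in> F" "\<mu> i u = \<mu> i w"
      then show "u = w"
        using rcons_flip[OF red, of u "(i, False)"] rcons_flip[OF red, of w "(i, False)"]
        by (simp add: \<mu>_def flip_def)
    qed
    have at: "S i f (\<mu> i u) = f u" if "f \<in> ell2 F" "u \<in> F" for f u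
      using that inj by (simp add: S_def)
    have off: "S i f w = 0" if "f \<in> ell2 F" "w \<notin> \<mu> i ` F" for f w
      using that by (simp add: S_def)
    have summ: "(\<lambda>w. (cmod (S i f w))\<^sup>2) summable_on UNIV \<and> l2norm (S i f) = l2norm f"
      if f: "f \<in> ell2 F" for f
    proof -
      have z: "f x = 0" if "x \<notin> F" for x using f that by (simp add: ell2_def)
      have "(\<lambda>x. (cmod (f x))\<^sup>2) summable_on UNIV" using f by (simp add: ell2_def)
      then have "((\<lambda>x. (cmod (f x))\<^sup>2) has_sum (\<Sum>\<^sub>\<infinity>x. (cmod (f x))\<^sup>2)) UNIV"
        by simp
      also have "?this \<longleftrightarrow> ((\<lambda>x. (cmod (f x))\<^sup>2) has_sum (\<Sum>\<^sub>\<infinity>x. (cmod (f x))\<^sup>2)) F"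
        by (rule has_sum_cong_neutral) (auto simp: z)
      also have "\<dots> \<longleftrightarrow> (((\<lambda>w. (cmod (S i f w))\<^sup>2) \<circ> \<mu> i) has_sum (\<Sum>\<^sub>\<infinity>x. (cmod (f x))\<^sup>2)) F"
        by (rule has_sum_cong) (simp add: at f)
      also have "\<dots> \<longleftrightarrow> ((\<lambda>w. (cmod (S i f w))\<^sup>2) has_sum (\<Sum>\<^sub>\<infinity>x. (cmod (f x))\<^sup>2)) (\<mu> i ` F)"
        by (rule has_sum_reindex[OF inj, symmetric])
      also have "\<dots> \<longleftrightarrow> ((\<lambda>w. (cmod (S i f w))\<^sup>2) has_sum (\<Sum>\<^sub>\<infinity>x. (cmod (f x))\<^sup>2)) UNIV"
        by (rule has_sum_cong_neutral) (auto simp: off f)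
      finally show ?thesis
        by (auto simp: l2norm_def infsumI summable_on_def)
    qed
    have into: "S i f \<in> ell2 F" if f: "f \<in> ell2 F" for f
    proof -
      have "S i f w = 0" if "w \<notin> F" for w
        by (rule off[OF f]) (use sub that in blast)
      then show ?thesis using summ[OF f] by (simp add: ell2_def)
    qed
    have add: "(\<lambda>x. f x + g x) \<in> ell2 F" if "f \<in> ell2 F" "g \<in> ell2 F" for f g
    proof -
      have "(cmod (f x + g x))\<^sup>2 \<le> 2 * (cmod (f x))\<^sup>2 + 2 * (cmod (g x))\<^sup>2" for x
      proof -
        have "(cmod (f x + g x))\<^sup>2 \<le> (cmod (f x) + cmod (g x))\<^sup>2"
          by (intro power_mono norm_triangle_ineq norm_ge_zero)
        also have "\<dots> \<le> 2 * (cmod (f x))\<^sup>2 + 2 * (cmod (g x))\<^sup>2"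
          using sum_squares_bound[of "cmod (f x)" "cmod (g x)"]
          by (simp add: power2_sum)
        finally show ?thesis .
      qed
      moreover have "(\<lambda>x. 2 * (cmod (f x))\<^sup>2 + 2 * (cmod (g x))\<^sup>2) summable_on UNIV"
        using that by (intro summable_on_add summable_on_cmult_right) (auto simp: ell2_def)
      ultimately have "(\<lambda>x. (cmod (f x + g x))\<^sup>2) summable_on UNIV"
        using summable_on_comparison_test[of "\<lambda>x. 2 * (cmod (f x))\<^sup>2 + 2 * (cmod (g x))\<^sup>2" UNIV
            "\<lambda>x. (cmod (f x + g x))\<^sup>2"] by simp
      then show ?thesis using that by (auto simp: ell2_def)
    qed
    have scale: "(\<lambda>x. c * f x) \<in> ell2 F" if "f \<in> ell2 F" for c f
      using that by (auto simp: ell2_def norm_mult power_mult_distrib intro!: summable_on_cmult_right)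
    have "S i \<in> bop (ell2 F) (ell2 F)"
      unfolding bop_def
    proof (intro CollectI conjI)
      show "S i \<in> ell2 F \<rightarrow>\<^sub>E ell2 F" using into by (auto simp: S_def)
      show "\<forall>f\<in>ell2 F. \<forall>g\<in>ell2 F. S i (\<lambda>x. f x + g x) = (\<lambda>x. S i f x + S i g x)"
        using add by (simp add: S_def fun_eq_iff)
      show "\<forall>c. \<forall>f\<in>ell2 F. S i (\<lambda>x. c * f x) = (\<lambda>x. c * S i f x)"
        using scale by (simp add: S_def fun_eq_iff)
      show "\<exists>C. \<forall>f\<in>ell2 F. l2norm (S i f) \<le> C * l2norm f"
        using summ by (intro exI[of _ 1]) auto
    qed
    moreover have "S i (ket u) = ket (\<mu> i u)" if u: "u \<in> F" for u
    proof
      fix w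
      have "(\<lambda>x. (cmod (ket u x))\<^sup>2) summable_on UNIV"
        by (rule finite_nonzero_values_imp_summable_on)
          (rule finite_subset[of _ "{u}"], auto simp: ket_def)
      then have k: "ket u \<in> ell2 F" using u by (auto simp: ell2_def ket_def)
      show "S i (ket u) w = ket (\<mu> i u) w"
      proof (cases "w \<in> \<mu> i ` F")
        case True
        then obtain x where "x \<in> F" "w = \<mu> i x" by blast
        moreover from this have "\<mu> i x = \<mu> i u \<longleftrightarrow> x = u" using inj u by (simp add: inj_on_eq_iff)
        ultimately show ?thesis using at[OF k] by (simp add: ket_def)
      next
        case False
        then show ?thesis using off[OF k] u by (auto simp: ket_def)
      qed
    qed
    ultimately show ?thesis by blast
  qed
  then have "weighted_shift n \<omega> (\<lambda>_. 1) S"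
    by (simp add: weighted_shift_def K_omega_def F_def \<mu>_def free_group_def pos_def Let_def)
  then show ?thesis by blast
qed

definition shift_algebra ::
  "enat \<Rightarrow> nat stream \<Rightarrow> (nat \<Rightarrow> fgword oper) \<Rightarrow> fgword oper set" where
  "shift_algebra n \<omega> T = wot_algebra (K_omega n \<omega>) (T ` letters n)"

definition word_op :: "'a vec set \<Rightarrow> (nat \<Rightarrow> 'a oper) \<Rightarrow> nat list \<Rightarrow> 'a oper" where
  "word_op K S w = foldr (\<lambda>j A. compose K (S j) A) w (\<lambda>f\<in>K. f)"

text \<open>For a reduced word \<open>u = v w\<inverse>\<close> with \<open>v\<close>, \<open>w\<close> positive, the following is \<open>v(S) w(S)\<^sup>*\<close>.\<close>

definition elem_op :: "'a vec set \<Rightarrow> (nat \<Rightarrow> 'a oper) \<Rightarrow> fgword \<Rightarrow> 'a oper" where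
  "elem_op K S u =
    (let v = map fst (takeWhile snd u); w = rev (map fst (dropWhile snd u))
     in compose K (word_op K S v) (adj K K (word_op K S w)))"


section \<open>Periodicity\<close>

text \<open>In this section \<open>\<omega> = cycle v0\<close>. Streams are indexed from 0, so the \<open>m\<close>-th letter of \<open>\<omega>\<close>,
  \<open>m \<ge> 1\<close>, is \<open>\<omega> !! (m - 1)\<close>; the letter with index 0 is by convention the one with
  index \<open>length v0\<close>.\<close>

definition letter :: "nat list \<Rightarrow> nat \<Rightarrow> nat" where
  "letter v0 m = cycle v0 !! ((if m = 0 then length v0 else m) - 1)"

text \<open>The set of all \<open>v \<omega>\<^sub>m\<inverse>\<close> with \<open>a \<le> m < b\<close> such that \<open>v\<close> does not end in the \<open>m\<close>-th letter;
  under this condition the concatenated word is already reduced.\<close>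

definition component :: "enat \<Rightarrow> nat list \<Rightarrow> nat \<Rightarrow> nat \<Rightarrow> fgword set" where
  "component n v0 a b = {pos v @ neg (stake m (cycle v0)) | v m.
    v \<in> lists (letters n) - {x @ [letter v0 m] | x. x \<in> lists (letters n)} \<and> a \<le> m \<and> m < b}"

definition principal_component :: "enat \<Rightarrow> nat list \<Rightarrow> nat \<Rightarrow> fgword set" where
  "principal_component n v0 k = component n v0 0 (k * length v0)"

definition block :: "enat \<Rightarrow> nat list \<Rightarrow> nat \<Rightarrow> fgword set" where
  "block n v0 r = component n v0 (r * length v0) ((r + 1) * length v0)"

definition J_phi :: "enat \<Rightarrow> nat list \<Rightarrow> nat \<Rightarrow> fgword set" where
  "J_phi n v0 k = {(pos v0 [^]\<^bsub>FG n\<^esub> k) [^]\<^bsub>FG n\<^esub> l | l :: int. True}"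

definition J :: "enat \<Rightarrow> nat list \<Rightarrow> nat \<Rightarrow> fgword \<Rightarrow> fgword set" where
  "J n v0 k u = u <#\<^bsub>FG n\<^esub> J_phi n v0 k"

text \<open>Here \<open>k\<close> need not be the least period: weights of period \<open>k\<close> are also of period \<open>j * k\<close>
  for \<open>j \<ge> 1\<close>.\<close>

definition weights_of_period :: "enat \<Rightarrow> nat list \<Rightarrow> nat \<Rightarrow> (fgword \<Rightarrow> real) \<Rightarrow> bool" where
  "weights_of_period n v0 k \<Lambda> \<longleftrightarrow>
    (\<forall>v\<in>F_omega n (cycle v0). \<forall>i\<in>letters n. \<forall>u\<in>principal_component n v0 k.
      pos [i] \<otimes>\<^bsub>FG n\<^esub> v \<in> J n v0 k u \<longrightarrow> \<Lambda> (pos [i] \<otimes>\<^bsub>FG n\<^esub> v) = \<Lambda> u)"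

definition periodic_weights :: "enat \<Rightarrow> nat stream \<Rightarrow> (fgword \<Rightarrow> real) \<Rightarrow> bool" where
  "periodic_weights n \<omega> \<Lambda> \<longleftrightarrow>
    (\<exists>v0 k. primitive v0 \<and> \<omega> = cycle v0 \<and> 1 \<le> k \<and> weights_of_period n v0 k \<Lambda>)"

definition doubly_periodic :: "enat \<Rightarrow> nat stream \<Rightarrow> (fgword \<Rightarrow> real) \<Rightarrow> bool" where
  "doubly_periodic n \<omega> \<Lambda> \<longleftrightarrow> periodic_word \<omega> \<and> periodic_weights n \<omega> \<Lambda>"

definition Q :: "enat \<Rightarrow> nat stream \<Rightarrow> fgword set \<Rightarrow> fgword oper" where
  "Q n \<omega> I = proj (K_omega n \<omega>) (closed_span (K_omega n \<omega>) (ket ` I))"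

definition block_proj :: "enat \<Rightarrow> nat list \<Rightarrow> nat \<Rightarrow> nat \<Rightarrow> fgword oper" where
  "block_proj n v0 k r = (THE P. has_orth_proj_sum (K_omega n (cycle v0)) (block n v0 r)
    (\<lambda>u. Q n (cycle v0) (J n v0 k u)) P)"

definition K_per :: "enat \<Rightarrow> nat list \<Rightarrow> nat \<Rightarrow> fgword vec set" where
  "K_per n v0 k = closed_span (K_omega n (cycle v0))
    {ket (u \<otimes>\<^bsub>FG n\<^esub> (pos v0 [^]\<^bsub>FG n\<^esub> (int k * l))) | u l. u \<in> block n v0 0}"

definition U_per :: "enat \<Rightarrow> nat list \<Rightarrow> nat \<Rightarrow> fgword oper" where
  "U_per n v0 k = (THE U. unitary (K_per n v0 k) (K_omega n (cycle v0)) U \<and>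
    (\<forall>u\<in>block n v0 0. \<forall>l :: int.
      U (ket (u \<otimes>\<^bsub>FG n\<^esub> (pos v0 [^]\<^bsub>FG n\<^esub> (int k * l)))) =
      ket (u \<otimes>\<^bsub>FG n\<^esub> (pos v0 [^]\<^bsub>FG n\<^esub> l))))"

end

theory Submission
  imports Defs "HOL-Real_Asymp.Real_Asymp"
begin

text \<open>Let \<open>P\<close> be the projection onto a closed subspace, with matrix entries
  \<open>P(u, v) = \<langle>P \<xi>\<^sub>v, \<xi>\<^sub>u\<rangle>\<close>. Every element of \<open>\<bbbF>\<^sub>\<omega>\<close> has a unique predecessor \<open>w\<close>, \<open>u = i w\<close>, and any two
  elements have a common ancestor. Comparing matrix entries, and using that \<open>P\<close> is selfadjoint and the
  weights are positive, \<open>P\<close> commutes with all \<open>T\<^sub>i\<close> iff \<open>P(i u, j v) = \<delta>\<^sub>i\<^sub>j P(u, v)\<close> and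
  \<open>P(u, v) \<noteq> 0\<close> implies \<open>\<lambda>\<^sub>i\<^sub>u = \<lambda>\<^sub>i\<^sub>v\<close>. Hence \<open>P(u, v) \<noteq> 0\<close> forces \<open>u\<close> and \<open>v\<close> to have the same infinite
  sequence of predecessors. For aperiodic \<open>\<omega>\<close> this gives \<open>u = v\<close> and \<open>P\<close> is scalar; for periodic \<open>\<omega>\<close>
  it gives \<open>v = u v\<^sub>0\<^sup>j\<close>, and \<open>P(u, u v\<^sub>0\<^sup>j) = c\<^sub>j\<close> does not depend on \<open>u\<close>, with \<open>c\<^sub>j \<noteq> 0\<close> only
  if right translation by \<open>v\<^sub>0\<^sup>j\<close> preserves the weights. So reducing subspaces correspond to convolution
  projections on \<open>\<int>\<close> supported on the periods of the weights, and all claims can be read off from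
  the coefficients \<open>c\<^sub>j\<close>. A non-trivial convolution projection comes from the discrete Hilbert transform.\<close>

section \<open>Square summable functions\<close>

text \<open>The obstacle is that the given period \<open>k\<close> need not be the least one. A
  coefficient \<open>c j \<noteq> 0\<close> makes \<open>j\<close> a period of the weights, and
  \<open>j\<close> is a multiple of \<open>k\<close> for certain only when \<open>k\<close> is the
  least period. For constant weights and \<open>k = 2\<close>, a reducing subspace with
  \<open>c 1 \<noteq> 0\<close> is not split by the classes modulo 2. So the decomposition of a
  given reducing subspace is tied to the least period, whereas the statements about
  \<open>U_per\<close> hold for every period; for them the subspace is first enlarged by modulations
  with roots of unity, which kill the coefficients outside the multiples of \<open>k\<close>.

  Fourier series would turn convolution projections on the integers into indicator functions on the
  circle. The indicator of a half circle has, up to a constant factor, the coefficients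
  \<open>1 / j\<close> at odd \<open>j\<close>, together with a constant at 0. This is the origin of
  the Hilbert transform here; the orthogonality of the two half circles is verified by telescoping
  sums instead of Fourier analysis.\<close>

lemma ell2_outside: "f \<in> ell2 X \<Longrightarrow> x \<notin> X \<Longrightarrow> f x = 0"
  by (simp add: ell2_def)

lemma ell2_summable: "f \<in> ell2 X \<Longrightarrow> (\<lambda>x. (cmod (f x))\<^sup>2) summable_on A"
  unfolding ell2_def using summable_on_subset_banach[of _ UNIV A] by blast

lemma ell2_mono: "X \<subseteq> Y \<Longrightarrow> ell2 X \<subseteq> ell2 Y"
  by (auto simp: ell2_def)

lemma ell2_dominated:
  assumes "f \<in> ell2 X" "\<And>x. cmod (g x) \<le> cmod (f x)"
  shows "g \<in> ell2 X"
proof -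
  have "(\<lambda>x. (cmod (g x))\<^sup>2) summable_on UNIV"
    by (rule summable_on_comparison_test[OF ell2_summable[OF assms(1)]])
      (auto intro: power_mono assms(2))
  moreover have "g x = 0" if "x \<notin> X" for x
    using assms(2)[of x] ell2_outside[OF assms(1) that] by simp
  ultimately show ?thesis by (simp add: ell2_def)
qed

lemma ell2_zero: "(\<lambda>x. 0) \<in> ell2 X"
  by (simp add: ell2_def)

lemma ell2_scale: "f \<in> ell2 X \<Longrightarrow> (\<lambda>x. c * f x) \<in> ell2 X"
  by (auto simp: ell2_def norm_mult power_mult_distrib intro!: summable_on_cmult_right)

lemma ell2_add:
  assumes "f \<in> ell2 X" "g \<in> ell2 X"
  shows "(\<lambda>x. f x + g x) \<in> ell2 X"
proof -
  have "(cmod (f x + g x))\<^sup>2 \<le> 2 * (cmod (f x))\<^sup>2 + 2 * (cmod (g x))\<^sup>2" for x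
  proof -
    have "(cmod (f x + g x))\<^sup>2 \<le> (cmod (f x) + cmod (g x))\<^sup>2"
      by (intro power_mono norm_triangle_ineq norm_ge_zero)
    also have "\<dots> \<le> 2 * (cmod (f x))\<^sup>2 + 2 * (cmod (g x))\<^sup>2"
      using sum_squares_bound[of "cmod (f x)" "cmod (g x)"] by (simp add: power2_sum)
    finally show ?thesis .
  qed
  moreover have "(\<lambda>x. 2 * (cmod (f x))\<^sup>2 + 2 * (cmod (g x))\<^sup>2) summable_on UNIV"
    using assms by (intro summable_on_add summable_on_cmult_right ell2_summable)
  ultimately have "(\<lambda>x. (cmod (f x + g x))\<^sup>2) summable_on UNIV"
    using summable_on_comparison_test[of "\<lambda>x. 2 * (cmod (f x))\<^sup>2 + 2 * (cmod (g x))\<^sup>2" UNIV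
        "\<lambda>x. (cmod (f x + g x))\<^sup>2"] by simp
  then show ?thesis using assms by (auto simp: ell2_def)
qed

lemma ell2_diff:
  assumes "f \<in> ell2 X" "g \<in> ell2 X"
  shows "(\<lambda>x. f x - g x) \<in> ell2 X"
  using ell2_add[OF assms(1) ell2_scale[OF assms(2), of "-1"]] by simp

lemma ell2_sum:
  assumes "\<And>i. i \<in> I \<Longrightarrow> f i \<in> ell2 X"
  shows "(\<lambda>x. \<Sum>i\<in>I. f i x) \<in> ell2 X"
  using assms
proof (induction I rule: infinite_finite_induct)
  case (insert i I)
  then show ?case using ell2_add[of "f i" X "\<lambda>x. \<Sum>i\<in>I. f i x"] by simp
qed (simp_all add: ell2_zero)

lemma ket_ell2:
  assumes "u \<in> X"
  shows "ket u \<in> ell2 X"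
proof -
  have "(\<lambda>x. (cmod (ket u x))\<^sup>2) summable_on UNIV"
    by (rule finite_nonzero_values_imp_summable_on)
      (rule finite_subset[of _ "{u}"], auto simp: ket_def)
  with assms show ?thesis by (auto simp: ell2_def ket_def)
qed

definition restr :: "'a set \<Rightarrow> 'a vec \<Rightarrow> 'a vec" where
  "restr I f = (\<lambda>x. if x \<in> I then f x else 0)"

lemma restr_ell2: "f \<in> ell2 X \<Longrightarrow> restr I f \<in> ell2 X"
  by (rule ell2_dominated[of f]) (auto simp: restr_def)

lemma restr_ell2': "f \<in> ell2 X \<Longrightarrow> restr I f \<in> ell2 I"
  using restr_ell2[of f X I] ell2_mono[of X UNIV] by (auto simp: ell2_def restr_def)

lemma restr_eq: "f \<in> ell2 I \<Longrightarrow> restr I f = f"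
  by (auto simp: restr_def ell2_outside)

lemma summable_cinner:
  assumes "f \<in> ell2 X" "g \<in> ell2 Y"
  shows "(\<lambda>x. f x * cnj (g x)) summable_on A"
proof -
  have "(\<lambda>x. norm (f x * cnj (g x))) summable_on A"
  proof (rule summable_on_comparison_test)
    show "(\<lambda>x. (cmod (f x))\<^sup>2 + (cmod (g x))\<^sup>2) summable_on A"
      by (intro summable_on_add ell2_summable[OF assms(1)] ell2_summable[OF assms(2)])
    fix x
    have "2 * cmod (f x) * cmod (g x) \<le> (cmod (f x))\<^sup>2 + (cmod (g x))\<^sup>2"
      by (rule sum_squares_bound)
    moreover have "0 \<le> cmod (f x) * cmod (g x)" by simp
    ultimately show "norm (f x * cnj (g x)) \<le> (cmod (f x))\<^sup>2 + (cmod (g x))\<^sup>2"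
      unfolding norm_mult complex_mod_cnj by linarith
  qed simp
  then show ?thesis by (rule abs_summable_summable)
qed

lemma cinner_commute: "cinner g f = cnj (cinner f g)"
  unfolding cinner_def infsum_cnj[symmetric] by (simp add: mult.commute)

lemma cinner_add_left:
  assumes "f \<in> ell2 X" "g \<in> ell2 Y" "h \<in> ell2 Z"
  shows "cinner (\<lambda>x. f x + g x) h = cinner f h + cinner g h"
  unfolding cinner_def distrib_right
  by (rule infsum_add) (use assms summable_cinner in blast)+

lemma cinner_scale_left: "cinner (\<lambda>x. c * f x) h = c * cinner f h"
  unfolding cinner_def mult.assoc by (rule infsum_cmult_right')

lemma cinner_diff_left:
  assumes "f \<in> ell2 X" "g \<in> ell2 Y" "h \<in> ell2 Z"
  shows "cinner (\<lambda>x. f x - g x) h = cinner f h - cinner g h"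
  using cinner_add_left[OF assms(1) ell2_scale[OF assms(2), of "-1"] assms(3)]
    cinner_scale_left[of "-1" g h] by simp

lemma cinner_add_right:
  assumes "f \<in> ell2 X" "g \<in> ell2 Y" "h \<in> ell2 Z"
  shows "cinner h (\<lambda>x. f x + g x) = cinner h f + cinner h g"
  using cinner_add_left[OF assms] by (simp add: cinner_commute[of h])

lemma cinner_scale_right: "cinner h (\<lambda>x. c * f x) = cnj c * cinner h f"
  by (simp add: cinner_commute[of h] cinner_scale_left)

lemma cinner_diff_right:
  assumes "f \<in> ell2 X" "g \<in> ell2 Y" "h \<in> ell2 Z"
  shows "cinner h (\<lambda>x. f x - g x) = cinner h f - cinner h g"
  using cinner_diff_left[OF assms] by (simp add: cinner_commute[of h])

lemma cinner_zero_left [simp]: "cinner (\<lambda>x. 0) f = 0"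
  and cinner_zero_right [simp]: "cinner f (\<lambda>x. 0) = 0"
  by (simp_all add: cinner_def)

lemma cinner_ket_right [simp]: "cinner f (ket x) = f x"
proof -
  have "cinner f (ket x) = infsum (\<lambda>y. f y * cnj (ket x y)) {x}"
    unfolding cinner_def by (rule infsum_cong_neutral) (auto simp: ket_def)
  then show ?thesis by (simp add: ket_def)
qed

lemma cinner_ket_left [simp]: "cinner (ket x) f = cnj (f x)"
  by (simp add: cinner_commute[of "ket x"])

lemma l2norm_nonneg [simp]: "0 \<le> l2norm f"
  by (simp add: l2norm_def infsum_nonneg)

lemma l2norm_power2: "(l2norm f)\<^sup>2 = (\<Sum>\<^sub>\<infinity>x. (cmod (f x))\<^sup>2)"
  by (simp add: l2norm_def infsum_nonneg)

lemma cinner_self: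
  assumes "f \<in> ell2 X"
  shows "cinner f f = complex_of_real ((l2norm f)\<^sup>2)"
  unfolding l2norm_power2 cinner_def complex_norm_square[symmetric]
  by (rule infsumI, rule has_sum_of_real, rule has_sum_infsum, rule ell2_summable, rule assms)

lemma l2norm_zero [simp]: "l2norm (\<lambda>x. 0) = 0"
  by (simp add: l2norm_def)

lemma l2norm_scale: "l2norm (\<lambda>x. c * f x) = cmod c * l2norm f"
  by (simp add: l2norm_def norm_mult power_mult_distrib infsum_cmult_right' real_sqrt_mult)

lemma l2norm_minus_commute: "l2norm (\<lambda>x. f x - g x) = l2norm (\<lambda>x. g x - f x)"
  by (simp add: l2norm_def norm_minus_commute)

lemma cmod_le_l2norm:
  assumes "f \<in> ell2 X"
  shows "cmod (f x) \<le> l2norm f"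
proof -
  have "infsum (\<lambda>y. (cmod (f y))\<^sup>2) {x} \<le> infsum (\<lambda>y. (cmod (f y))\<^sup>2) UNIV"
    by (rule infsum_mono_neutral) (use ell2_summable[OF assms] in auto)
  then have "(cmod (f x))\<^sup>2 \<le> (l2norm f)\<^sup>2" by (simp add: l2norm_power2)
  then show ?thesis by (rule power2_le_imp_le) simp
qed

lemma l2norm_eq_0_iff:
  assumes "f \<in> ell2 X"
  shows "l2norm f = 0 \<longleftrightarrow> f = (\<lambda>x. 0)"
proof
  assume "l2norm f = 0"
  then have "f x = 0" for x using cmod_le_l2norm[OF assms, of x] by simp
  then show "f = (\<lambda>x. 0)" by auto
qed simp

lemma cinner_self_eq_0_iff: "f \<in> ell2 X \<Longrightarrow> cinner f f = 0 \<longleftrightarrow> f = (\<lambda>x. 0)"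
  by (simp add: cinner_self l2norm_eq_0_iff)

lemma l2norm_diff_power2:
  assumes f: "f \<in> ell2 X" and g: "g \<in> ell2 X"
  shows "(l2norm (\<lambda>x. f x - g x))\<^sup>2 = (l2norm f)\<^sup>2 - 2 * Re (cinner f g) + (l2norm g)\<^sup>2"
proof -
  have "cinner (\<lambda>x. f x - g x) (\<lambda>x. f x - g x) =
      cinner f f - cinner f g - (cinner g f - cinner g g)"
    by (simp add: cinner_diff_left[OF f g ell2_diff[OF f g]] cinner_diff_right[OF f g f]
        cinner_diff_right[OF f g g])
  then have "Re (cinner (\<lambda>x. f x - g x) (\<lambda>x. f x - g x)) =
      Re (cinner f f - cinner f g - (cinner g f - cinner g g))"
    by (rule arg_cong)
  then show ?thesis
    by (simp add: cinner_self[OF f] cinner_self[OF g] cinner_self[OF ell2_diff[OF f g]] cinner_commute[of g f])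
qed

text \<open>\<open>c * g\<close> is the projection of \<open>f\<close> onto the line spanned by
  \<open>g\<close>; the inequality is the nonnegativity of the squared distance from
  \<open>f\<close> to it.\<close>

lemma cinner_Cauchy_Schwarz:
  assumes f: "f \<in> ell2 X" and g: "g \<in> ell2 X"
  shows "cmod (cinner f g) \<le> l2norm f * l2norm g"
proof (cases "l2norm g = 0")
  case True
  then have "g = (\<lambda>x. 0)" using l2norm_eq_0_iff[OF g] by simp
  then show ?thesis by simp
next
  case False
  define N where "N = (l2norm g)\<^sup>2"
  define c where "c = cinner f g / complex_of_real N"
  have N: "N > 0" using False by (simp add: N_def)
  have "cinner f (\<lambda>x. c * g x) = complex_of_real ((cmod (cinner f g))\<^sup>2 / N)"
    unfolding cinner_scale_right c_def
    by (simp add: complex_norm_square[symmetric] mult.commute)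
  moreover have "(l2norm (\<lambda>x. c * g x))\<^sup>2 = (cmod (cinner f g))\<^sup>2 / N"
    unfolding l2norm_scale power_mult_distrib c_def N_def[symmetric]
    using N by (simp add: norm_divide power_divide power2_eq_square)
  ultimately have "(l2norm (\<lambda>x. f x - c * g x))\<^sup>2 = (l2norm f)\<^sup>2 - (cmod (cinner f g))\<^sup>2 / N"
    using l2norm_diff_power2[OF f ell2_scale[OF g, of c]] by simp
  then have "(cmod (cinner f g))\<^sup>2 / N \<le> (l2norm f)\<^sup>2"
    using zero_le_power2[of "l2norm (\<lambda>x. f x - c * g x)"] by linarith
  then have "(cmod (cinner f g))\<^sup>2 \<le> (l2norm f * l2norm g)\<^sup>2"
    using N by (simp add: field_simps N_def power_mult_distrib)
  then show ?thesis by (rule power2_le_imp_le) simp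
qed

lemma l2norm_diff_triangle:
  assumes f: "f \<in> ell2 X" and g: "g \<in> ell2 X"
  shows "l2norm (\<lambda>x. f x - g x) \<le> l2norm f + l2norm g"
proof -
  have "\<bar>Re (cinner f g)\<bar> \<le> l2norm f * l2norm g"
    using cinner_Cauchy_Schwarz[OF f g] abs_Re_le_cmod order_trans by blast
  then have "(l2norm (\<lambda>x. f x - g x))\<^sup>2 \<le> (l2norm f + l2norm g)\<^sup>2"
    unfolding l2norm_diff_power2[OF f g] power2_sum by linarith
  then show ?thesis by (rule power2_le_imp_le) simp
qed

lemma l2norm_triangle:
  assumes f: "f \<in> ell2 X" and g: "g \<in> ell2 X"
  shows "l2norm (\<lambda>x. f x + g x) \<le> l2norm f + l2norm g"
  using l2norm_diff_triangle[OF f ell2_scale[OF g, of "-1"]] l2norm_scale[of "-1" g] by simp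

lemma l2norm_dist_triangle:
  assumes f: "f \<in> ell2 X" and g: "g \<in> ell2 X" and h: "h \<in> ell2 X"
  shows "l2norm (\<lambda>x. f x - h x) \<le> l2norm (\<lambda>x. f x - g x) + l2norm (\<lambda>x. g x - h x)"
  using l2norm_triangle[OF ell2_diff[OF f g] ell2_diff[OF g h]] by simp

lemma parallelogram:
  assumes f: "f \<in> ell2 X" and g: "g \<in> ell2 X"
  shows "(l2norm (\<lambda>x. f x + g x))\<^sup>2 + (l2norm (\<lambda>x. f x - g x))\<^sup>2 = 2 * (l2norm f)\<^sup>2 + 2 * (l2norm g)\<^sup>2"
proof -
  have "cinner f (\<lambda>x. - 1 * g x) = - cinner f g"
    by (subst cinner_scale_right) simp
  then show ?thesis
    using l2norm_diff_power2[OF f g] l2norm_diff_power2[OF f ell2_scale[OF g, of "-1"]]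
      l2norm_scale[of "-1" g] by simp
qed

lemma Metric_space_ell2: "Metric_space (ell2 X) (\<lambda>f g. l2norm (\<lambda>x. f x - g x))"
proof
  fix f g :: "'a vec" assume f: "f \<in> ell2 X" and g: "g \<in> ell2 X"
  show "(l2norm (\<lambda>x. f x - g x) = 0) = (f = g)"
    using l2norm_eq_0_iff[OF ell2_diff[OF f g]] by (auto simp: fun_eq_iff)
qed (auto intro: l2norm_minus_commute l2norm_dist_triangle)

text \<open>In a metric topology closed means sequentially closed. Below, the topology on the
  vectors enters only through this criterion.\<close>

lemma closedin_l2_topology_iff:
  "closedin (l2_topology (ell2 X)) M \<longleftrightarrow> M \<subseteq> ell2 X \<and>
    (\<forall>\<sigma> f. range \<sigma> \<subseteq> M \<and> f \<in> ell2 X \<and> (\<lambda>n. l2norm (\<lambda>x. \<sigma> n x - f x)) \<longlonglongrightarrow> 0 \<longrightarrow> f \<in> M)"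
proof -
  interpret Metric_space "ell2 X" "\<lambda>f g. l2norm (\<lambda>x. f x - g x)"
    by (rule Metric_space_ell2)
  have "limitin mtopology \<sigma> f sequentially \<longleftrightarrow>
      f \<in> ell2 X \<and> (\<lambda>n. l2norm (\<lambda>x. \<sigma> n x - f x)) \<longlonglongrightarrow> 0"
    if "M \<subseteq> ell2 X" "range \<sigma> \<subseteq> M" for \<sigma> f
  proof -
    have "\<sigma> n \<in> ell2 X" for n using that by auto
    then show ?thesis by (simp add: limitin_metric_dist_null)
  qed
  then show ?thesis
    unfolding l2_topology_def metric_closedin_iff_sequentially_closed by meson
qed

text \<open>Coordinates are bounded by the norm, so a Cauchy sequence converges pointwise. The norm
  bounds are bounds on finite sums, and these pass to the pointwise limit.\<close>

lemma ell2_complete: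
  assumes \<sigma>: "\<And>n. \<sigma> n \<in> ell2 X"
    and cau: "\<And>e. e > 0 \<Longrightarrow> \<exists>N. \<forall>m\<ge>N. \<forall>n\<ge>N. l2norm (\<lambda>x. \<sigma> m x - \<sigma> n x) < e"
  shows "\<exists>f\<in>ell2 X. (\<lambda>n. l2norm (\<lambda>x. \<sigma> n x - f x)) \<longlonglongrightarrow> 0"
proof -
  have "\<exists>l. (\<lambda>n. \<sigma> n x) \<longlonglongrightarrow> l" for x
  proof -
    have "Cauchy (\<lambda>n. \<sigma> n x)"
    proof (rule metric_CauchyI)
      fix e :: real assume "e > 0"
      from cau[OF this] obtain N where N: "\<And>m n. m \<ge> N \<Longrightarrow> n \<ge> N \<Longrightarrow> l2norm (\<lambda>x. \<sigma> m x - \<sigma> n x) < e"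
        by blast
      have "dist (\<sigma> m x) (\<sigma> n x) < e" if "m \<ge> N" "n \<ge> N" for m n
        using N[OF that] cmod_le_l2norm[OF ell2_diff[OF \<sigma>[of m] \<sigma>[of n]], of x]
        by (simp add: dist_norm)
      then show "\<exists>M. \<forall>m\<ge>M. \<forall>n\<ge>M. dist (\<sigma> m x) (\<sigma> n x) < e" by blast
    qed
    then show ?thesis by (simp add: Cauchy_convergent_iff convergent_def)
  qed
  then obtain f where f: "\<And>x. (\<lambda>n. \<sigma> n x) \<longlonglongrightarrow> f x" by metis
  have key: "(\<lambda>x. \<sigma> m x - f x) \<in> ell2 X \<and> l2norm (\<lambda>x. \<sigma> m x - f x) \<le> e"
    if e: "e > 0" and m: "\<And>n. n \<ge> N \<Longrightarrow> l2norm (\<lambda>x. \<sigma> m x - \<sigma> n x) < e" for m N e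
  proof -
    have fin: "(\<Sum>x\<in>A. (cmod (\<sigma> m x - f x))\<^sup>2) \<le> e\<^sup>2" for A
    proof (rule LIMSEQ_le_const2)
      show "(\<lambda>n. \<Sum>x\<in>A. (cmod (\<sigma> m x - \<sigma> n x))\<^sup>2) \<longlonglongrightarrow> (\<Sum>x\<in>A. (cmod (\<sigma> m x - f x))\<^sup>2)"
        by (intro tendsto_intros f)
      show "\<exists>N. \<forall>n\<ge>N. (\<Sum>x\<in>A. (cmod (\<sigma> m x - \<sigma> n x))\<^sup>2) \<le> e\<^sup>2"
      proof (intro exI allI impI)
        fix n assume "N \<le> n"
        show "(\<Sum>x\<in>A. (cmod (\<sigma> m x - \<sigma> n x))\<^sup>2) \<le> e\<^sup>2"
        proof (cases "finite A")
          case True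
          have "(\<Sum>x\<in>A. (cmod (\<sigma> m x - \<sigma> n x))\<^sup>2) \<le> (l2norm (\<lambda>x. \<sigma> m x - \<sigma> n x))\<^sup>2"
            unfolding l2norm_power2
            by (rule finite_sum_le_infsum)
              (use True ell2_summable[OF ell2_diff[OF \<sigma>[of m] \<sigma>[of n]]] in auto)
          also have "\<dots> \<le> e\<^sup>2"
            using m[OF \<open>N \<le> n\<close>] by (intro power_mono) auto
          finally show ?thesis .
        qed simp
      qed
    qed
    have summ: "(\<lambda>x. (cmod (\<sigma> m x - f x))\<^sup>2) summable_on UNIV"
      by (rule nonneg_bounded_partial_sums_imp_summable_on) (use fin in auto)
    have "f x = 0" if "x \<notin> X" for x
      using f[of x] ell2_outside[OF \<sigma> that] by (simp add: LIMSEQ_const_iff)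
    then have 1: "(\<lambda>x. \<sigma> m x - f x) \<in> ell2 X"
      using summ ell2_outside[OF \<sigma>] by (simp add: ell2_def)
    have "(l2norm (\<lambda>x. \<sigma> m x - f x))\<^sup>2 \<le> e\<^sup>2"
      unfolding l2norm_power2
      by (rule infsum_le_finite_sums) (use summ fin in auto)
    then have "l2norm (\<lambda>x. \<sigma> m x - f x) \<le> e"
      using e by (auto dest: power2_le_imp_le)
    with 1 show ?thesis by blast
  qed
  obtain N where N: "\<And>m n. m \<ge> N \<Longrightarrow> n \<ge> N \<Longrightarrow> l2norm (\<lambda>x. \<sigma> m x - \<sigma> n x) < 1"
    using cau[of 1] by auto
  have "(\<lambda>x. \<sigma> N x - f x) \<in> ell2 X"
    using key[of 1 N N] N by simp
  from ell2_diff[OF \<sigma>[of N] this] have "f \<in> ell2 X" by simp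
  moreover have "(\<lambda>n. l2norm (\<lambda>x. \<sigma> n x - f x)) \<longlonglongrightarrow> 0"
  proof (rule LIMSEQ_I)
    fix r :: real assume r: "r > 0"
    then obtain N where N: "\<And>m n. m \<ge> N \<Longrightarrow> n \<ge> N \<Longrightarrow> l2norm (\<lambda>x. \<sigma> m x - \<sigma> n x) < r / 2"
      using cau[of "r / 2"] by auto
    have "l2norm (\<lambda>x. \<sigma> n x - f x) \<le> r / 2" if "n \<ge> N" for n
      using key[of "r / 2" N n] r N[OF that] by simp
    then show "\<exists>no. \<forall>n\<ge>no. norm (l2norm (\<lambda>x. \<sigma> n x - f x) - 0) < r"
      using r by (intro exI[of _ N]) fastforce
  qed
  ultimately show ?thesis by blast
qed

section \<open>Closed subspaces and projections\<close>

lemma closed_subspace_subset: "closed_subspace K M \<Longrightarrow> M \<subseteq> K"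
  and closed_subspace_zero: "closed_subspace K M \<Longrightarrow> (\<lambda>x. 0) \<in> M"
  and closed_subspace_add: "closed_subspace K M \<Longrightarrow> f \<in> M \<Longrightarrow> g \<in> M \<Longrightarrow> (\<lambda>x. f x + g x) \<in> M"
  and closed_subspace_scale: "closed_subspace K M \<Longrightarrow> f \<in> M \<Longrightarrow> (\<lambda>x. c * f x) \<in> M"
  by (simp_all add: closed_subspace_def)

lemma closed_subspace_ell2: "closed_subspace (ell2 X) M \<Longrightarrow> f \<in> M \<Longrightarrow> f \<in> ell2 X"
  using closed_subspace_subset by blast

lemma closed_subspace_diff:
  assumes "closed_subspace K M" "f \<in> M" "g \<in> M"
  shows "(\<lambda>x. f x - g x) \<in> M"
  using closed_subspace_add[OF assms(1,2) closed_subspace_scale[OF assms(1,3), of "-1"]] by simp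

lemma closed_subspace_sum:
  assumes "closed_subspace K M" "\<And>i. i \<in> I \<Longrightarrow> f i \<in> M"
  shows "(\<lambda>x. \<Sum>i\<in>I. f i x) \<in> M"
  using assms(2)
proof (induction I rule: infinite_finite_induct)
  case (insert i I)
  then show ?case using closed_subspace_add[OF assms(1), of "f i" "\<lambda>x. \<Sum>i\<in>I. f i x"] by simp
qed (simp_all add: closed_subspace_zero[OF assms(1)])

lemma closed_subspace_limit:
  assumes "closed_subspace (ell2 X) M" "\<And>n. \<sigma> n \<in> M" "f \<in> ell2 X"
    "(\<lambda>n. l2norm (\<lambda>x. \<sigma> n x - f x)) \<longlonglongrightarrow> 0"
  shows "f \<in> M"
  using assms unfolding closed_subspace_def closedin_l2_topology_iff by blast

lemma closed_subspaceI:
  assumes "M \<subseteq> ell2 X" "(\<lambda>x. 0) \<in> M"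
    "\<And>f g. f \<in> M \<Longrightarrow> g \<in> M \<Longrightarrow> (\<lambda>x. f x + g x) \<in> M"
    "\<And>c f. f \<in> M \<Longrightarrow> (\<lambda>x. c * f x) \<in> M"
    "\<And>\<sigma> f. (\<And>n. \<sigma> n \<in> M) \<Longrightarrow> f \<in> ell2 X \<Longrightarrow> (\<lambda>n. l2norm (\<lambda>x. \<sigma> n x - f x)) \<longlonglongrightarrow> 0 \<Longrightarrow> f \<in> M"
  shows "closed_subspace (ell2 X) M"
proof -
  have "f \<in> M" if "range \<sigma> \<subseteq> M" "f \<in> ell2 X" "(\<lambda>n. l2norm (\<lambda>x. \<sigma> n x - f x)) \<longlonglongrightarrow> 0" for \<sigma> f
    by (rule assms(5)[OF _ that(2,3)]) (use that(1) in auto)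
  then show ?thesis
    unfolding closed_subspace_def closedin_l2_topology_iff using assms(1-4) by blast
qed

lemma cinner_limit_zero:
  assumes \<sigma>: "\<And>n. \<sigma> n \<in> ell2 X" and f: "f \<in> ell2 X" and g: "g \<in> ell2 X"
    and lim: "(\<lambda>n. l2norm (\<lambda>x. \<sigma> n x - f x)) \<longlonglongrightarrow> 0" and z: "\<And>n. cinner (\<sigma> n) g = 0"
  shows "cinner f g = 0"
proof -
  have "cmod (cinner f g) \<le> l2norm (\<lambda>x. \<sigma> n x - f x) * l2norm g" for n
    using cinner_Cauchy_Schwarz[OF ell2_diff[OF \<sigma>[of n] f] g] cinner_diff_left[OF \<sigma>[of n] f g]
    by (simp add: z)
  moreover have "(\<lambda>n. l2norm (\<lambda>x. \<sigma> n x - f x) * l2norm g) \<longlonglongrightarrow> 0 * l2norm g"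
    by (intro tendsto_mult lim tendsto_const)
  ultimately have "cmod (cinner f g) \<le> 0 * l2norm g"
    by (intro LIMSEQ_le_const[where a = "cmod (cinner f g)"]) auto
  then show ?thesis by simp
qed

lemma closed_subspace_whole: "closed_subspace (ell2 X) (ell2 X)"
  by (rule closed_subspaceI) (auto intro: ell2_zero ell2_add ell2_scale)

lemma closed_subspace_trivial: "closed_subspace (ell2 X) {\<lambda>x. 0}"
proof (rule closed_subspaceI)
  fix \<sigma> and f :: "'a vec"
  assume "\<And>n :: nat. \<sigma> n \<in> {\<lambda>x. 0}" "f \<in> ell2 X" "(\<lambda>n. l2norm (\<lambda>x. \<sigma> n x - f x)) \<longlonglongrightarrow> 0"
  moreover from this have "\<sigma> = (\<lambda>n x. 0)" by auto
  ultimately have "l2norm (\<lambda>x. 0 - f x) = 0" by (simp add: LIMSEQ_const_iff)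
  with \<open>f \<in> ell2 X\<close> show "f \<in> {\<lambda>x. 0}"
    using l2norm_minus_commute[of "\<lambda>x. 0" f] l2norm_eq_0_iff[of f X] by simp
qed (auto simp: ell2_zero)

lemma closed_subspace_orthogonal:
  assumes "\<Phi> \<subseteq> ell2 X"
  shows "closed_subspace (ell2 X) {f \<in> ell2 X. \<forall>g\<in>\<Phi>. cinner f g = 0}"
proof (rule closed_subspaceI)
  fix \<sigma> and f :: "'a vec"
  assume \<sigma>: "\<And>n :: nat. \<sigma> n \<in> {f \<in> ell2 X. \<forall>g\<in>\<Phi>. cinner f g = 0}" and f: "f \<in> ell2 X"
    and lim: "(\<lambda>n. l2norm (\<lambda>x. \<sigma> n x - f x)) \<longlonglongrightarrow> 0"
  then show "f \<in> {f \<in> ell2 X. \<forall>g\<in>\<Phi>. cinner f g = 0}"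
    using cinner_limit_zero[of \<sigma> X f] assms by blast
next
  fix f h assume fh: "f \<in> {f \<in> ell2 X. \<forall>g\<in>\<Phi>. cinner f g = 0}" "h \<in> {f \<in> ell2 X. \<forall>g\<in>\<Phi>. cinner f g = 0}"
  have "cinner (\<lambda>x. f x + h x) g = 0" if "g \<in> \<Phi>" for g
    using cinner_add_left[of f X h X g X] fh that assms by auto
  with fh show "(\<lambda>x. f x + h x) \<in> {f \<in> ell2 X. \<forall>g\<in>\<Phi>. cinner f g = 0}"
    by (auto intro: ell2_add)
qed (auto simp: ell2_zero cinner_scale_left intro: ell2_scale)

lemma closed_subspace_Inter:
  assumes "\<And>M. M \<in> \<M> \<Longrightarrow> closed_subspace (ell2 X) M" "\<M> \<noteq> {}"
  shows "closed_subspace (ell2 X) (\<Inter>\<M>)"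
proof (rule closed_subspaceI)
  fix \<sigma> and f :: "'a vec"
  assume *: "\<And>n :: nat. \<sigma> n \<in> \<Inter>\<M>" "f \<in> ell2 X" "(\<lambda>n. l2norm (\<lambda>x. \<sigma> n x - f x)) \<longlonglongrightarrow> 0"
  show "f \<in> \<Inter>\<M>"
  proof
    fix M assume "M \<in> \<M>"
    then show "f \<in> M" using closed_subspace_limit[OF assms(1), of M \<sigma> f] * by auto
  qed
next
  show "\<Inter>\<M> \<subseteq> ell2 X" using assms closed_subspace_subset by blast
qed (auto dest: assms(1) intro: closed_subspace_zero closed_subspace_add closed_subspace_scale)

text \<open>The projection is the nearest point of \<open>M\<close>: a minimizing sequence is Cauchy
  by the parallelogram law, and at a nearest point the residual is orthogonal to
  \<open>M\<close>.\<close>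

lemma ex_orthogonal_projection:
  assumes M: "closed_subspace (ell2 X) M" and f: "f \<in> ell2 X"
  shows "\<exists>g\<in>M. \<forall>h\<in>M. cinner (\<lambda>x. f x - g x) h = 0"
proof -
  note in_ell2 = closed_subspace_ell2[OF M]
  define D where "D = (\<lambda>g. (l2norm (\<lambda>x. f x - g x))\<^sup>2) ` M"
  define d where "d = Inf D"
  have bdd: "bdd_below D" by (intro bdd_belowI[of _ 0]) (auto simp: D_def)
  have ne: "D \<noteq> {}" using closed_subspace_zero[OF M] by (auto simp: D_def)
  have d_le: "d \<le> (l2norm (\<lambda>x. f x - g x))\<^sup>2" if "g \<in> M" for g
    unfolding d_def by (rule cInf_lower[OF _ bdd]) (use that in \<open>auto simp: D_def\<close>)
  have "\<exists>g\<in>M. (l2norm (\<lambda>x. f x - g x))\<^sup>2 < d + inverse (Suc n)" for n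
  proof -
    have "d < d + inverse (Suc n)" by simp
    then obtain t where "t \<in> D" "t < d + inverse (Suc n)"
      using cInf_lessD[OF ne, of "d + inverse (Suc n)"] by (auto simp: d_def)
    then show ?thesis by (auto simp: D_def)
  qed
  then obtain \<sigma> where \<sigma>: "\<And>n. \<sigma> n \<in> M" and close: "\<And>n. (l2norm (\<lambda>x. f x - \<sigma> n x))\<^sup>2 < d + inverse (Suc n)"
    by metis
  \<comment> \<open>Parallelogram law for \<open>f - g\<close> and \<open>f - h\<close>: half their
    sum is \<open>f - (g + h) / 2\<close>, whose squared norm is at least \<open>d\<close> because
    the midpoint lies in \<open>M\<close>.\<close>
  have near: "(l2norm (\<lambda>x. g x - h x))\<^sup>2 \<le> 2 * (s - d) + 2 * (t - d)"
    if "g \<in> M" "h \<in> M" "(l2norm (\<lambda>x. f x - g x))\<^sup>2 \<le> s" "(l2norm (\<lambda>x. f x - h x))\<^sup>2 \<le> t" for g h s t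
  proof -
    have mid: "(\<lambda>x. (1 / 2) * (g x + h x)) \<in> M"
      by (rule closed_subspace_scale[OF M closed_subspace_add[OF M that(1,2)]])
    have "(\<lambda>x. (f x - g x) + (f x - h x)) = (\<lambda>x. 2 * (f x - (1 / 2) * (g x + h x)))"
      by (auto simp: algebra_simps)
    then have "(l2norm (\<lambda>x. (f x - g x) + (f x - h x)))\<^sup>2 = (cmod 2 * l2norm (\<lambda>x. f x - (1 / 2) * (g x + h x)))\<^sup>2"
      by (simp only: l2norm_scale)
    then have "(l2norm (\<lambda>x. (f x - g x) + (f x - h x)))\<^sup>2 = 4 * (l2norm (\<lambda>x. f x - (1 / 2) * (g x + h x)))\<^sup>2"
      by (simp only: power_mult_distrib) simp
    moreover have "l2norm (\<lambda>x. (f x - g x) - (f x - h x)) = l2norm (\<lambda>x. g x - h x)"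
      using l2norm_minus_commute[of g h] by simp
    ultimately show ?thesis
      using parallelogram[OF ell2_diff[OF f in_ell2[OF that(1)]] ell2_diff[OF f in_ell2[OF that(2)]]]
        d_le[OF mid] that(3,4) by simp
  qed
  have "\<exists>g\<in>ell2 X. (\<lambda>n. l2norm (\<lambda>x. \<sigma> n x - g x)) \<longlonglongrightarrow> 0"
  proof (rule ell2_complete)
    fix e :: real assume e: "e > 0"
    obtain N where N': "inverse (real (Suc N)) < e\<^sup>2 / 4"
      using reals_Archimedean[of "e\<^sup>2 / 4"] e by auto
    define t where "t = inverse (real (Suc N))"
    have N: "t < e\<^sup>2 / 4" using N' by (simp add: t_def)
    have "l2norm (\<lambda>x. \<sigma> m x - \<sigma> n x) < e" if "m \<ge> N" "n \<ge> N" for m n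
    proof -
      have le: "(l2norm (\<lambda>x. f x - \<sigma> k x))\<^sup>2 \<le> d + t" if "k \<ge> N" for k
      proof -
        have "inverse (real (Suc k)) \<le> inverse (real (Suc N))" using that by simp
        with close[of k] show ?thesis unfolding t_def by linarith
      qed
      have "(l2norm (\<lambda>x. \<sigma> m x - \<sigma> n x))\<^sup>2 < e\<^sup>2"
      proof (rule le_less_trans)
        show "(l2norm (\<lambda>x. \<sigma> m x - \<sigma> n x))\<^sup>2 \<le> 4 * t"
          using near[OF \<sigma>[of m] \<sigma>[of n] le[OF that(1)] le[OF that(2)]] by simp
        show "4 * t < e\<^sup>2" using N by simp
      qed
      then show ?thesis by (rule power2_less_imp_less) (use e in simp)
    qed
    then show "\<exists>N. \<forall>m\<ge>N. \<forall>n\<ge>N. l2norm (\<lambda>x. \<sigma> m x - \<sigma> n x) < e" by blast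
  qed (rule in_ell2[OF \<sigma>])
  then obtain g where g: "g \<in> ell2 X" and lim: "(\<lambda>n. l2norm (\<lambda>x. \<sigma> n x - g x)) \<longlonglongrightarrow> 0" by blast
  have gM: "g \<in> M" by (rule closed_subspace_limit[OF M \<sigma> g lim])
  have gd: "(l2norm (\<lambda>x. f x - g x))\<^sup>2 \<le> d"
  proof -
    have "l2norm (\<lambda>x. f x - g x) \<le> sqrt (d + inverse (Suc n)) + l2norm (\<lambda>x. \<sigma> n x - g x)" for n
    proof -
      have "l2norm (\<lambda>x. f x - g x) \<le> l2norm (\<lambda>x. f x - \<sigma> n x) + l2norm (\<lambda>x. \<sigma> n x - g x)"
        by (rule l2norm_dist_triangle[OF f in_ell2[OF \<sigma>] g])
      moreover have "l2norm (\<lambda>x. f x - \<sigma> n x) \<le> sqrt (d + inverse (Suc n))"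
        by (rule real_le_rsqrt) (use close[of n] in simp)
      ultimately show ?thesis by linarith
    qed
    moreover have "(\<lambda>n. sqrt (d + inverse (Suc n)) + l2norm (\<lambda>x. \<sigma> n x - g x)) \<longlonglongrightarrow> sqrt (d + 0) + 0"
      by (intro tendsto_intros lim LIMSEQ_inverse_real_of_nat)
    ultimately have "l2norm (\<lambda>x. f x - g x) \<le> sqrt (d + 0) + 0"
      by (intro LIMSEQ_le_const[where a = "l2norm (\<lambda>x. f x - g x)"]) auto
    then have le: "l2norm (\<lambda>x. f x - g x) \<le> sqrt d" by simp
    have "0 \<le> sqrt d" using l2norm_nonneg le order_trans by blast
    with power_mono[OF le, of 2] show ?thesis by simp
  qed
  have "cinner (\<lambda>x. f x - g x) h = 0" if h: "h \<in> M" for h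
  proof (cases "l2norm h = 0")
    case True
    then have "h = (\<lambda>x. 0)" using l2norm_eq_0_iff[OF in_ell2[OF h]] by simp
    then show ?thesis by simp
  next
    case False
    define N where "N = (l2norm h)\<^sup>2"
    define c where "c = cinner (\<lambda>x. f x - g x) h"
    have N: "N > 0" using False by (simp add: N_def)
    \<comment> \<open>If the residual had a nonzero component \<open>k\<close> along
      \<open>h\<close>, moving from \<open>g\<close> by \<open>k\<close> inside \<open>M\<close>
      would lower the squared distance by \<open>(cmod c)^2 / N\<close>, below the infimum.\<close>
    define k where "k = (\<lambda>x. (c / complex_of_real N) * h x)"
    have kM: "k \<in> M" unfolding k_def by (rule closed_subspace_scale[OF M h])
    have "(\<lambda>x. (f x - g x) - k x) = (\<lambda>x. f x - (g x + k x))" by auto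
    then have "d \<le> (l2norm (\<lambda>x. (f x - g x) - k x))\<^sup>2"
      using d_le[OF closed_subspace_add[OF M gM kM]] by simp
    also have "\<dots> = (l2norm (\<lambda>x. f x - g x))\<^sup>2 - 2 * Re (cinner (\<lambda>x. f x - g x) k) + (l2norm k)\<^sup>2"
      by (rule l2norm_diff_power2[OF ell2_diff[OF f g] in_ell2[OF kM]])
    also have "cinner (\<lambda>x. f x - g x) k = complex_of_real ((cmod c)\<^sup>2 / N)"
      unfolding k_def cinner_scale_right c_def[symmetric]
      by (simp add: complex_norm_square[symmetric] mult.commute)
    also have "(l2norm k)\<^sup>2 = (cmod c)\<^sup>2 / N"
      unfolding k_def l2norm_scale power_mult_distrib N_def[symmetric]
      using N by (simp add: norm_divide power_divide power2_eq_square)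
    finally have "(cmod c)\<^sup>2 / N \<le> 0" using gd by simp
    then have "(cmod c)\<^sup>2 \<le> 0" using N by (simp add: divide_le_0_iff)
    then show ?thesis by (simp add: c_def)
  qed
  with gM show ?thesis by blast
qed

lemma orthogonal_projection_unique:
  assumes M: "closed_subspace (ell2 X) M" and f: "f \<in> ell2 X"
    and g: "g \<in> M" "\<And>h. h \<in> M \<Longrightarrow> cinner (\<lambda>x. f x - g x) h = 0"
    and g': "g' \<in> M" "\<And>h. h \<in> M \<Longrightarrow> cinner (\<lambda>x. f x - g' x) h = 0"
  shows "g = g'"
proof -
  note in_ell2 = closed_subspace_ell2[OF M]
  let ?h = "\<lambda>x. g x - g' x"
  have h: "?h \<in> M" by (rule closed_subspace_diff[OF M g(1) g'(1)])
  have "(\<lambda>x. (f x - g' x) - (f x - g x)) = ?h" by auto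
  then have "cinner ?h ?h = 0"
    using cinner_diff_left[OF ell2_diff[OF f in_ell2[OF g'(1)]] ell2_diff[OF f in_ell2[OF g(1)]] in_ell2[OF h]]
      g(2)[OF h] g'(2)[OF h] by simp
  then have "?h = (\<lambda>x. 0)" using cinner_self_eq_0_iff[OF in_ell2[OF h]] by simp
  then show ?thesis by (auto simp: fun_eq_iff)
qed

lemma proj_eqI:
  assumes M: "closed_subspace (ell2 X) M" and f: "f \<in> ell2 X"
    and g: "g \<in> M" "\<And>h. h \<in> M \<Longrightarrow> cinner (\<lambda>x. f x - g x) h = 0"
  shows "proj (ell2 X) M f = g"
  unfolding proj_def using f
  by (auto intro!: the_equality g orthogonal_projection_unique[OF M f])

lemma proj_in:
  assumes M: "closed_subspace (ell2 X) M" and f: "f \<in> ell2 X"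
  shows "proj (ell2 X) M f \<in> M"
  using ex_orthogonal_projection[OF assms] proj_eqI[OF assms] by metis

lemma proj_orthogonal:
  assumes M: "closed_subspace (ell2 X) M" and f: "f \<in> ell2 X" and h: "h \<in> M"
  shows "cinner (\<lambda>x. f x - proj (ell2 X) M f x) h = 0"
  using ex_orthogonal_projection[OF M f] proj_eqI[OF M f] h by metis

lemma proj_ell2:
  assumes M: "closed_subspace (ell2 X) M" and f: "f \<in> ell2 X"
  shows "proj (ell2 X) M f \<in> ell2 X"
  using proj_in[OF assms] closed_subspace_ell2[OF M] by blast

lemma proj_fixed:
  assumes M: "closed_subspace (ell2 X) M" and f: "f \<in> M"
  shows "proj (ell2 X) M f = f"
  by (rule proj_eqI[OF M closed_subspace_ell2[OF M f] f]) simp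

lemma cinner_proj:
  assumes M: "closed_subspace (ell2 X) M" and f: "f \<in> ell2 X" and h: "h \<in> M"
  shows "cinner (proj (ell2 X) M f) h = cinner f h"
  using cinner_diff_left[OF f proj_ell2[OF M f] closed_subspace_ell2[OF M h]]
    proj_orthogonal[OF assms] by simp

lemma proj_selfadjoint:
  assumes M: "closed_subspace (ell2 X) M" and f: "f \<in> ell2 X" and g: "g \<in> ell2 X"
  shows "cinner (proj (ell2 X) M f) g = cinner f (proj (ell2 X) M g)"
proof -
  have "cinner (proj (ell2 X) M f) g = cnj (cinner g (proj (ell2 X) M f))"
    by (rule cinner_commute)
  also have "\<dots> = cnj (cinner (proj (ell2 X) M g) (proj (ell2 X) M f))"
    by (simp add: cinner_proj[OF M g proj_in[OF M f]])
  also have "\<dots> = cinner (proj (ell2 X) M f) (proj (ell2 X) M g)"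
    by (rule cinner_commute[symmetric])
  also have "\<dots> = cinner f (proj (ell2 X) M g)"
    by (rule cinner_proj[OF M f proj_in[OF M g]])
  finally show ?thesis .
qed

section \<open>Bounded operators\<close>

lemma bop_maps: "A \<in> bop D E \<Longrightarrow> f \<in> D \<Longrightarrow> A f \<in> E"
  by (auto simp: bop_def)

lemma bop_add: "A \<in> bop D E \<Longrightarrow> f \<in> D \<Longrightarrow> g \<in> D \<Longrightarrow> A (\<lambda>x. f x + g x) = (\<lambda>x. A f x + A g x)"
  by (auto simp: bop_def)

lemma bop_scale: "A \<in> bop D E \<Longrightarrow> f \<in> D \<Longrightarrow> A (\<lambda>x. c * f x) = (\<lambda>x. c * A f x)"
  by (auto simp: bop_def)

lemma bop_diff:
  assumes "A \<in> bop (ell2 X) E" "f \<in> ell2 X" "g \<in> ell2 X"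
  shows "A (\<lambda>x. f x - g x) = (\<lambda>x. A f x - A g x)"
  using bop_add[OF assms(1,2) ell2_scale[OF assms(3), of "-1"]] bop_scale[OF assms(1,3), of "-1"]
  by simp

lemma bop_zero:
  assumes "A \<in> bop (ell2 X) E"
  shows "A (\<lambda>x. 0) = (\<lambda>x. 0)"
  using bop_scale[OF assms ell2_zero, of 0] by simp

lemma bop_bounded: "A \<in> bop D E \<Longrightarrow> \<exists>C\<ge>0. \<forall>f\<in>D. l2norm (A f) \<le> C * l2norm f"
proof -
  assume "A \<in> bop D E"
  then obtain C where C: "\<And>f. f \<in> D \<Longrightarrow> l2norm (A f) \<le> C * l2norm f"
    unfolding bop_def by blast
  have "l2norm (A f) \<le> \<bar>C\<bar> * l2norm f" if "f \<in> D" for f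
    by (rule order_trans[OF C[OF that] mult_right_mono]) auto
  then show ?thesis by (intro exI[of _ "\<bar>C\<bar>"]) auto
qed

lemma bop_extensional: "A \<in> bop D E \<Longrightarrow> A \<in> extensional D"
  by (auto simp: bop_def PiE_def)

lemma bopI:
  assumes "A \<in> extensional D" "\<And>f. f \<in> D \<Longrightarrow> A f \<in> E"
    "\<And>f g. f \<in> D \<Longrightarrow> g \<in> D \<Longrightarrow> A (\<lambda>x. f x + g x) = (\<lambda>x. A f x + A g x)"
    "\<And>c f. f \<in> D \<Longrightarrow> A (\<lambda>x. c * f x) = (\<lambda>x. c * A f x)"
    "\<And>f. f \<in> D \<Longrightarrow> l2norm (A f) \<le> C * l2norm f"
  shows "A \<in> bop D E"
  using assms by (auto simp: bop_def PiE_def intro!: exI[of _ C])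

lemma bop_compose:
  assumes A: "A \<in> bop (ell2 Y) F" and B: "B \<in> bop (ell2 X) (ell2 Y)"
  shows "compose (ell2 X) A B \<in> bop (ell2 X) F"
proof -
  obtain C where C: "C \<ge> 0" "\<And>f. f \<in> ell2 Y \<Longrightarrow> l2norm (A f) \<le> C * l2norm f"
    using bop_bounded[OF A] by blast
  obtain C' where C': "C' \<ge> 0" "\<And>f. f \<in> ell2 X \<Longrightarrow> l2norm (B f) \<le> C' * l2norm f"
    using bop_bounded[OF B] by blast
  show ?thesis
  proof (rule bopI)
    fix f assume f: "f \<in> ell2 X"
    have "l2norm (A (B f)) \<le> C * l2norm (B f)" by (rule C(2)[OF bop_maps[OF B f]])
    also have "\<dots> \<le> C * (C' * l2norm f)" by (rule mult_left_mono[OF C'(2)[OF f] C(1)])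
    finally show "l2norm (compose (ell2 X) A B f) \<le> (C * C') * l2norm f"
      using f by (simp add: compose_def)
  qed (simp_all add: compose_def ell2_add ell2_scale bop_maps[OF B] bop_maps[OF A]
      bop_add[OF B] bop_add[OF A] bop_scale[OF B] bop_scale[OF A])
qed

lemma bop_id: "(\<lambda>f\<in>ell2 X. f) \<in> bop (ell2 X) (ell2 X)"
  by (rule bopI[where C = 1]) (simp_all add: ell2_add ell2_scale)

lemma proj_bop:
  assumes M: "closed_subspace (ell2 X) M"
  shows "proj (ell2 X) M \<in> bop (ell2 X) (ell2 X)"
proof (rule bopI)
  show "proj (ell2 X) M \<in> extensional (ell2 X)" by (simp add: proj_def)
next
  fix f g assume f: "f \<in> ell2 X" and g: "g \<in> ell2 X"
  note Pf = proj_ell2[OF M f] and Pg = proj_ell2[OF M g]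
  show "proj (ell2 X) M (\<lambda>x. f x + g x) = (\<lambda>x. proj (ell2 X) M f x + proj (ell2 X) M g x)"
  proof (rule proj_eqI[OF M ell2_add[OF f g] closed_subspace_add[OF M proj_in[OF M f] proj_in[OF M g]]])
    fix h assume h: "h \<in> M"
    have "(\<lambda>x. f x + g x - (proj (ell2 X) M f x + proj (ell2 X) M g x)) =
        (\<lambda>x. (f x - proj (ell2 X) M f x) + (g x - proj (ell2 X) M g x))" by auto
    then show "cinner (\<lambda>x. f x + g x - (proj (ell2 X) M f x + proj (ell2 X) M g x)) h = 0"
      using cinner_add_left[OF ell2_diff[OF f Pf] ell2_diff[OF g Pg] closed_subspace_ell2[OF M h]]
        proj_orthogonal[OF M f h] proj_orthogonal[OF M g h] by simp
  qed
next
  fix c f assume f: "f \<in> ell2 X"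
  show "proj (ell2 X) M (\<lambda>x. c * f x) = (\<lambda>x. c * proj (ell2 X) M f x)"
  proof (rule proj_eqI[OF M ell2_scale[OF f] closed_subspace_scale[OF M proj_in[OF M f]]])
    fix h assume h: "h \<in> M"
    have "(\<lambda>x. c * f x - c * proj (ell2 X) M f x) = (\<lambda>x. c * (f x - proj (ell2 X) M f x))"
      by (auto simp: algebra_simps)
    then show "cinner (\<lambda>x. c * f x - c * proj (ell2 X) M f x) h = 0"
      by (simp only: cinner_scale_left proj_orthogonal[OF M f h] mult_zero_right)
  qed
next
  fix f assume f: "f \<in> ell2 X"
  let ?P = "proj (ell2 X) M f"
  have "(l2norm ?P)\<^sup>2 = Re (cinner ?P ?P)" by (simp add: cinner_self[OF proj_ell2[OF M f]])
  also have "\<dots> = Re (cinner f ?P)" by (simp add: cinner_proj[OF M f proj_in[OF M f]])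
  also have "\<dots> \<le> l2norm f * l2norm ?P"
    using cinner_Cauchy_Schwarz[OF f proj_ell2[OF M f]] complex_Re_le_cmod order_trans by blast
  finally have "l2norm ?P * l2norm ?P \<le> l2norm f * l2norm ?P" by (simp add: power2_eq_square)
  then show "l2norm ?P \<le> 1 * l2norm f"
    by (cases "l2norm ?P = 0") (auto simp: mult_le_cancel_right less_le)
qed (rule proj_ell2[OF M])

text \<open>For a limit \<open>f\<close> of elements of \<open>M\<close>, the residual
  \<open>f - P f\<close> is orthogonal to \<open>M\<close>, hence to \<open>f\<close> and to itself,
  so \<open>f = P f\<close>. An explicit formula for the projection thus yields closedness.\<close>

lemma closed_subspace_projectable:
  assumes sub: "M \<subseteq> ell2 X" and zero: "(\<lambda>x. 0) \<in> M"
    and add: "\<And>f g. f \<in> M \<Longrightarrow> g \<in> M \<Longrightarrow> (\<lambda>x. f x + g x) \<in> M"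
    and scale: "\<And>c f. f \<in> M \<Longrightarrow> (\<lambda>x. c * f x) \<in> M"
    and P: "\<And>f. f \<in> ell2 X \<Longrightarrow> P f \<in> M"
      "\<And>f g. f \<in> ell2 X \<Longrightarrow> g \<in> M \<Longrightarrow> cinner (\<lambda>x. f x - P f x) g = 0"
  shows "closed_subspace (ell2 X) M"
proof (rule closed_subspaceI[OF sub zero add scale])
  fix \<sigma> f assume \<sigma>: "\<And>n. \<sigma> n \<in> M" and f: "f \<in> ell2 X"
    and lim: "(\<lambda>n. l2norm (\<lambda>x. \<sigma> n x - f x)) \<longlonglongrightarrow> 0"
  let ?d = "\<lambda>x. f x - P f x"
  have L: "g \<in> ell2 X" if "g \<in> M" for g using that sub by blast
  have d: "?d \<in> ell2 X" by (rule ell2_diff[OF f L[OF P(1)[OF f]]])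
  have z: "cinner g ?d = 0" if "g \<in> M" for g
    using P(2)[OF f that] by (simp add: cinner_commute[of g])
  have "cinner f ?d = 0"
    by (rule cinner_limit_zero[OF L[OF \<sigma>] f d lim z[OF \<sigma>]])
  then have "cinner ?d ?d = 0"
    using cinner_diff_left[OF f L[OF P(1)[OF f]] d] z[OF P(1)[OF f]] by simp
  then have "?d = (\<lambda>x. 0)" using cinner_self_eq_0_iff[OF d] by simp
  then have "P f = f" by (auto simp: fun_eq_iff)
  then show "f \<in> M" using P(1)[OF f] by simp
qed

text \<open>Pairing with basis vectors determines all coordinates of \<open>B g\<close>, so the
  definite description in \<open>adj\<close> has only one candidate.\<close>

lemma adj_eqI:
  assumes A: "A \<in> bop (ell2 X) (ell2 Y)" and B: "B \<in> bop (ell2 Y) (ell2 X)"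
    and adj: "\<And>f g. f \<in> ell2 X \<Longrightarrow> g \<in> ell2 Y \<Longrightarrow> cinner (A f) g = cinner f (B g)"
  shows "adj (ell2 X) (ell2 Y) A = B"
  unfolding adj_def
proof (rule the_equality)
  fix C assume C: "C \<in> bop (ell2 Y) (ell2 X) \<and> (\<forall>f\<in>ell2 X. \<forall>g\<in>ell2 Y. cinner (A f) g = cinner f (C g))"
  show "C = B"
  proof (rule extensionalityI[OF bop_extensional bop_extensional])
    fix g assume g: "g \<in> ell2 Y"
    have Cg: "C g \<in> ell2 X" and Bg: "B g \<in> ell2 X" using C B g bop_maps by blast+
    show "C g = B g"
    proof
      fix x show "C g x = B g x"
      proof (cases "x \<in> X")
        case True
        from ket_ell2[OF this] have "cinner (ket x) (C g) = cinner (ket x) (B g)"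
          using adj[of "ket x" g] C g by auto
        then show ?thesis by simp
      next
        case False
        then show ?thesis using ell2_outside Cg Bg by metis
      qed
    qed
  qed (use B C in auto)
qed (use B adj in auto)

lemma closed_span_superset:
  "B \<subseteq> closed_span K B"
  by (simp add: closed_span_def hull_subset)

lemma closed_span_minimal:
  "closed_subspace K M \<Longrightarrow> B \<subseteq> M \<Longrightarrow> closed_span K B \<subseteq> M"
  by (simp add: closed_span_def hull_minimal)

lemma closed_subspace_closed_span:
  assumes "B \<subseteq> ell2 X"
  shows "closed_subspace (ell2 X) (closed_span (ell2 X) B)"
  unfolding closed_span_def hull_def
  by (rule closed_subspace_Inter) (use assms closed_subspace_whole in auto)

text \<open>The residual of \<open>f\<close> under the projection onto the closed span stays in
  \<open>M\<close> and is orthogonal to \<open>B\<close>; by \<open>orth\<close> it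
  vanishes.\<close>

lemma closed_span_eqI:
  assumes M: "closed_subspace (ell2 X) M" and B: "B \<subseteq> M"
    and orth: "\<And>f. f \<in> M \<Longrightarrow> (\<And>g. g \<in> B \<Longrightarrow> cinner f g = 0) \<Longrightarrow> f = (\<lambda>x. 0)"
  shows "closed_span (ell2 X) B = M"
proof
  show sub: "closed_span (ell2 X) B \<subseteq> M" by (rule closed_span_minimal[OF M B])
  show "M \<subseteq> closed_span (ell2 X) B"
  proof
    fix f assume f: "f \<in> M"
    have fX: "f \<in> ell2 X" by (rule closed_subspace_ell2[OF M f])
    have N: "closed_subspace (ell2 X) (closed_span (ell2 X) B)"
      by (rule closed_subspace_closed_span) (use B closed_subspace_subset[OF M] in blast)
    let ?P = "proj (ell2 X) (closed_span (ell2 X) B)"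
    have "(\<lambda>x. f x - ?P f x) = (\<lambda>x. 0)"
    proof (rule orth)
      show "(\<lambda>x. f x - ?P f x) \<in> M"
        by (rule closed_subspace_diff[OF M f]) (use proj_in[OF N fX] sub in blast)
      fix g assume "g \<in> B"
      then show "cinner (\<lambda>x. f x - ?P f x) g = 0"
        using proj_orthogonal[OF N fX] closed_span_superset[of B "ell2 X"] by blast
    qed
    then have "?P f = f" by (auto simp: fun_eq_iff)
    then show "f \<in> closed_span (ell2 X) B" using proj_in[OF N fX] by simp
  qed
qed

section \<open>Coordinate subspaces\<close>

lemma closed_subspace_ell2_subset:
  assumes "I \<subseteq> X"
  shows "closed_subspace (ell2 X) (ell2 I)"
proof (rule closed_subspace_projectable[where P = "restr I"])
  fix f g assume "f \<in> ell2 X" and g: "g \<in> ell2 I"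
  have "(\<lambda>x. (f x - restr I f x) * cnj (g x)) = (\<lambda>x. 0)"
    using ell2_outside[OF g] by (auto simp: restr_def)
  then show "cinner (\<lambda>x. f x - restr I f x) g = 0" by (simp add: cinner_def)
qed (use assms in \<open>auto intro: ell2_zero ell2_add ell2_scale restr_ell2' dest: ell2_mono\<close>)

lemma closed_span_ket:
  assumes "I \<subseteq> X"
  shows "closed_span (ell2 X) (ket ` I) = ell2 I"
proof (rule closed_span_eqI[OF closed_subspace_ell2_subset[OF assms]])
  fix f assume f: "f \<in> ell2 I" and z: "\<And>g. g \<in> ket ` I \<Longrightarrow> cinner f g = 0"
  have "f x = 0" for x
  proof (cases "x \<in> I")
    case True
    then have "cinner f (ket x) = 0" by (intro z) auto
    then show ?thesis by simp
  qed (rule ell2_outside[OF f])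
  then show "f = (\<lambda>x. 0)" by auto
qed (auto intro: ket_ell2)

lemma proj_ell2_subset:
  assumes "I \<subseteq> X"
  shows "proj (ell2 X) (ell2 I) = (\<lambda>f\<in>ell2 X. restr I f)"
proof (rule extensionalityI)
  fix f assume f: "f \<in> ell2 X"
  have "proj (ell2 X) (ell2 I) f = restr I f"
  proof (rule proj_eqI[OF closed_subspace_ell2_subset[OF assms] f restr_ell2'[OF f]])
    fix g assume g: "g \<in> ell2 I"
    have "(\<lambda>x. (f x - restr I f x) * cnj (g x)) = (\<lambda>x. 0)"
      using ell2_outside[OF g] by (auto simp: restr_def)
    then show "cinner (\<lambda>x. f x - restr I f x) g = 0" by (simp add: cinner_def)
  qed
  with f show "proj (ell2 X) (ell2 I) f = (\<lambda>f\<in>ell2 X. restr I f) f" by simp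
qed (auto simp: proj_def)

lemma l2norm_restr_power2: "(l2norm (restr I f))\<^sup>2 = (\<Sum>\<^sub>\<infinity>x\<in>I. (cmod (f x))\<^sup>2)"
  unfolding l2norm_power2 by (rule infsum_cong_neutral) (auto simp: restr_def)

lemma sum_restr:
  assumes "finite F" "\<And>u w. u \<in> F \<Longrightarrow> w \<in> F \<Longrightarrow> u \<noteq> w \<Longrightarrow> B u \<inter> B w = {}"
  shows "(\<Sum>u\<in>F. restr (B u) f x) = restr (\<Union>u\<in>F. B u) f x"
  using assms
proof (induction F)
  case (insert u F)
  have "B u \<inter> (\<Union>u\<in>F. B u) = {}" using insert.prems insert.hyps by blast
  moreover have "(\<Sum>u\<in>F. restr (B u) f x) = restr (\<Union>u\<in>F. B u) f x"
    by (rule insert.IH) (use insert.prems in auto)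
  ultimately show ?case using insert.hyps by (auto simp: restr_def)
qed (simp add: restr_def)

text \<open>A finite set \<open>A\<close> carries all but a small part of the mass of
  \<open>f\<close>. By disjointness only finitely many \<open>B u\<close> meet \<open>A\<close>, and
  once \<open>F\<close> contains their indices the remainder lives off \<open>A\<close>.\<close>

lemma restr_Union_tendsto:
  assumes f: "f \<in> ell2 X"
    and disj: "\<And>u w. u \<in> I \<Longrightarrow> w \<in> I \<Longrightarrow> u \<noteq> w \<Longrightarrow> B u \<inter> B w = {}"
  shows "((\<lambda>F. l2norm (\<lambda>x. restr (\<Union>u\<in>I. B u) f x - (\<Sum>u\<in>F. restr (B u) f x))) \<longlongrightarrow> 0)
    (finite_subsets_at_top I)"
proof (rule tendstoI)
  fix e :: real assume e: "e > 0"
  let ?g = "\<lambda>x. (cmod (f x))\<^sup>2"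
  obtain A where A: "finite A" "dist (sum ?g A) (infsum ?g UNIV) \<le> e\<^sup>2 / 2"
    using has_sum_finite_approximation[OF has_sum_infsum[OF ell2_summable[OF f]], of "e\<^sup>2 / 2"] e
    by auto
  have split: "infsum ?g UNIV = infsum ?g A + infsum ?g (- A)"
    using infsum_Un_disjoint[of ?g A "- A"] ell2_summable[OF f] by simp
  have tail: "infsum ?g (- A) < e\<^sup>2"
  proof (rule le_less_trans)
    have "\<bar>infsum ?g (- A)\<bar> \<le> e\<^sup>2 / 2" using A split by (simp add: dist_real_def)
    then show "infsum ?g (- A) \<le> e\<^sup>2 / 2" by (rule order_trans[OF abs_ge_self])
    show "e\<^sup>2 / 2 < e\<^sup>2" using e by simp
  qed
  define F0 where "F0 = {u \<in> I. B u \<inter> A \<noteq> {}}"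
  have "\<exists>a. a \<in> B u \<inter> A" if "u \<in> F0" for u using that by (auto simp: F0_def)
  then obtain h where h: "\<And>u. u \<in> F0 \<Longrightarrow> h u \<in> B u \<inter> A" by metis
  \<comment> \<open>Picking a point of \<open>A\<close> in each \<open>B u\<close> is injective in
    \<open>u\<close> by disjointness.\<close>
  have "finite F0"
  proof (rule inj_on_finite[OF _ _ A(1)])
    show "inj_on h F0"
    proof (rule inj_onI)
      fix u w assume uw: "u \<in> F0" "w \<in> F0" "h u = h w"
      then have "B u \<inter> B w \<noteq> {}" using h[of u] h[of w] by auto
      then show "u = w" using disj[of u w] uw by (auto simp: F0_def)
    qed
    show "h ` F0 \<subseteq> A" using h by auto
  qed
  moreover have "F0 \<subseteq> I" by (auto simp: F0_def)
  moreover have "dist (l2norm (\<lambda>x. restr (\<Union>u\<in>I. B u) f x - (\<Sum>u\<in>F. restr (B u) f x))) 0 < e"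
    if F: "finite F" "F0 \<subseteq> F" "F \<subseteq> I" for F
  proof -
    have "(\<lambda>x. restr (\<Union>u\<in>I. B u) f x - (\<Sum>u\<in>F. restr (B u) f x)) =
        restr ((\<Union>u\<in>I. B u) - (\<Union>u\<in>F. B u)) f"
    proof
      fix x
      have "(\<Sum>u\<in>F. restr (B u) f x) = restr (\<Union>u\<in>F. B u) f x"
        by (rule sum_restr[OF F(1)]) (use disj F(3) in blast)
      then show "restr (\<Union>u\<in>I. B u) f x - (\<Sum>u\<in>F. restr (B u) f x) =
          restr ((\<Union>u\<in>I. B u) - (\<Union>u\<in>F. B u)) f x"
        using F(3) by (auto simp: restr_def)
    qed
    moreover have "infsum ?g ((\<Union>u\<in>I. B u) - (\<Union>u\<in>F. B u)) \<le> infsum ?g (- A)"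
      by (rule infsum_mono_neutral) (use F(2) ell2_summable[OF f] in \<open>auto simp: F0_def\<close>)
    ultimately have "(l2norm (\<lambda>x. restr (\<Union>u\<in>I. B u) f x - (\<Sum>u\<in>F. restr (B u) f x)))\<^sup>2 < e\<^sup>2"
      using tail by (simp add: l2norm_restr_power2)
    then have "l2norm (\<lambda>x. restr (\<Union>u\<in>I. B u) f x - (\<Sum>u\<in>F. restr (B u) f x)) < e"
      by (rule power2_less_imp_less) (use e in simp)
    then show ?thesis by simp
  qed
  ultimately show "\<forall>\<^sub>F F in finite_subsets_at_top I.
      dist (l2norm (\<lambda>x. restr (\<Union>u\<in>I. B u) f x - (\<Sum>u\<in>F. restr (B u) f x))) 0 < e"
    unfolding eventually_finite_subsets_at_top by blast
qed

lemma bop_sum_ket: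
  assumes A: "A \<in> bop (ell2 X) E" and "finite F" "F \<subseteq> X"
  shows "A (restr F f) x = (\<Sum>u\<in>F. f u * A (ket u) x)"
  using assms(2,3)
proof (induction F)
  case empty
  have "restr {} f = (\<lambda>x. 0)" by (auto simp: restr_def)
  then show ?case using bop_zero[OF A] by simp
next
  case (insert u F)
  have "restr (insert u F) f = (\<lambda>x. f u * ket u x + restr F f x)"
    using insert.hyps by (auto simp: restr_def ket_def fun_eq_iff)
  moreover have "restr F f \<in> ell2 X"
  proof -
    have "(\<lambda>x. \<Sum>u\<in>F. f u * ket u x) \<in> ell2 X"
      by (rule ell2_sum) (use insert.prems in \<open>auto intro: ell2_scale ket_ell2\<close>)
    also have "(\<lambda>x. \<Sum>u\<in>F. f u * ket u x) = restr F f"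
      using insert.hyps by (auto simp: restr_def ket_def fun_eq_iff if_distrib cong: if_cong)
    finally show ?thesis .
  qed
  ultimately show ?case
    using insert bop_add[OF A ell2_scale[OF ket_ell2[of u X], of "f u"]]
      bop_scale[OF A ket_ell2[of u X], of "f u"] by simp
qed

text \<open>Matrix form of a bounded operator: truncations of \<open>f\<close> converge in norm,
  boundedness carries this over to \<open>A f\<close>, and coordinates are dominated by the norm.
  The later matrix computations rest on it.\<close>

lemma bop_has_sum:
  assumes A: "A \<in> bop (ell2 X) (ell2 Y)" and f: "f \<in> ell2 X"
  shows "((\<lambda>u. f u * A (ket u) x) has_sum A f x) X"
proof -
  obtain C where C: "C \<ge> 0" "\<And>f. f \<in> ell2 X \<Longrightarrow> l2norm (A f) \<le> C * l2norm f"
    using bop_bounded[OF A] by blast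
  have lim: "((\<lambda>F. C * l2norm (\<lambda>x. f x - restr F f x)) \<longlongrightarrow> C * 0) (finite_subsets_at_top X)"
  proof (intro tendsto_mult tendsto_const)
    have "((\<lambda>F. l2norm (\<lambda>x. restr (\<Union>u\<in>X. {u}) f x - (\<Sum>u\<in>F. restr {u} f x))) \<longlongrightarrow> 0)
        (finite_subsets_at_top X)"
      by (rule restr_Union_tendsto[OF f]) auto
    moreover have "\<forall>\<^sub>F F in finite_subsets_at_top X.
        l2norm (\<lambda>x. restr (\<Union>u\<in>X. {u}) f x - (\<Sum>u\<in>F. restr {u} f x)) = l2norm (\<lambda>x. f x - restr F f x)"
    proof (rule eventually_finite_subsets_at_top_weakI)
      fix F assume "finite F" "F \<subseteq> X"
      then show "l2norm (\<lambda>x. restr (\<Union>u\<in>X. {u}) f x - (\<Sum>u\<in>F. restr {u} f x)) =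
          l2norm (\<lambda>x. f x - restr F f x)"
        using sum_restr[of F "\<lambda>u. {u}" f] restr_eq[OF f] by simp
    qed
    ultimately show "((\<lambda>F. l2norm (\<lambda>x. f x - restr F f x)) \<longlongrightarrow> 0) (finite_subsets_at_top X)"
      using tendsto_cong[of "\<lambda>F. l2norm (\<lambda>x. restr (\<Union>u\<in>X. {u}) f x - (\<Sum>u\<in>F. restr {u} f x))"
          "\<lambda>F. l2norm (\<lambda>x. f x - restr F f x)"] by blast
  qed
  have "((\<lambda>F. (\<Sum>u\<in>F. f u * A (ket u) x) - A f x) \<longlongrightarrow> 0) (finite_subsets_at_top X)"
  proof (rule Lim_null_comparison[OF _ lim[simplified]])
    show "\<forall>\<^sub>F F in finite_subsets_at_top X.
        norm ((\<Sum>u\<in>F. f u * A (ket u) x) - A f x) \<le> C * l2norm (\<lambda>x. f x - restr F f x)"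
    proof (rule eventually_finite_subsets_at_top_weakI)
      fix F assume F: "finite F" "F \<subseteq> X"
      have r: "restr F f \<in> ell2 X" by (rule restr_ell2[OF f])
      have "(\<Sum>u\<in>F. f u * A (ket u) x) = A (restr F f) x"
        by (rule bop_sum_ket[OF A F, symmetric])
      then have "norm ((\<Sum>u\<in>F. f u * A (ket u) x) - A f x) = cmod (A (\<lambda>x. f x - restr F f x) x)"
        by (simp add: bop_diff[OF A f r] norm_minus_commute)
      also have "\<dots> \<le> l2norm (A (\<lambda>x. f x - restr F f x))"
        by (rule cmod_le_l2norm[OF bop_maps[OF A ell2_diff[OF f r]]])
      also have "\<dots> \<le> C * l2norm (\<lambda>x. f x - restr F f x)"
        by (rule C(2)[OF ell2_diff[OF f r]])
      finally show "norm ((\<Sum>u\<in>F. f u * A (ket u) x) - A f x) \<le> C * l2norm (\<lambda>x. f x - restr F f x)" .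
    qed
  qed
  then show ?thesis unfolding has_sum_def using LIM_zero_iff by blast
qed

lemma bop_eqI_ket:
  assumes A: "A \<in> bop (ell2 X) (ell2 Y)" and B: "B \<in> bop (ell2 X) (ell2 Y)"
    and eq: "\<And>u. u \<in> X \<Longrightarrow> A (ket u) = B (ket u)"
  shows "A = B"
proof (rule extensionalityI[OF bop_extensional[OF A] bop_extensional[OF B]])
  fix f assume f: "f \<in> ell2 X"
  have "A f x = B f x" for x
    using infsumI[OF bop_has_sum[OF A f, of x]] infsumI[OF bop_has_sum[OF B f, of x]]
      infsum_cong[of X "\<lambda>u. f u * A (ket u) x" "\<lambda>u. f u * B (ket u) x"] eq by simp
  then show "A f = B f" by auto
qed

section \<open>Reducing subspaces\<close>

lemma commute_sym: "commute K A B \<longleftrightarrow> commute K B A"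
  by (auto simp: commute_def)

lemma commute_iff: "commute K A B \<longleftrightarrow> (\<forall>f\<in>K. A (B f) = B (A f))"
proof
  assume "commute K A B"
  then have "compose K A B f = compose K B A f" for f by (simp add: commute_def)
  then show "\<forall>f\<in>K. A (B f) = B (A f)" by (metis compose_eq)
qed (auto simp: commute_def compose_def restrict_def)

lemma commute_proj_ket_iff:
  assumes M: "closed_subspace (ell2 X) M" and A: "A \<in> bop (ell2 X) (ell2 X)"
  shows "commute (ell2 X) (proj (ell2 X) M) A \<longleftrightarrow>
    (\<forall>u\<in>X. proj (ell2 X) M (A (ket u)) = A (proj (ell2 X) M (ket u)))"
proof
  assume *: "\<forall>u\<in>X. proj (ell2 X) M (A (ket u)) = A (proj (ell2 X) M (ket u))"
  show "commute (ell2 X) (proj (ell2 X) M) A"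
    unfolding commute_def
    by (rule bop_eqI_ket[OF bop_compose[OF proj_bop[OF M] A] bop_compose[OF A proj_bop[OF M]]])
      (use * in \<open>simp add: compose_eq ket_ell2\<close>)
qed (simp add: commute_iff ket_ell2)

text \<open>\<open>B\<close> plays the adjoint of \<open>A\<close>. Its invariance of
  \<open>M\<close> makes \<open>A\<close> preserve the complement of \<open>M\<close>, so
  \<open>A (P f)\<close> has the defining property of \<open>P (A f)\<close>.\<close>

lemma commute_projI:
  assumes M: "closed_subspace (ell2 X) M" and A: "A \<in> bop (ell2 X) (ell2 X)"
    and adj: "\<And>f g. f \<in> ell2 X \<Longrightarrow> g \<in> ell2 X \<Longrightarrow> cinner (A f) g = cinner f (B g)"
    and inv: "\<And>f. f \<in> M \<Longrightarrow> A f \<in> M" "\<And>f. f \<in> M \<Longrightarrow> B f \<in> M"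
  shows "commute (ell2 X) (proj (ell2 X) M) A"
  unfolding commute_iff
proof
  fix f assume f: "f \<in> ell2 X"
  note Pf = proj_ell2[OF M f]
  show "proj (ell2 X) M (A f) = A (proj (ell2 X) M f)"
  proof (rule proj_eqI[OF M bop_maps[OF A f] inv(1)[OF proj_in[OF M f]]])
    fix h assume h: "h \<in> M"
    have "cinner (\<lambda>x. A f x - A (proj (ell2 X) M f) x) h = cinner (\<lambda>x. f x - proj (ell2 X) M f x) (B h)"
      using adj[OF ell2_diff[OF f Pf] closed_subspace_ell2[OF M h]] bop_diff[OF A f Pf] by simp
    also have "\<dots> = 0" by (rule proj_orthogonal[OF M f inv(2)[OF h]])
    finally show "cinner (\<lambda>x. A f x - A (proj (ell2 X) M f) x) h = 0" .
  qed
qed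

lemma commute_proj_invariant:
  assumes M: "closed_subspace (ell2 X) M" and c: "commute (ell2 X) (proj (ell2 X) M) A"
    and A: "A \<in> bop (ell2 X) (ell2 X)" and f: "f \<in> M"
  shows "A f \<in> M"
proof -
  have f': "f \<in> ell2 X" by (rule closed_subspace_ell2[OF M f])
  then have "proj (ell2 X) M (A f) = A f"
    using c proj_fixed[OF M f] by (simp add: commute_iff)
  then show ?thesis using proj_in[OF M bop_maps[OF A f']] by simp
qed

text \<open>Commuting with the projection \<open>P\<close> is a family of equations
  \<open>cinner (A f) (P g) = cinner (A (P f)) g\<close>, by selfadjointness of \<open>P\<close>.
  Both sides are continuous in \<open>A\<close> for the weak operator topology, so each equation
  defines a closed set.\<close>

lemma wot_closed_unital_algebra_commutant:
  assumes M: "closed_subspace (ell2 X) M"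
  shows "wot_closed_unital_algebra (ell2 X)
    {A \<in> bop (ell2 X) (ell2 X). commute (ell2 X) (proj (ell2 X) M) A}"
    (is "wot_closed_unital_algebra ?K ?C")
proof -
  let ?P = "proj ?K M"
  have P: "?P \<in> bop ?K ?K" by (rule proj_bop[OF M])
  define \<Phi> where "\<Phi> = (\<lambda>A :: 'a oper. \<lambda>(f, g)\<in>?K \<times> ?K. cinner (A f) g)"
  have top: "topspace (wot ?K) = bop ?K ?K"
    by (auto simp: wot_def topspace_pullback_topology PiE_def)
  have coord: "continuous_map (wot ?K) euclidean (\<lambda>A. cinner (A f) g)" if "f \<in> ?K" "g \<in> ?K" for f g
  proof -
    have "continuous_map (wot ?K) euclidean ((\<lambda>x. x (f, g)) \<circ> \<Phi>)"
      unfolding wot_def \<Phi>_def[symmetric]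
      by (intro continuous_map_pullback continuous_map_product_projection) (use that in simp)
    also have "(\<lambda>x. x (f, g)) \<circ> \<Phi> = (\<lambda>A. cinner (A f) g)" using that by (auto simp: \<Phi>_def)
    finally show ?thesis .
  qed
  have one: "closedin (wot ?K) {A \<in> bop ?K ?K. cinner (A f) (?P g) = cinner (A (?P f)) g}"
    if "f \<in> ?K" "g \<in> ?K" for f g
    unfolding top[symmetric]
    by (rule closedin_continuous_maps_eq[of euclidean])
      (auto intro!: coord that proj_ell2[OF M])
  have "?C = (\<Inter>(f, g)\<in>?K \<times> ?K. {A \<in> bop ?K ?K. cinner (A f) (?P g) = cinner (A (?P f)) g})"
    (is "_ = ?D")
  proof
    show "?C \<subseteq> ?D"
    proof
      fix A assume A: "A \<in> ?C"
      have "cinner (A f) (?P g) = cinner (A (?P f)) g" if "f \<in> ?K" "g \<in> ?K" for f g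
      proof -
        have "cinner (A f) (?P g) = cinner (?P (A f)) g"
          using proj_selfadjoint[OF M bop_maps[of A ?K ?K f] that(2)] A that(1) by simp
        with A that show ?thesis by (simp add: commute_iff)
      qed
      with A show "A \<in> ?D" by auto
    qed
    show "?D \<subseteq> ?C"
    proof
      fix A assume "A \<in> ?D"
      \<comment> \<open>The index set of the intersection contains the pair of zero vectors, so it
        is nonempty and membership in \<open>?D\<close> yields boundedness of \<open>A\<close> as
        well.\<close>
      then have A: "A \<in> bop ?K ?K"
        and eq: "\<And>f g. f \<in> ?K \<Longrightarrow> g \<in> ?K \<Longrightarrow> cinner (A f) (?P g) = cinner (A (?P f)) g"
        using ell2_zero by fastforce+
      have "?P (A f) = A (?P f)" if f: "f \<in> ?K" for f
      proof
        fix x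
        note l = proj_ell2[OF M bop_maps[OF A f]] and r = bop_maps[OF A proj_ell2[OF M f]]
        show "?P (A f) x = A (?P f) x"
        proof (cases "x \<in> X")
          case True
          have "cinner (?P (A f)) (ket x) = cinner (A (?P f)) (ket x)"
            using proj_selfadjoint[OF M bop_maps[OF A f] ket_ell2[OF True]] eq[OF f ket_ell2[OF True]]
            by simp
          then show ?thesis by simp
        next
          case False
          then show ?thesis using ell2_outside[OF l] ell2_outside[OF r] by simp
        qed
      qed
      with A show "A \<in> ?C" by (simp add: commute_iff)
    qed
  qed
  moreover have "closedin (wot ?K) ?D"
    using one ell2_zero[of X] by (intro closedin_INT) auto
  ultimately have "closedin (wot ?K) ?C" by simp
  moreover have "\<forall>A\<in>?C. \<forall>B\<in>?C. compose ?K A B \<in> ?C \<and> (\<lambda>f\<in>?K. \<lambda>x. A f x + B f x) \<in> ?C"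
  proof (intro ballI conjI)
    fix A B assume that: "A \<in> ?C" "B \<in> ?C"
    have A: "A \<in> bop ?K ?K" "\<And>f. f \<in> ?K \<Longrightarrow> ?P (A f) = A (?P f)"
      and B: "B \<in> bop ?K ?K" "\<And>f. f \<in> ?K \<Longrightarrow> ?P (B f) = B (?P f)"
      using that by (auto simp: commute_iff)
    show "compose ?K A B \<in> ?C"
      using bop_compose[OF A(1) B(1)] by (auto simp: commute_iff compose_eq A B bop_maps[OF B(1)] proj_ell2[OF M])
    obtain C where C: "\<And>f. f \<in> ?K \<Longrightarrow> l2norm (A f) \<le> C * l2norm f" using bop_bounded[OF A(1)] by blast
    obtain C' where C': "\<And>f. f \<in> ?K \<Longrightarrow> l2norm (B f) \<le> C' * l2norm f" using bop_bounded[OF B(1)] by blast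
    have "(\<lambda>f\<in>?K. \<lambda>x. A f x + B f x) \<in> bop ?K ?K"
    proof (rule bopI)
      fix f assume f: "f \<in> ?K"
      have "l2norm (\<lambda>x. A f x + B f x) \<le> l2norm (A f) + l2norm (B f)"
        by (rule l2norm_triangle[OF bop_maps[OF A(1) f] bop_maps[OF B(1) f]])
      also have "\<dots> \<le> (C + C') * l2norm f" using C[OF f] C'[OF f] by (simp add: distrib_right)
      finally show "l2norm ((\<lambda>f\<in>?K. \<lambda>x. A f x + B f x) f) \<le> (C + C') * l2norm f" using f by simp
    qed (auto simp: ell2_add ell2_scale bop_maps[OF A(1)] bop_maps[OF B(1)] bop_add[OF A(1)]
        bop_add[OF B(1)] bop_scale[OF A(1)] bop_scale[OF B(1)] algebra_simps)
    then show "(\<lambda>f\<in>?K. \<lambda>x. A f x + B f x) \<in> ?C"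
      by (auto simp: commute_iff proj_ell2[OF M] bop_add[OF P bop_maps[OF A(1)] bop_maps[OF B(1)]] A(2) B(2))
  qed
  moreover have "\<forall>c. \<forall>A\<in>?C. (\<lambda>f\<in>?K. \<lambda>x. c * A f x) \<in> ?C"
  proof (intro allI ballI)
    fix c A assume that: "A \<in> ?C"
    have A: "A \<in> bop ?K ?K" "\<And>f. f \<in> ?K \<Longrightarrow> ?P (A f) = A (?P f)"
      using that by (auto simp: commute_iff)
    obtain C where C: "\<And>f. f \<in> ?K \<Longrightarrow> l2norm (A f) \<le> C * l2norm f" using bop_bounded[OF A(1)] by blast
    have "(\<lambda>f\<in>?K. \<lambda>x. c * A f x) \<in> bop ?K ?K"
    proof (rule bopI)
      fix f assume f: "f \<in> ?K"
      show "l2norm ((\<lambda>f\<in>?K. \<lambda>x. c * A f x) f) \<le> (cmod c * C) * l2norm f"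
        using f mult_left_mono[OF C[OF f], of "cmod c"] by (simp add: l2norm_scale mult.assoc)
    qed (auto simp: ell2_add ell2_scale bop_maps[OF A(1)] bop_add[OF A(1)] bop_scale[OF A(1)] algebra_simps)
    then show "(\<lambda>f\<in>?K. \<lambda>x. c * A f x) \<in> ?C"
      by (auto simp: commute_iff proj_ell2[OF M] bop_scale[OF P bop_maps[OF A(1)]] A(2))
  qed
  moreover have "(\<lambda>f\<in>?K. f) \<in> ?C"
    using bop_id by (auto simp: commute_iff proj_ell2[OF M])
  ultimately show ?thesis
    unfolding wot_closed_unital_algebra_def by simp
qed

text \<open>The operators commuting with the projection form a closed unital algebra; once it
  contains the generators it contains their hull.\<close>

lemma reduces_wot_algebra_iff:
  assumes "\<S> \<subseteq> bop (ell2 X) (ell2 X)"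
  shows "reduces (ell2 X) M (wot_algebra (ell2 X) \<S>) \<longleftrightarrow> reduces (ell2 X) M \<S>"
proof
  assume "reduces (ell2 X) M (wot_algebra (ell2 X) \<S>)"
  moreover have "\<S> \<subseteq> wot_algebra (ell2 X) \<S>" by (simp add: wot_algebra_def hull_subset)
  ultimately show "reduces (ell2 X) M \<S>" by (auto simp: reduces_def)
next
  assume r: "reduces (ell2 X) M \<S>"
  then have M: "closed_subspace (ell2 X) M" by (simp add: reduces_def)
  have "wot_algebra (ell2 X) \<S> \<subseteq> {A \<in> bop (ell2 X) (ell2 X). commute (ell2 X) (proj (ell2 X) M) A}"
    unfolding wot_algebra_def
    by (rule hull_minimal) (use assms r wot_closed_unital_algebra_commutant[OF M] in \<open>auto simp: reduces_def\<close>)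
  with M show "reduces (ell2 X) M (wot_algebra (ell2 X) \<S>)" by (auto simp: reduces_def)
qed

text \<open>Sums of closed subspaces need not be closed. When the projections \<open>P\<close> and
  \<open>Q\<close> commute, \<open>P + Q (1 - P)\<close> is an orthogonal projection with range
  \<open>M + N\<close>.\<close>

lemma closed_subspace_plus:
  assumes M: "closed_subspace (ell2 X) M" and N: "closed_subspace (ell2 X) N"
    and comm: "commute (ell2 X) (proj (ell2 X) M) (proj (ell2 X) N)"
  defines "S \<equiv> {\<lambda>x. f x + g x | f g. f \<in> M \<and> g \<in> N}"
  shows "closed_subspace (ell2 X) S"
    and "\<And>f. f \<in> ell2 X \<Longrightarrow> proj (ell2 X) S f =
      (\<lambda>x. proj (ell2 X) M f x + proj (ell2 X) N (\<lambda>y. f y - proj (ell2 X) M f y) x)"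
proof -
  let ?K = "ell2 X"
  let ?P = "\<lambda>f x. proj ?K M f x + proj ?K N (\<lambda>y. f y - proj ?K M f y) x"
  have SI: "(\<lambda>x. a x + b x) \<in> S" if "a \<in> M" "b \<in> N" for a b
    using that by (auto simp: S_def)
  have PS: "?P f \<in> S" if f: "f \<in> ?K" for f
    using proj_in[OF M f] proj_in[OF N ell2_diff[OF f proj_ell2[OF M f]]] by (auto simp: S_def)
  have orth: "cinner (\<lambda>x. f x - ?P f x) h = 0" if f: "f \<in> ?K" and h: "h \<in> S" for f h
  proof -
    let ?e = "\<lambda>x. f x - proj ?K M f x"
    let ?d = "\<lambda>x. ?e x - proj ?K N ?e x"
    have e: "?e \<in> ?K" by (rule ell2_diff[OF f proj_ell2[OF M f]])
    have d: "?d \<in> ?K" by (rule ell2_diff[OF e proj_ell2[OF N e]])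
    have eq: "(\<lambda>x. f x - ?P f x) = ?d" by auto
    obtain a b where a: "a \<in> M" and b: "b \<in> N" and hab: "h = (\<lambda>x. a x + b x)" using h by (auto simp: S_def)
    \<comment> \<open>The projection onto \<open>M\<close> kills \<open>?e\<close>, hence by
      commutation also \<open>proj ?K N ?e\<close>, and so the whole residual; thus the residual is
      orthogonal to \<open>M\<close>.\<close>
    have "proj ?K M ?e = (\<lambda>x. proj ?K M f x - proj ?K M f x)"
      using bop_diff[OF proj_bop[OF M] f proj_ell2[OF M f]] proj_fixed[OF M proj_in[OF M f]] by simp
    then have "proj ?K M (proj ?K N ?e) = (\<lambda>x. 0)" "proj ?K M ?e = (\<lambda>x. 0)"
      using comm e bop_zero[OF proj_bop[OF N]] by (simp_all add: commute_iff)
    then have "proj ?K M ?d = (\<lambda>x. 0)"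
      using bop_diff[OF proj_bop[OF M] e proj_ell2[OF N e]] by simp
    then have "cinner ?d a = 0" using cinner_proj[OF M d a] by simp
    moreover have "cinner ?d b = 0" by (rule proj_orthogonal[OF N e b])
    ultimately show ?thesis
      unfolding eq hab
      by (simp add: cinner_add_right[OF closed_subspace_ell2[OF M a] closed_subspace_ell2[OF N b] d])
  qed
  show S: "closed_subspace ?K S"
  proof (rule closed_subspace_projectable[where P = ?P])
    have "(\<lambda>x. f x + g x) \<in> ?K" if "f \<in> M" "g \<in> N" for f g
      by (rule ell2_add[OF closed_subspace_ell2[OF M that(1)] closed_subspace_ell2[OF N that(2)]])
    then show "S \<subseteq> ?K" by (auto simp: S_def)
    show "(\<lambda>x. 0) \<in> S"
      using closed_subspace_zero[OF M] closed_subspace_zero[OF N] by (force simp: S_def)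
  next
    fix f g assume "f \<in> S" "g \<in> S"
    then obtain a b a' b' where ab: "a \<in> M" "b \<in> N" "f = (\<lambda>x. a x + b x)" "a' \<in> M" "b' \<in> N" "g = (\<lambda>x. a' x + b' x)"
      by (auto simp: S_def)
    then have "(\<lambda>x. f x + g x) = (\<lambda>x. (a x + a' x) + (b x + b' x))" by auto
    moreover have "(\<lambda>x. (a x + a' x) + (b x + b' x)) \<in> S"
      by (rule SI[OF closed_subspace_add[OF M ab(1,4)] closed_subspace_add[OF N ab(2,5)]])
    ultimately show "(\<lambda>x. f x + g x) \<in> S" by simp
  next
    fix c f assume "f \<in> S"
    then obtain a b where ab: "a \<in> M" "b \<in> N" "f = (\<lambda>x. a x + b x)" by (auto simp: S_def)
    then have "(\<lambda>x. c * f x) = (\<lambda>x. c * a x + c * b x)" by (auto simp: distrib_left)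
    moreover have "(\<lambda>x. c * a x + c * b x) \<in> S"
      by (rule SI[OF closed_subspace_scale[OF M ab(1)] closed_subspace_scale[OF N ab(2)]])
    ultimately show "(\<lambda>x. c * f x) \<in> S" by simp
  qed (fact PS, fact orth)
  show "proj ?K S f = ?P f" if f: "f \<in> ?K" for f
    by (rule proj_eqI[OF S f PS[OF f] orth[OF f]])
qed

lemma commute_proj_plus:
  assumes M: "closed_subspace (ell2 X) M" and N: "closed_subspace (ell2 X) N"
    and comm: "commute (ell2 X) (proj (ell2 X) M) (proj (ell2 X) N)"
    and A: "A \<in> bop (ell2 X) (ell2 X)"
    and cM: "commute (ell2 X) (proj (ell2 X) M) A" and cN: "commute (ell2 X) (proj (ell2 X) N) A"
  shows "commute (ell2 X) (proj (ell2 X) {\<lambda>x. f x + g x | f g. f \<in> M \<and> g \<in> N}) A"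
  unfolding commute_iff
proof
  fix f assume f: "f \<in> ell2 X"
  note P = closed_subspace_plus(2)[OF M N comm]
  note Pf = proj_ell2[OF M f]
  note e = ell2_diff[OF f Pf]
  have "(\<lambda>y. A f y - proj (ell2 X) M (A f) y) = A (\<lambda>y. f y - proj (ell2 X) M f y)"
    using bop_diff[OF A f Pf] cM f by (simp add: commute_iff)
  then show "proj (ell2 X) {\<lambda>x. f x + g x | f g. f \<in> M \<and> g \<in> N} (A f) =
      A (proj (ell2 X) {\<lambda>x. f x + g x | f g. f \<in> M \<and> g \<in> N} f)"
    using cM cN f e bop_add[OF A Pf proj_ell2[OF N e]]
    by (simp add: P[OF f] P[OF bop_maps[OF A f]] commute_iff)
qed

section \<open>Orthogonal sums of coordinate projections\<close>

lemma restr_bop: "(\<lambda>f\<in>ell2 X. restr I f) \<in> bop (ell2 X) (ell2 X)"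
proof (rule bopI)
  fix f assume f: "f \<in> ell2 X"
  have "(l2norm (restr I f))\<^sup>2 \<le> (l2norm f)\<^sup>2"
    by (subst l2norm_restr_power2, subst l2norm_power2, rule infsum_mono_neutral) (use ell2_summable[OF f] in auto)
  then have "l2norm (restr I f) \<le> l2norm f" by (rule power2_le_imp_le) simp
  then show "l2norm ((\<lambda>f\<in>ell2 X. restr I f) f) \<le> 1 * l2norm f" using f by simp
qed (auto simp: restr_ell2 ell2_add ell2_scale, auto simp: restr_def)

lemma cinner_restr: "cinner (restr I f) g = cinner f (restr I g)"
  unfolding cinner_def by (rule infsum_cong) (simp add: restr_def)

lemma has_orth_proj_sum_restr:
  fixes X :: "'a set"
  assumes sub: "\<And>u. u \<in> I \<Longrightarrow> B u \<subseteq> X"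
    and disj: "\<And>u w. u \<in> I \<Longrightarrow> w \<in> I \<Longrightarrow> u \<noteq> w \<Longrightarrow> B u \<inter> B w = {}"
    and A: "\<And>u. u \<in> I \<Longrightarrow> A u = (\<lambda>f\<in>ell2 X. restr (B u) f)"
  shows "has_orth_proj_sum (ell2 X) I A (\<lambda>f\<in>ell2 X. restr (\<Union>u\<in>I. B u) f)"
  unfolding has_orth_proj_sum_def
proof (intro conjI ballI impI)
  show "(\<lambda>f\<in>ell2 X. restr (\<Union>u\<in>I. B u) f) \<in> bop (ell2 X) (ell2 X)" by (rule restr_bop)
next
  fix u assume u: "u \<in> I"
  show "\<exists>M. closed_subspace (ell2 X) M \<and> A u = proj (ell2 X) M"
    using closed_subspace_ell2_subset[OF sub[OF u]] proj_ell2_subset[OF sub[OF u]] A[OF u] by metis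
next
  fix u w and f :: "'a vec" assume "u \<in> I" "w \<in> I" "u \<noteq> w" "f \<in> ell2 X"
  then show "A u (A w f) = (\<lambda>x. 0)"
    using disj[of u w] by (auto simp: A restr_ell2) (auto simp: restr_def fun_eq_iff)
next
  fix f :: "'a vec" assume f: "f \<in> ell2 X"
  have ev: "\<forall>\<^sub>F F in finite_subsets_at_top I.
      l2norm (\<lambda>x. restr (\<Union>u\<in>I. B u) f x - (\<Sum>u\<in>F. restr (B u) f x)) =
      l2norm (\<lambda>x. (\<lambda>f\<in>ell2 X. restr (\<Union>u\<in>I. B u) f) f x - (\<Sum>u\<in>F. A u f x))"
  proof (rule eventually_finite_subsets_at_top_weakI)
    fix F assume F: "finite F" "F \<subseteq> I"
    have "(\<Sum>u\<in>F. A u f x) = (\<Sum>u\<in>F. restr (B u) f x)" for x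
      by (rule sum.cong) (use F A f in auto)
    then show "l2norm (\<lambda>x. restr (\<Union>u\<in>I. B u) f x - (\<Sum>u\<in>F. restr (B u) f x)) =
        l2norm (\<lambda>x. (\<lambda>f\<in>ell2 X. restr (\<Union>u\<in>I. B u) f) f x - (\<Sum>u\<in>F. A u f x))"
      using f by simp
  qed
  show "((\<lambda>F. l2norm (\<lambda>x. (\<lambda>f\<in>ell2 X. restr (\<Union>u\<in>I. B u) f) f x - (\<Sum>u\<in>F. A u f x))) \<longlongrightarrow> 0)
      (finite_subsets_at_top I)"
    by (rule iffD1[OF tendsto_cong[OF ev] restr_Union_tendsto[OF f disj]])
qed

text \<open>Both candidates are strong limits of the same net of finite sums. This is what allows
  the definite description in \<open>block_proj\<close> to be evaluated.\<close>

lemma has_orth_proj_sum_unique: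
  assumes P: "has_orth_proj_sum (ell2 X) I A P" and P': "has_orth_proj_sum (ell2 X) I A P'"
  shows "P = P'"
proof (rule extensionalityI)
  have b: "P \<in> bop (ell2 X) (ell2 X)" "P' \<in> bop (ell2 X) (ell2 X)"
    using P P' by (simp_all add: has_orth_proj_sum_def)
  then show "P \<in> extensional (ell2 X)" "P' \<in> extensional (ell2 X)"
    using bop_extensional by blast+
  fix f assume f: "f \<in> ell2 X"
  have Af: "A u f \<in> ell2 X" if "u \<in> I" for u
  proof -
    have "\<exists>M. closed_subspace (ell2 X) M \<and> A u = proj (ell2 X) M"
      using P that unfolding has_orth_proj_sum_def by simp
    then obtain M where M: "closed_subspace (ell2 X) M" and Au: "A u = proj (ell2 X) M" by blast
    show ?thesis unfolding Au by (rule proj_ell2[OF M f])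
  qed
  note Pf = bop_maps[OF b(1) f] and Pf' = bop_maps[OF b(2) f]
  let ?d = "\<lambda>P F. l2norm (\<lambda>x. P f x - (\<Sum>u\<in>F. A u f x))"
  have "((\<lambda>F. ?d P F + ?d P' F) \<longlongrightarrow> 0 + 0) (finite_subsets_at_top I)"
    using P P' f by (intro tendsto_add) (auto simp: has_orth_proj_sum_def)
  moreover have "\<forall>\<^sub>F F in finite_subsets_at_top I. l2norm (\<lambda>x. P f x - P' f x) \<le> ?d P F + ?d P' F"
  proof (rule eventually_finite_subsets_at_top_weakI)
    fix F assume "finite F" "F \<subseteq> I"
    then have s: "(\<lambda>x. \<Sum>u\<in>F. A u f x) \<in> ell2 X" using Af by (intro ell2_sum) auto
    show "l2norm (\<lambda>x. P f x - P' f x) \<le> ?d P F + ?d P' F"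
      using l2norm_dist_triangle[OF Pf s Pf'] l2norm_minus_commute[of "\<lambda>x. \<Sum>u\<in>F. A u f x" "P' f"] by simp
  qed
  ultimately have "l2norm (\<lambda>x. P f x - P' f x) \<le> 0 + 0"
    by (intro tendsto_lowerbound) auto
  then have "l2norm (\<lambda>x. P f x - P' f x) = 0" using l2norm_nonneg[of "\<lambda>x. P f x - P' f x"] by linarith
  then have "(\<lambda>x. P f x - P' f x) = (\<lambda>x. 0)" using l2norm_eq_0_iff[OF ell2_diff[OF Pf Pf']] by simp
  then show "P f = P' f" by (auto simp: fun_eq_iff)
qed

text \<open>The image of a closed subspace under a coordinate projection need not be closed.
  Invariance turns it into an intersection of two closed subspaces.\<close>

lemma closed_subspace_restr_image:
  assumes H: "closed_subspace (ell2 X) H" and "I \<subseteq> X"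
    and inv: "\<And>f. f \<in> H \<Longrightarrow> restr I f \<in> H"
  shows "restr I ` H = H \<inter> ell2 I" and "closed_subspace (ell2 X) (restr I ` H)"
proof -
  show eq: "restr I ` H = H \<inter> ell2 I"
  proof
    show "restr I ` H \<subseteq> H \<inter> ell2 I"
      using inv restr_ell2'[OF closed_subspace_ell2[OF H]] by auto
    show "H \<inter> ell2 I \<subseteq> restr I ` H" using restr_eq by force
  qed
  have "closed_subspace (ell2 X) (\<Inter>{H, ell2 I})"
    by (rule closed_subspace_Inter) (use H closed_subspace_ell2_subset[OF \<open>I \<subseteq> X\<close>] in auto)
  then show "closed_subspace (ell2 X) (restr I ` H)" by (simp add: eq)
qed

lemma orth_sum_restr:
  assumes H: "closed_subspace (ell2 X) H" and cover: "(\<Union>u\<in>I. B u) = X"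
    and disj: "\<And>u w. u \<in> I \<Longrightarrow> w \<in> I \<Longrightarrow> u \<noteq> w \<Longrightarrow> B u \<inter> B w = {}"
    and inv: "\<And>u f. u \<in> I \<Longrightarrow> f \<in> H \<Longrightarrow> restr (B u) f \<in> H"
    and A: "\<And>u f. u \<in> I \<Longrightarrow> f \<in> ell2 X \<Longrightarrow> A u f = restr (B u) f"
  shows "orth_sum (ell2 X) I (\<lambda>u. A u ` H) H"
proof -
  have sub: "B u \<subseteq> X" if "u \<in> I" for u using cover that by blast
  have im: "A u ` H = restr (B u) ` H" if "u \<in> I" for u
    by (rule image_cong) (use A[OF that] closed_subspace_ell2[OF H] in auto)
  have orth: "cinner f g = 0" if "f \<in> restr (B u) ` H" "g \<in> restr (B w) ` H" "B u \<inter> B w = {}" for f g u w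
  proof -
    have "f x * cnj (g x) = 0" for x
    proof (cases "x \<in> B u")
      case True
      with that(3) have "x \<notin> B w" by blast
      with that(2) show ?thesis by (auto simp: restr_def)
    qed (use that(1) in \<open>auto simp: restr_def\<close>)
    then have "(\<lambda>x. f x * cnj (g x)) = (\<lambda>x. 0)" by (rule ext)
    then show ?thesis by (simp only: cinner_def infsum_0_simp)
  qed
  have "closed_span (ell2 X) (\<Union>u\<in>I. restr (B u) ` H) = H"
  proof (rule closed_span_eqI[OF H])
    show "(\<Union>u\<in>I. restr (B u) ` H) \<subseteq> H" using inv by auto
    fix f assume f: "f \<in> H" and z: "\<And>g. g \<in> (\<Union>u\<in>I. restr (B u) ` H) \<Longrightarrow> cinner f g = 0"
    note fX = closed_subspace_ell2[OF H f]
    have "f x = 0" for x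
    proof (cases "x \<in> X")
      case True
      then obtain u where u: "u \<in> I" "x \<in> B u" using cover by blast
      \<comment> \<open>The piece of \<open>f\<close> over \<open>B u\<close> is one of the
        generators, and pairing \<open>f\<close> with it gives the squared norm of that
        piece.\<close>
      have "cinner f (restr (B u) f) = 0" using u f by (intro z) blast
      moreover have "restr (B u) (restr (B u) f) = restr (B u) f" by (auto simp: restr_def)
      ultimately have "cinner (restr (B u) f) (restr (B u) f) = 0" by (simp add: cinner_restr)
      then have "restr (B u) f = (\<lambda>x. 0)" using cinner_self_eq_0_iff[OF restr_ell2[OF fX]] by simp
      then show ?thesis using u(2) by (auto simp: restr_def fun_eq_iff split: if_splits)
    qed (rule ell2_outside[OF fX])
    then show "f = (\<lambda>x. 0)" by auto
  qed
  moreover have "(\<Union>u\<in>I. A u ` H) = (\<Union>u\<in>I. restr (B u) ` H)" using im by auto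
  ultimately show ?thesis
    unfolding orth_sum_def
    using closed_subspace_restr_image(2)[OF H sub inv] orth disj im by auto
qed

section \<open>Operators induced by injections\<close>

text \<open>For \<open>\<theta>\<close> injective on \<open>X\<close> this is the isometry sending
  \<open>ket x\<close> to \<open>ket (\<theta> x)\<close>; \<open>pull\<close> is its
  adjoint.\<close>

definition push :: "'a set \<Rightarrow> ('a \<Rightarrow> 'a) \<Rightarrow> 'a vec \<Rightarrow> 'a vec" where
  "push X \<theta> g = (\<lambda>z. if z \<in> \<theta> ` X then g (inv_into X \<theta> z) else 0)"

definition pull :: "'a set \<Rightarrow> ('a \<Rightarrow> 'a) \<Rightarrow> 'a vec \<Rightarrow> 'a vec" where
  "pull X \<theta> f = (\<lambda>x. if x \<in> X then f (\<theta> x) else 0)"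

context
  fixes X Y :: "'a set" and \<theta> :: "'a \<Rightarrow> 'a"
  assumes inj: "inj_on \<theta> X" and sub: "\<theta> ` X \<subseteq> Y"
begin

lemma push_at: "x \<in> X \<Longrightarrow> push X \<theta> g (\<theta> x) = g x"
  using inj by (simp add: push_def)

text \<open>Change of variables along \<open>\<theta>\<close>. The general \<open>\<phi>\<close>
  serves both the norm, with \<open>\<phi> a b = (cmod a)^2\<close>, and the inner product, with
  \<open>\<phi> a b = a * cnj b\<close>.\<close>

lemma push_has_sum:
  assumes "\<And>x. x \<notin> X \<Longrightarrow> \<phi> (g x) (h x) = 0" "\<And>c. \<phi> 0 c = 0" "\<And>x. x \<in> X \<Longrightarrow> h x = k (\<theta> x)"
  shows "((\<lambda>z. \<phi> (push X \<theta> g z) (k z)) has_sum s) UNIV \<longleftrightarrow> ((\<lambda>x. \<phi> (g x) (h x)) has_sum s) UNIV"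
proof -
  have "((\<lambda>z. \<phi> (push X \<theta> g z) (k z)) has_sum s) UNIV \<longleftrightarrow>
      ((\<lambda>z. \<phi> (push X \<theta> g z) (k z)) has_sum s) (\<theta> ` X)"
    by (rule has_sum_cong_neutral) (auto simp: push_def assms)
  also have "\<dots> \<longleftrightarrow> (((\<lambda>z. \<phi> (push X \<theta> g z) (k z)) \<circ> \<theta>) has_sum s) X"
    by (rule has_sum_reindex[OF inj])
  also have "\<dots> \<longleftrightarrow> ((\<lambda>x. \<phi> (g x) (h x)) has_sum s) X"
    by (rule has_sum_cong) (simp add: push_at assms)
  also have "\<dots> \<longleftrightarrow> ((\<lambda>x. \<phi> (g x) (h x)) has_sum s) UNIV"
    by (rule has_sum_cong_neutral) (auto simp: assms)
  finally show ?thesis .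
qed

lemma push_norm:
  assumes g: "g \<in> ell2 X"
  shows "push X \<theta> g \<in> ell2 (\<theta> ` X)" and "l2norm (push X \<theta> g) = l2norm g"
proof -
  have "((\<lambda>z. (cmod (push X \<theta> g z))\<^sup>2) has_sum (l2norm g)\<^sup>2) UNIV \<longleftrightarrow>
      ((\<lambda>x. (cmod (g x))\<^sup>2) has_sum (l2norm g)\<^sup>2) UNIV"
    by (rule push_has_sum[where \<phi> = "\<lambda>a b. (cmod a)\<^sup>2" and h = "\<lambda>_. ()" and k = "\<lambda>_. ()"])
      (auto simp: ell2_outside[OF g])
  moreover have "((\<lambda>x. (cmod (g x))\<^sup>2) has_sum (l2norm g)\<^sup>2) UNIV"
    unfolding l2norm_power2 by (rule has_sum_infsum[OF ell2_summable[OF g]])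
  ultimately have s: "((\<lambda>z. (cmod (push X \<theta> g z))\<^sup>2) has_sum (l2norm g)\<^sup>2) UNIV" by simp
  then show "push X \<theta> g \<in> ell2 (\<theta> ` X)" by (auto simp: ell2_def summable_on_def push_def)
  have "(l2norm (push X \<theta> g))\<^sup>2 = (l2norm g)\<^sup>2"
    using infsumI[OF s] by (simp add: l2norm_power2)
  then show "l2norm (push X \<theta> g) = l2norm g" by simp
qed

lemma push_ell2: "g \<in> ell2 X \<Longrightarrow> push X \<theta> g \<in> ell2 Y"
  using push_norm(1) ell2_mono[OF sub] by blast

lemma cinner_push:
  assumes g: "g \<in> ell2 X"
  shows "cinner (push X \<theta> g) f = cinner g (pull X \<theta> f)"
proof -
  show ?thesis
    unfolding cinner_def
  proof (rule infsum_eqI')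
    fix s
    show "((\<lambda>z. push X \<theta> g z * cnj (f z)) has_sum s) UNIV \<longleftrightarrow>
        ((\<lambda>x. g x * cnj (pull X \<theta> f x)) has_sum s) UNIV"
      by (rule push_has_sum[where \<phi> = "\<lambda>a b. a * cnj b" and h = "pull X \<theta> f" and k = f])
      (auto simp: ell2_outside[OF g] pull_def)
  qed
qed

lemma pull_ell2:
  assumes f: "f \<in> ell2 Y"
  shows "pull X \<theta> f \<in> ell2 X" and "l2norm (pull X \<theta> f) \<le> l2norm f"
proof -
  let ?s = "infsum (\<lambda>z. (cmod (f z))\<^sup>2) (\<theta> ` X)"
  have "((\<lambda>z. (cmod (f z))\<^sup>2) has_sum ?s) (\<theta> ` X)"
    by (rule has_sum_infsum[OF ell2_summable[OF f]])
  also have "?this \<longleftrightarrow> (((\<lambda>z. (cmod (f z))\<^sup>2) \<circ> \<theta>) has_sum ?s) X"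
    by (rule has_sum_reindex[OF inj])
  also have "\<dots> \<longleftrightarrow> ((\<lambda>x. (cmod (pull X \<theta> f x))\<^sup>2) has_sum ?s) UNIV"
    by (rule has_sum_cong_neutral) (auto simp: pull_def)
  finally have s: "((\<lambda>x. (cmod (pull X \<theta> f x))\<^sup>2) has_sum ?s) UNIV" .
  then show "pull X \<theta> f \<in> ell2 X" by (auto simp: ell2_def summable_on_def pull_def)
  have "?s \<le> infsum (\<lambda>z. (cmod (f z))\<^sup>2) UNIV"
    by (rule infsum_mono_neutral) (use ell2_summable[OF f] in auto)
  then have "(l2norm (pull X \<theta> f))\<^sup>2 \<le> (l2norm f)\<^sup>2"
    using infsumI[OF s] by (simp add: l2norm_power2)
  then show "l2norm (pull X \<theta> f) \<le> l2norm f" by (rule power2_le_imp_le) simp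
qed

lemma push_add: "push X \<theta> (\<lambda>x. f x + g x) = (\<lambda>z. push X \<theta> f z + push X \<theta> g z)"
  and push_scale: "push X \<theta> (\<lambda>x. c * f x) = (\<lambda>z. c * push X \<theta> f z)"
  and pull_add: "pull X \<theta> (\<lambda>x. f' x + g' x) = (\<lambda>z. pull X \<theta> f' z + pull X \<theta> g' z)"
  and pull_scale: "pull X \<theta> (\<lambda>x. c * f' x) = (\<lambda>z. c * pull X \<theta> f' z)"
  by (auto simp: push_def pull_def)

lemma pull_push: "g \<in> ell2 X \<Longrightarrow> pull X \<theta> (push X \<theta> g) = g"
  by (auto simp: pull_def push_at ell2_outside)

lemma push_pull: "push X \<theta> (pull X \<theta> f) = restr (\<theta> ` X) f"
  by (rule ext) (auto simp: pull_def push_def restr_def inv_into_f_f[OF inj])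

lemma push_ket: "u \<in> X \<Longrightarrow> push X \<theta> (ket u) = ket (\<theta> u)"
  by (rule ext) (auto simp: push_def ket_def inv_into_f_f[OF inj])

lemma pull_ket: "u \<in> X \<Longrightarrow> pull X \<theta> (ket (\<theta> u)) = ket u"
  using inj by (auto simp: pull_def ket_def inj_on_def)

lemma push_bop: "(\<lambda>g\<in>ell2 X. push X \<theta> g) \<in> bop (ell2 X) (ell2 Y)"
  by (rule bopI[where C = 1]) (auto simp: push_ell2 ell2_add ell2_scale push_add push_scale push_norm(2))

lemma pull_bop: "(\<lambda>f\<in>ell2 Y. pull X \<theta> f) \<in> bop (ell2 Y) (ell2 X)"
  by (rule bopI[where C = 1]) (auto simp: pull_ell2 ell2_add ell2_scale pull_add pull_scale)

lemma cinner_pull: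
  assumes g: "g \<in> ell2 X"
  shows "cinner (pull X \<theta> f) g = cinner f (push X \<theta> g)"
  using cinner_push[OF g, of f] by (simp add: cinner_commute[of "pull X \<theta> f"] cinner_commute[of f])

end

section \<open>Periodic streams\<close>

lemma stream_eqI:
  assumes "\<And>i. s !! i = t !! i"
  shows "s = t"
proof -
  have "smap (\<lambda>i. s !! i) nats = smap (\<lambda>i. t !! i) nats" using assms by simp
  then show ?thesis by (simp add: stream_smap_nats[symmetric])
qed

text \<open>Unfolding the fixed point equation \<open>i + 1\<close> times gives both streams the
  prefix \<open>v\<close> repeated \<open>i + 1\<close> times, and position \<open>i\<close> lies
  inside that prefix.\<close>

lemma stream_eq_cycle:
  assumes "s = v @- s" "v \<noteq> []"
  shows "s = cycle v"
proof -
  have "\<exists>t. s = concat (replicate k v) @- t" for k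
  proof (induction k)
    case (Suc k)
    then obtain t where "s = concat (replicate k v) @- t" by blast
    then have "s = v @- concat (replicate k v) @- t" using assms(1) by metis
    then show ?case by auto
  qed auto
  moreover have "\<exists>t. cycle v = concat (replicate k v) @- t" for k
  proof (induction k)
    case (Suc k)
    then obtain t where "cycle v = concat (replicate k v) @- t" by blast
    then have "cycle v = v @- concat (replicate k v) @- t" using cycle_decomp[OF assms(2)] by metis
    then show ?case by auto
  qed auto
  moreover have len: "length (concat (replicate k v)) = k * length v" for k
    by (induction k) auto
  moreover have "i < Suc i * length v" for i
    using assms(2) by (cases v) auto
  ultimately have "s !! i = concat (replicate (Suc i) v) ! i \<and> cycle v !! i = concat (replicate (Suc i) v) ! i" for i
    by (metis shift_snth_less)
  then show ?thesis by (intro stream_eqI) simp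
qed

text \<open>A word that is not primitive is a proper power of a shorter word with the same infinite
  repetition, so induction on the length applies.\<close>

lemma primitive_root:
  assumes "v \<noteq> []"
  shows "\<exists>w. primitive w \<and> cycle v = cycle w"
  using assms
proof (induction "length v" arbitrary: v rule: less_induct)
  case less
  show ?case
  proof (cases "primitive v")
    case False
    then obtain x j where xj: "2 \<le> j" "v = concat (replicate j x)"
      using less.prems by (auto simp: primitive_def)
    have x: "x \<noteq> []" using xj less.prems by (cases x) auto
    obtain i where j: "j = Suc (Suc i)" using xj(1) by (metis add_2_eq_Suc le_Suc_ex)
    have "length x < length v" using x by (auto simp: xj(2) j)
    moreover have "cycle x = concat (replicate k x) @- cycle x" for k
      by (induction k) (auto simp: cycle_decomp[OF x, symmetric])
    then have "cycle x = cycle v"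
      using stream_eq_cycle[of "cycle x" v] less.prems xj(2) by metis
    ultimately show ?thesis using less.hyps[OF _ x] by metis
  qed blast
qed

text \<open>By Bezout the stream is also fixed by dropping \<open>g = gcd d (length v)\<close>
  letters, so \<open>v\<close> is a power of its prefix of length \<open>g\<close>; primitivity
  leaves only \<open>g = length v\<close>.\<close>

lemma primitive_sdrop_cycle:
  assumes v: "primitive v" and d: "sdrop d (cycle v) = cycle v"
  shows "length v dvd d"
proof (cases "d = 0")
  case False
  let ?p = "length v" and ?s = "cycle v"
  have v0: "v \<noteq> []" using v by (simp add: primitive_def)
  define g where "g = gcd d ?p"
  have shift: "sdrop (k * m) ?s = ?s" if "sdrop k ?s = ?s" for k m
  proof (induction m)
    case (Suc m)
    have "sdrop (k * Suc m) ?s = sdrop (k * m) (sdrop k ?s)" by (simp add: add.commute)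
    with Suc that show ?case by simp
  qed simp
  obtain x y where xy: "d * x = ?p * y + g" using bezout_nat[OF False, of ?p] by (auto simp: g_def)
  have "?s = sdrop (?p * y + g) ?s" using shift[OF d, of x] xy by simp
  also have "\<dots> = sdrop g (sdrop (?p * y) ?s)" by simp
  also have "\<dots> = sdrop g ?s" using shift[OF sdrop_cycle_eq[OF v0]] by simp
  finally have g: "sdrop g ?s = ?s" by simp
  have g0: "g > 0" using False by (simp add: g_def)
  define w where "w = stake g ?s"
  have "length w = g" by (simp add: w_def)
  then have w: "w \<noteq> []" "length w = g" using g0 by auto
  have "?s = w @- ?s" using stake_sdrop[of g ?s] g by (simp add: w_def)
  then have s: "?s = cycle w" by (rule stream_eq_cycle[OF _ w(1)])
  have "g dvd ?p" by (simp add: g_def)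
  then have "stake ?p (cycle w) = concat (replicate (?p div g) w)"
    using stake_cycle_eq_mod_0[OF w(1), of ?p] w(2) by (simp add: mod_eq_0_iff_dvd)
  then have "v = concat (replicate (?p div g) w)" using stake_cycle_eq[OF v0] s by simp
  then have "\<not> 2 \<le> ?p div g" using v unfolding primitive_def by blast
  moreover have "?p div g \<noteq> 0" using v0 \<open>g dvd ?p\<close> by (auto simp: dvd_div_eq_0_iff)
  ultimately have "?p div g = 1" by linarith
  then have "g = ?p" using \<open>g dvd ?p\<close> by (metis dvd_div_mult_self mult_1)
  then show ?thesis by (metis g_def gcd_dvd1)
qed simp

section \<open>Left multiplication on the translates of a word\<close>

lemma freduced_append_mult: "freduced (u @ w) \<Longrightarrow> foldr rcons u w = u @ w"
proof (induction u)
  case (Cons a u)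
  then have "freduced (u @ w)" by (cases "u @ w") (auto simp: freduced_def)
  with Cons have "foldr rcons (a # u) w = rcons a (u @ w)" by simp
  also have "\<dots> = a # u @ w" using Cons.prems by (cases "u @ w") (auto simp: freduced_def)
  finally show ?case by simp
qed simp

lemma freduced_pos: "freduced (pos v)"
  by (induction v rule: induct_list012) (auto simp: freduced_def pos_def flip_def)

lemma freduced_neg: "freduced (neg v)"
proof (induction v)
  case (Cons i v)
  then show ?case
    by (cases v) (auto simp: freduced_def neg_def successively_append_iff flip_def last_rev hd_append)
qed (simp add: freduced_def neg_def)

lemma freduced_pos_neg:
  assumes "v = [] \<or> w = [] \<or> last v \<noteq> last w"
  shows "freduced (pos v @ neg w)"
proof -
  have "hd (rev (map (\<lambda>i. (i, False)) w)) = (last w, False)" if "w \<noteq> []"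
    using that by (simp add: hd_rev last_map)
  moreover have "last (map (\<lambda>i. (i, True)) v) = (last v, True)" if "v \<noteq> []"
    using that by (simp add: last_map)
  ultimately show ?thesis
    using assms freduced_pos[of v] freduced_neg[of w]
    by (auto simp: freduced_def successively_append_iff flip_def neg_def pos_def)
qed

locale word_translates =
  fixes n :: enat and \<omega> :: "nat stream"
  assumes omega: "\<omega> \<in> streams (letters n)"
begin

interpretation FG: group "FG n"
  by (rule group_free_group)

lemma mult_FG: "x \<otimes>\<^bsub>FG n\<^esub> y = foldr rcons x y"
  by (simp add: free_group_def)

lemma pos_closed [simp]: "v \<in> lists (letters n) \<Longrightarrow> pos v \<in> carrier (FG n)"
  using freduced_pos by (auto simp: free_group_def pos_def)

lemma neg_closed: "v \<in> lists (letters n) \<Longrightarrow> neg v \<in> carrier (FG n)"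
  using freduced_neg by (auto simp: free_group_def neg_def)

lemma pos_append: "pos (v @ w) = pos v \<otimes>\<^bsub>FG n\<^esub> pos w"
  using freduced_append_mult[of "pos v" "pos w"] freduced_pos[of "v @ w"]
  by (simp add: mult_FG pos_def)

lemma pos_Nil: "pos [] = \<one>\<^bsub>FG n\<^esub>"
  by (simp add: pos_def free_group_def)

lemma pos_inj: "pos v = pos w \<longleftrightarrow> v = w"
  by (simp add: pos_def inj_map_eq_map inj_def)

lemma inv_pos: "v \<in> lists (letters n) \<Longrightarrow> inv\<^bsub>FG n\<^esub> (pos v) = neg v"
proof (rule FG.inv_equality)
  have "neg v = rev (map flip (pos v))"
    by (simp add: neg_def pos_def flip_def rev_map comp_def)
  moreover have "foldr rcons (pos v) [] = pos v" by (rule mult_one_freduced[OF freduced_pos])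
  ultimately show "neg v \<otimes>\<^bsub>FG n\<^esub> pos v = \<one>\<^bsub>FG n\<^esub>"
    using mult_inverse[of "[]" "pos v"] by (simp add: mult_FG free_group_def freduced_def)
qed (simp_all add: neg_closed)

lemma stake_letters [simp]: "stake m (sdrop k \<omega>) \<in> lists (letters n)"
  using omega by (auto simp: streams_iff_snth set_conv_nth in_set_conv_nth stake_nth sdrop_snth)

lemma stake_letters' [simp]: "stake m \<omega> \<in> lists (letters n)"
  using stake_letters[of m 0] by simp

lemma snth_letters [simp]: "\<omega> !! m \<in> letters n"
  using omega by (simp add: streams_iff_snth)

text \<open>The product \<open>v \<omega>\<^sub>m\<inverse>\<close> is not required to be reduced.\<close>

definition elt :: "nat list \<Rightarrow> nat \<Rightarrow> fgword" where
  "elt v m = pos v \<otimes>\<^bsub>FG n\<^esub> inv\<^bsub>FG n\<^esub> (pos (stake m \<omega>))"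

lemma elt_closed [simp]: "v \<in> lists (letters n) \<Longrightarrow> elt v m \<in> carrier (FG n)"
  by (simp add: elt_def)

text \<open>Letters of \<open>\<omega>\<close> appended to both factors cancel. This brings any two
  elements to the same \<open>m\<close>, where \<open>elt\<close> is injective in the word.\<close>

lemma elt_extend:
  assumes v: "v \<in> lists (letters n)"
  shows "elt (v @ stake d (sdrop m \<omega>)) (m + d) = elt v m"
proof -
  let ?a = "pos (stake m \<omega>)" and ?b = "pos (stake d (sdrop m \<omega>))"
  have "pos (stake (m + d) \<omega>) = ?a \<otimes>\<^bsub>FG n\<^esub> ?b"
    unfolding stake_add[symmetric] by (rule pos_append)
  moreover have "pos v \<otimes>\<^bsub>FG n\<^esub> ?b \<otimes>\<^bsub>FG n\<^esub> (inv\<^bsub>FG n\<^esub> ?b \<otimes>\<^bsub>FG n\<^esub> inv\<^bsub>FG n\<^esub> ?a) =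
      pos v \<otimes>\<^bsub>FG n\<^esub> inv\<^bsub>FG n\<^esub> ?a"
    using v by (simp add: FG.m_assoc FG.inv_solve_left flip: FG.m_assoc[of ?b "inv\<^bsub>FG n\<^esub> ?b"])
  ultimately show ?thesis
    using v by (simp add: elt_def pos_append FG.inv_mult_group)
qed

lemma elt_snoc: "v \<in> lists (letters n) \<Longrightarrow> elt (v @ [\<omega> !! m]) (Suc m) = elt v m"
  using elt_extend[of v 1 m] by simp

lemma elt_inj:
  assumes "v \<in> lists (letters n)" "v' \<in> lists (letters n)"
  shows "elt v m = elt v' m \<longleftrightarrow> v = v'"
  using assms by (simp add: elt_def pos_inj)

lemma elt_eq_iff:
  assumes "v \<in> lists (letters n)" "v' \<in> lists (letters n)" "m \<le> m'"
  shows "elt v m = elt v' m' \<longleftrightarrow> v' = v @ stake (m' - m) (sdrop m \<omega>)"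
proof -
  have "v @ stake (m' - m) (sdrop m \<omega>) \<in> lists (letters n)"
    using assms(1) stake_letters[of "m' - m" m] by (metis append_in_lists_conv)
  from elt_inj[OF this assms(2), of m'] show ?thesis
    using elt_extend[OF assms(1), of "m' - m" m] assms(3) by auto
qed

lemma elt_reduced:
  assumes "v \<in> lists (letters n)" "v = [] \<or> m = 0 \<or> last v \<noteq> \<omega> !! (m - 1)"
  shows "elt v m = pos v @ neg (stake m \<omega>)"
proof -
  have "v = [] \<or> stake m \<omega> = [] \<or> last v \<noteq> last (stake m \<omega>)"
    using assms(2) by (cases m) (auto simp: stake_Suc simp del: stake.simps)
  then show ?thesis
    using freduced_append_mult[OF freduced_pos_neg] assms(1) by (simp add: elt_def inv_pos mult_FG)
qed

lemma elt_reduced_in_F_omega: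
  assumes "v \<in> lists (letters n)" "v = [] \<or> m = 0 \<or> last v \<noteq> \<omega> !! (m - 1)"
  shows "elt v m \<in> F_omega n \<omega>"
  unfolding F_omega_def
  by (intro CollectI conjI elt_closed assms(1) bexI[of _ v] exI[of _ m] elt_reduced assms)

lemma elt_in_F_omega: "v \<in> lists (letters n) \<Longrightarrow> elt v m \<in> F_omega n \<omega>"
proof (induction m arbitrary: v)
  case 0
  then show ?case
    by (simp add: elt_reduced_in_F_omega)
next
  case (Suc m)
  show ?case
  proof (cases "v = [] \<or> last v \<noteq> \<omega> !! m")
    case True
    then show ?thesis
      using Suc.prems by (intro elt_reduced_in_F_omega) auto
  next
    case False
    then have v: "v = butlast v @ [\<omega> !! m]" using append_butlast_last_id by metis
    then have b: "butlast v \<in> lists (letters n)" using Suc.prems by (metis append_in_lists_conv)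
    show ?thesis using Suc.IH[OF b] elt_snoc[OF b, of m] v by simp
  qed
qed

lemma F_omega_elt: "u \<in> F_omega n \<omega> \<longleftrightarrow> (\<exists>v\<in>lists (letters n). \<exists>m. u = elt v m)"
proof
  assume "u \<in> F_omega n \<omega>"
  then obtain v m where vm: "v \<in> lists (letters n)" "u = pos v @ neg (stake m \<omega>)" "freduced u"
    by (auto simp: F_omega_def free_group_def)
  then have "u = elt v m"
    using freduced_append_mult[of "pos v" "neg (stake m \<omega>)"] by (simp add: elt_def inv_pos mult_FG)
  with vm(1) show "\<exists>v\<in>lists (letters n). \<exists>m. u = elt v m" by blast
qed (auto intro: elt_in_F_omega)

lemma F_omega_carrier: "u \<in> F_omega n \<omega> \<Longrightarrow> u \<in> carrier (FG n)"
  by (simp add: F_omega_def)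

text \<open>Extending each representation by the other's index makes both indices
  \<open>m + m'\<close>. For the common \<open>m\<close>, \<open>elt [] m\<close> is a common
  ancestor.\<close>

lemma F_omega_common:
  assumes "u \<in> F_omega n \<omega>" "w \<in> F_omega n \<omega>"
  obtains v v' m where "v \<in> lists (letters n)" "v' \<in> lists (letters n)" "u = elt v m" "w = elt v' m"
proof -
  obtain v m v' m' where *: "v \<in> lists (letters n)" "u = elt v m" "v' \<in> lists (letters n)" "w = elt v' m'"
    using assms by (auto simp: F_omega_elt)
  show thesis
    by (rule that[of "v @ stake m' (sdrop m \<omega>)" "v' @ stake m (sdrop m' \<omega>)" "m + m'"])
      (use * elt_extend[of v m' m] elt_extend[of v' m m'] in \<open>simp_all add: add.commute\<close>)
qed

abbreviation \<mu> :: "nat \<Rightarrow> fgword \<Rightarrow> fgword" where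
  "\<mu> i u \<equiv> pos [i] \<otimes>\<^bsub>FG n\<^esub> u"

lemma mu_elt: "i \<in> letters n \<Longrightarrow> v \<in> lists (letters n) \<Longrightarrow> \<mu> i (elt v m) = elt (i # v) m"
  using pos_append[of "[i]" v] by (simp add: elt_def FG.m_assoc)

lemma mu_closed: "i \<in> letters n \<Longrightarrow> u \<in> F_omega n \<omega> \<Longrightarrow> \<mu> i u \<in> F_omega n \<omega>"
  using mu_elt elt_in_F_omega F_omega_elt by (metis Cons_in_lists_iff)

lemma mu_inj:
  assumes "i \<in> letters n" "j \<in> letters n" "u \<in> F_omega n \<omega>" "w \<in> F_omega n \<omega>" "\<mu> i u = \<mu> j w"
  shows "i = j \<and> u = w"
proof -
  obtain v v' m where *: "v \<in> lists (letters n)" "v' \<in> lists (letters n)" "u = elt v m" "w = elt v' m"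
    using F_omega_common assms by blast
  then have "i # v = j # v'"
    using assms elt_inj[of "i # v" "j # v'" m] by (simp add: mu_elt)
  with * show ?thesis by simp
qed

text \<open>There is no root: an inverse prefix has the next longer inverse prefix as its
  predecessor. Streams are indexed from 0, so \<open>\<omega> !! m\<close> is the letter by which
  the prefix of length \<open>m\<close> is extended.\<close>

lemma elt_Nil: "elt [] m = \<mu> (\<omega> !! m) (elt [] (Suc m))"
  using elt_snoc[of "[]" m] by (simp add: mu_elt)

lemma mu_cover: "u \<in> F_omega n \<omega> \<Longrightarrow> \<exists>i\<in>letters n. \<exists>w\<in>F_omega n \<omega>. u = \<mu> i w"
proof -
  assume "u \<in> F_omega n \<omega>"
  then obtain v m where v: "v \<in> lists (letters n)" "u = elt v m" by (auto simp: F_omega_elt)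
  show ?thesis
  proof (cases v)
    case Nil
    then show ?thesis using v elt_Nil[of m] elt_in_F_omega[of "[]" "Suc m"] snth_letters by blast
  next
    case (Cons i v')
    then show ?thesis using v mu_elt[of i v' m] elt_in_F_omega[of v' m] by (metis Cons_in_lists_iff)
  qed
qed

text \<open>Each \<open>elt v m\<close> is reached from \<open>elt [] m\<close> by left
  multiplications, and any two elements can be written with the same \<open>m\<close>. Used to show
  that matrix entries do not depend on the base point.\<close>

lemma F_omega_connected:
  assumes \<phi>: "\<And>i u. i \<in> letters n \<Longrightarrow> u \<in> F_omega n \<omega> \<Longrightarrow> \<phi> (\<mu> i u) \<longleftrightarrow> \<phi> u"
    and "u \<in> F_omega n \<omega>" "w \<in> F_omega n \<omega>"
  shows "\<phi> u \<longleftrightarrow> \<phi> w"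
proof -
  have "\<phi> (elt v m) \<longleftrightarrow> \<phi> (elt [] m)" if "v \<in> lists (letters n)" for v m
    using that
  proof (induction v)
    case (Cons i v)
    then show ?case using \<phi>[of i "elt v m"] by (simp add: mu_elt elt_in_F_omega)
  qed simp
  then show ?thesis using F_omega_common assms(2,3) by metis
qed

text \<open>Removing first letters from \<open>elt v m\<close> forever spells the stream
  \<open>v @- sdrop m \<omega>\<close>; this is one step of that process.\<close>

lemma elt_step:
  assumes "v \<in> lists (letters n)" "i \<in> letters n" "u \<in> F_omega n \<omega>" "elt v m = \<mu> i u"
  shows "\<exists>v1\<in>lists (letters n). \<exists>m1. u = elt v1 m1 \<and> v @- sdrop m \<omega> = i ## (v1 @- sdrop m1 \<omega>)"
proof (cases v)
  case Nil
  have "\<omega> !! m = i \<and> elt [] (Suc m) = u"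
    by (rule mu_inj) (use assms Nil elt_Nil[of m] elt_in_F_omega in auto)
  then have "u = elt [] (Suc m) \<and> v @- sdrop m \<omega> = i ## ([] @- sdrop (Suc m) \<omega>)"
    using Nil id_stake_snth_sdrop[of "sdrop m \<omega>" 0] by (simp add: sdrop_snth)
  then show ?thesis by blast
next
  case (Cons j v')
  have "j = i \<and> elt v' m = u"
    by (rule mu_inj) (use assms Cons mu_elt elt_in_F_omega in auto)
  then have "u = elt v' m \<and> v @- sdrop m \<omega> = i ## (v' @- sdrop m \<omega>)" using Cons by simp
  then show ?thesis using assms(1) Cons by auto
qed

text \<open>A simulation along predecessors: related elements share the first letter and their
  predecessors are again related. The support of the matrix of a reducing projection has this
  property.\<close>

definition back_closed :: "(fgword \<Rightarrow> fgword \<Rightarrow> bool) \<Rightarrow> bool" where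
  "back_closed E \<longleftrightarrow> (\<forall>u w. E u w \<longrightarrow> (\<exists>i\<in>letters n. \<exists>u'\<in>F_omega n \<omega>. \<exists>w'\<in>F_omega n \<omega>.
      u = \<mu> i u' \<and> w = \<mu> i w' \<and> E u' w'))"

text \<open>Following predecessors \<open>N\<close> times shows that the two predecessor streams
  agree on their first \<open>N\<close> letters.\<close>

lemma back_closed_branch:
  assumes pred: "back_closed E"
    and "E (elt v m) (elt v' m')" "v \<in> lists (letters n)" "v' \<in> lists (letters n)"
  shows "v @- sdrop m \<omega> = v' @- sdrop m' \<omega>"
proof -
  have "stake N (v @- sdrop m \<omega>) = stake N (v' @- sdrop m' \<omega>)" for N
    using assms(2-4)
  proof (induction N arbitrary: v m v' m')
    case (Suc N)
    obtain i u w where iuw: "i \<in> letters n" "u \<in> F_omega n \<omega>" "w \<in> F_omega n \<omega>"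
        "elt v m = \<mu> i u" "elt v' m' = \<mu> i w" "E u w"
      using pred Suc.prems(1) unfolding back_closed_def by metis
    obtain v1 m1 where 1: "v1 \<in> lists (letters n)" "u = elt v1 m1" "v @- sdrop m \<omega> = i ## (v1 @- sdrop m1 \<omega>)"
      using elt_step[OF Suc.prems(2) iuw(1,2,4)] by blast
    obtain v2 m2 where 2: "v2 \<in> lists (letters n)" "w = elt v2 m2" "v' @- sdrop m' \<omega> = i ## (v2 @- sdrop m2 \<omega>)"
      using elt_step[OF Suc.prems(3) iuw(1,3,5)] by blast
    show ?case using Suc.IH[of v1 m1 v2 m2] iuw(6) 1 2 by simp
  qed simp
  then have "(v @- sdrop m \<omega>) !! i = (v' @- sdrop m' \<omega>) !! i" for i
    by (metis stake_nth lessI)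
  then show ?thesis by (rule stream_eqI)
qed

lemma back_closed_elt:
  assumes pred: "back_closed E"
    and E: "E u w"
  obtains v m m' where "v \<in> lists (letters n)" "u = elt v m" "w = elt v m'" "sdrop m \<omega> = sdrop m' \<omega>"
proof -
  have "u \<in> F_omega n \<omega>" "w \<in> F_omega n \<omega>" using pred E mu_closed unfolding back_closed_def by metis+
  then obtain v m v' m' where *: "v \<in> lists (letters n)" "u = elt v m" "v' \<in> lists (letters n)" "w = elt v' m'"
    by (auto simp: F_omega_elt)
  \<comment> \<open>Both words are lengthened to \<open>length v + length v'\<close>. With equal
    lengths, equality of the predecessor streams splits into equality of the words and of the
    tails.\<close>
  define a where "a = v @ stake (length v') (sdrop m \<omega>)"
  define b where "b = v' @ stake (length v) (sdrop m' \<omega>)"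
  have ab: "a \<in> lists (letters n)" "b \<in> lists (letters n)" "length a = length b"
    "u = elt a (m + length v')" "w = elt b (m' + length v)"
    using * elt_extend[of v "length v'" m] elt_extend[of v' "length v" m'] by (auto simp: a_def b_def)
  have "a @- sdrop (m + length v') \<omega> = b @- sdrop (m' + length v) \<omega>"
    using back_closed_branch[OF pred, of a "m + length v'" b "m' + length v"] E ab by blast
  with ab(3) have "a = b \<and> sdrop (m + length v') \<omega> = sdrop (m' + length v) \<omega>"
    by (metis shift_left_inj stake_shift diff_self_eq_0 stake.simps(1) append_Nil2 take_all order_refl)
  with ab that show thesis by blast
qed

text \<open>Equal tails of \<open>\<omega>\<close> at two different positions would make
  \<open>\<omega>\<close> eventually periodic, so the two indices coincide.\<close>

lemma aperiodic_back_closed: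
  assumes aper: "\<not> eventually_periodic \<omega>"
    and pred: "back_closed E"
    and E: "E u w"
  shows "u = w"
proof -
  obtain v m m' where v: "v \<in> lists (letters n)"
    and *: "u = elt v m" "w = elt v m'" "sdrop m \<omega> = sdrop m' \<omega>"
    by (rule back_closed_elt[OF pred E])
  have "False" if "a < b" "sdrop a \<omega> = sdrop b \<omega>" for a b
  proof -
    let ?s = "sdrop a \<omega>"
    have "sdrop (b - a) ?s = sdrop b \<omega>" using that(1) by simp
    then have "?s = stake (b - a) ?s @- ?s"
      using that(2) stake_sdrop[of "b - a" ?s] by metis
    then have "?s = cycle (stake (b - a) ?s)"
      by (rule stream_eq_cycle) (use that in \<open>simp flip: length_greater_0_conv\<close>)
    then have "\<omega> = stake a \<omega> @- cycle (stake (b - a) ?s)" using stake_sdrop[of a \<omega>] by simp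
    moreover have "stake (b - a) ?s \<noteq> []" using that by (simp flip: length_greater_0_conv)
    ultimately show False using aper unfolding eventually_periodic_def by blast
  qed
  then have "m = m'" using *(3) by (metis linorder_neqE_nat)
  with * show ?thesis by simp
qed

end

section \<open>Right translation by powers of a primitive period\<close>

locale periodic_translates = word_translates n "cycle v0" for n v0 +
  assumes v0: "primitive v0"
begin

interpretation FG: group "FG n"
  by (rule group_free_group)

abbreviation p :: nat where "p \<equiv> length v0"

lemma v0_Nil [simp]: "v0 \<noteq> []"
  using v0 by (simp add: primitive_def)

lemma v0_letters [simp]: "v0 \<in> lists (letters n)"
  using stake_letters'[of p] by simp

text \<open>An action of the integers on \<open>F_omega n (cycle v0)\<close> that commutes with
  every \<open>\<mu> i\<close>. It turns out to be free, and its orbits are where the projection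
  matrices become convolutions.\<close>

definition act :: "fgword \<Rightarrow> int \<Rightarrow> fgword" where
  "act u l = u \<otimes>\<^bsub>FG n\<^esub> (pos v0 [^]\<^bsub>FG n\<^esub> l)"

lemma act_0: "u \<in> F_omega n (cycle v0) \<Longrightarrow> act u 0 = u"
  by (simp add: act_def F_omega_carrier)

lemma act_act_carrier: "u \<in> carrier (FG n) \<Longrightarrow> act (act u a) b = act u (a + b)"
  by (simp add: act_def FG.m_assoc FG.int_pow_mult)

lemma act_act: "u \<in> F_omega n (cycle v0) \<Longrightarrow> act (act u a) b = act u (a + b)"
  by (rule act_act_carrier[OF F_omega_carrier])

lemma mu_act: "i \<in> letters n \<Longrightarrow> u \<in> F_omega n (cycle v0) \<Longrightarrow> \<mu> i (act u a) = act (\<mu> i u) a"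
  by (simp add: act_def FG.m_assoc F_omega_carrier)

lemma stake_periods: "stake (p * q + m) (cycle v0) = concat (replicate q v0) @ stake m (cycle v0)"
proof -
  have "sdrop (p * q) (cycle v0) = cycle v0" by simp
  moreover have "stake (p * q) (cycle v0) = concat (replicate q v0)" by simp
  ultimately show ?thesis by (simp only: stake_add[symmetric])
qed

lemma pos_concat_replicate: "pos (concat (replicate q v0)) = pos v0 [^]\<^bsub>FG n\<^esub> q"
proof (induction q)
  case (Suc q)
  have "pos (concat (replicate (Suc q) v0)) = pos v0 \<otimes>\<^bsub>FG n\<^esub> pos v0 [^]\<^bsub>FG n\<^esub> q"
    using Suc by (simp add: pos_append)
  then show ?case using FG.nat_pow_Suc2[of "pos v0" q] by simp
qed (simp add: pos_Nil)

text \<open>The prefix of length \<open>p * q + m\<close> is \<open>v0\<close> repeated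
  \<open>q\<close> times followed by the prefix of length \<open>m\<close>; inverting moves the
  power of \<open>v0\<close> to the right end.\<close>

lemma elt_periods:
  assumes "v \<in> lists (letters n)"
  shows "elt v (p * q + m) = act (elt v m) (- int q)"
proof -
  let ?g = "pos v0 [^]\<^bsub>FG n\<^esub> q"
  have "pos (stake (p * q + m) (cycle v0)) = ?g \<otimes>\<^bsub>FG n\<^esub> pos (stake m (cycle v0))"
    by (simp only: stake_periods pos_append pos_concat_replicate)
  moreover have "pos v0 [^]\<^bsub>FG n\<^esub> (- int q) = inv\<^bsub>FG n\<^esub> ?g"
    by (simp add: FG.int_pow_neg int_pow_int)
  ultimately show ?thesis
    using assms by (simp add: elt_def act_def FG.inv_mult_group FG.m_assoc)
qed

text \<open>A negative power only lengthens the prefix. For a positive power the element is first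
  extended by \<open>q\<close> whole periods, which the power then removes.\<close>

lemma act_closed: "u \<in> F_omega n (cycle v0) \<Longrightarrow> act u l \<in> F_omega n (cycle v0)"
proof -
  assume u: "u \<in> F_omega n (cycle v0)"
  then obtain v m where v: "v \<in> lists (letters n)" "u = elt v m" by (auto simp: F_omega_elt)
  show ?thesis
  proof (cases "l \<le> 0")
    case True
    then have "act u l = elt v (p * nat (- l) + m)" using elt_periods[OF v(1)] v(2) by simp
    then show ?thesis using elt_in_F_omega v(1) by simp
  next
    case False
    define q where "q = nat l"
    define v' where "v' = v @ stake (p * q) (sdrop m (cycle v0))"
    have v': "v' \<in> lists (letters n)" using v(1) stake_letters[of "p * q" m] by (simp add: v'_def)
    have "u = act (elt v' m) (- int q)"
      using elt_extend[OF v(1), of "p * q" m] v(2) elt_periods[OF v', of q m]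
      by (simp add: v'_def add.commute)
    then have "act u l = elt v' m"
      using False act_act[OF elt_in_F_omega[OF v'], of m "- int q" l] act_0[OF elt_in_F_omega[OF v']]
      by (simp add: q_def)
    then show ?thesis using elt_in_F_omega v' by simp
  qed
qed

lemma periodic_back_closed:
  assumes pred: "back_closed E"
    and E: "E u w"
  shows "\<exists>j. w = act u j"
proof -
  obtain v m m' where *: "v \<in> lists (letters n)" "u = elt v m" "w = elt v m'"
    "sdrop m (cycle v0) = sdrop m' (cycle v0)"
    by (rule back_closed_elt[OF pred E])
  have main: "\<exists>q. b = p * q + a" if "a \<le> b" "sdrop a (cycle v0) = sdrop b (cycle v0)" for a b
  proof -
    \<comment> \<open>Dropping \<open>p * a - a\<close> further letters from both tails turns the
      first into \<open>cycle v0\<close> and the second into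
      \<open>sdrop (b - a) (cycle v0)\<close>, so \<open>cycle v0\<close> is fixed by dropping
      \<open>b - a\<close> letters.\<close>
    have "a \<le> p * a" by (cases v0) auto
    have per: "sdrop (p * a) (cycle v0) = cycle v0" by simp
    have "p * a + (b - a) = b + (p * a - a)" using that(1) \<open>a \<le> p * a\<close> by simp
    then have "sdrop (b - a) (sdrop (p * a) (cycle v0)) = sdrop (b + (p * a - a)) (cycle v0)"
      by (simp only: sdrop_add)
    then have "sdrop (b - a) (cycle v0) = sdrop (b + (p * a - a)) (cycle v0)" by (simp only: per)
    also have "\<dots> = sdrop (p * a - a) (sdrop b (cycle v0))" by simp
    also have "\<dots> = sdrop (p * a - a) (sdrop a (cycle v0))" using that(2) by simp
    also have "\<dots> = cycle v0" using per \<open>a \<le> p * a\<close> by simp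
    finally have "p dvd b - a" by (rule primitive_sdrop_cycle[OF v0])
    then obtain q where "b - a = p * q" by blast
    then show ?thesis using that(1) by (intro exI[of _ q]) simp
  qed
  show ?thesis
  proof (cases "m \<le> m'")
    case True
    then obtain q where "m' = p * q + m" using main *(4) by blast
    then show ?thesis using elt_periods[OF *(1)] *(2,3) by blast
  next
    case False
    then obtain q where "m = p * q + m'" using main[of m' m] *(4) by fastforce
    then have "u = act w (- int q)" using elt_periods[OF *(1)] *(2,3) by simp
    then have "act u (int q) = w"
      using act_act[of w "- int q" "int q"] act_0[of w] elt_in_F_omega *(1,3) by simp
    then show ?thesis by metis
  qed
qed

lemma letter_Suc: "letter v0 (Suc m) = cycle v0 !! m"
  by (simp add: letter_def)

lemma cycle_snth_period: "cycle v0 !! (p * q + m) = cycle v0 !! m"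
  using sdrop_snth[of "p * q" "cycle v0" m] by (simp add: sdrop_cycle_eq_mod_0)

lemma letter_period: "letter v0 (p * q + m) = letter v0 m"
proof (cases m)
  case 0
  show ?thesis
  proof (cases q)
    case (Suc q')
    \<comment> \<open>The convention that index 0 carries the letter with index \<open>p\<close>
      extends periodicity to the multiples of \<open>p\<close>.\<close>
    have "p * q + m = Suc (p * q' + (p - 1))" using 0 Suc by (cases v0) auto
    then show ?thesis using 0 cycle_snth_period[of q' "p - 1"] by (simp add: letter_def)
  qed (simp add: 0)
next
  case (Suc m')
  then show ?thesis using cycle_snth_period[of q m'] by (simp add: letter_def)
qed

text \<open>For \<open>m > 0\<close> the condition on the last letter says that the word is reduced.
  For \<open>m = 0\<close> it forbids \<open>v\<close> to end in the last letter of
  \<open>v0\<close>: such an element has a translate with \<open>m = p - 1\<close>, and the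
  component is to meet each orbit only once per block of \<open>p\<close> indices.\<close>

lemma component_elt:
  "component n v0 a b = {elt v m | v m. v \<in> lists (letters n) \<and> (v \<noteq> [] \<longrightarrow> last v \<noteq> letter v0 m) \<and> a \<le> m \<and> m < b}"
proof -
  have eq: "v \<in> lists (letters n) - {x @ [letter v0 m] | x. x \<in> lists (letters n)} \<longleftrightarrow>
      v \<in> lists (letters n) \<and> (v \<noteq> [] \<longrightarrow> last v \<noteq> letter v0 m)" for v m
  proof (cases v rule: rev_cases)
    case (snoc x a)
    then show ?thesis by auto
  qed auto
  have "pos v @ neg (stake m (cycle v0)) = elt v m"
    if "v \<in> lists (letters n)" "v \<noteq> [] \<longrightarrow> last v \<noteq> letter v0 m" for v m
    by (rule elt_reduced[symmetric]) (use that in \<open>cases m; auto simp: letter_def\<close>)+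
  then show ?thesis unfolding component_def eq by (intro Collect_cong) metis
qed

lemma in_block_iff: "u \<in> block n v0 r \<longleftrightarrow> (\<exists>v m. u = elt v m \<and> v \<in> lists (letters n) \<and>
    (v \<noteq> [] \<longrightarrow> last v \<noteq> letter v0 m) \<and> r * p \<le> m \<and> m < (r + 1) * p)"
  unfolding block_def component_elt by (rule mem_Collect_eq)

lemma blockI: "v \<in> lists (letters n) \<Longrightarrow> (v \<noteq> [] \<Longrightarrow> last v \<noteq> letter v0 m) \<Longrightarrow> r * p \<le> m \<Longrightarrow>
    m < (r + 1) * p \<Longrightarrow> elt v m \<in> block n v0 r"
  unfolding in_block_iff by blast

lemma block_sub: "block n v0 r \<subseteq> F_omega n (cycle v0)"
  using elt_in_F_omega unfolding subset_iff in_block_iff by blast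

text \<open>Adding \<open>r\<close> whole periods to \<open>m\<close> is a translation by
  \<open>- r\<close> and leaves the condition on the last letter unchanged, by
  \<open>letter_period\<close>.\<close>

lemma block_eq: "block n v0 r = (\<lambda>g. act g (- int r)) ` block n v0 0"
proof
  show "block n v0 r \<subseteq> (\<lambda>g. act g (- int r)) ` block n v0 0"
  proof
    fix u assume "u \<in> block n v0 r"
    then obtain v m where vm: "u = elt v m" "v \<in> lists (letters n)" "v \<noteq> [] \<longrightarrow> last v \<noteq> letter v0 m"
      "r * p \<le> m" "m < (r + 1) * p"
      by (auto simp only: in_block_iff)
    define m' where "m' = m - r * p"
    have m: "m = p * r + m'" "m' < p" using vm(4,5) by (auto simp: m'_def algebra_simps)
    have "u = act (elt v m') (- int r)" using vm(1,2) m elt_periods by simp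
    moreover have "elt v m' \<in> block n v0 0"
      using vm(2,3) m letter_period[of r m'] by (intro blockI) auto
    ultimately show "u \<in> (\<lambda>g. act g (- int r)) ` block n v0 0" by blast
  qed
  show "(\<lambda>g. act g (- int r)) ` block n v0 0 \<subseteq> block n v0 r"
  proof
    fix u assume "u \<in> (\<lambda>g. act g (- int r)) ` block n v0 0"
    then obtain g where g: "g \<in> block n v0 0" "u = act g (- int r)" by blast
    from g(1)[unfolded in_block_iff] obtain v m where "g = elt v m" "v \<in> lists (letters n)"
      "v \<noteq> [] \<longrightarrow> last v \<noteq> letter v0 m" "m < p"
      by (metis add_0 mult_1)
    with g(2) have vm: "u = act (elt v m) (- int r)" "v \<in> lists (letters n)"
      "v \<noteq> [] \<longrightarrow> last v \<noteq> letter v0 m" "m < p"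
      by simp_all
    then have "u = elt v (p * r + m)" using elt_periods by simp
    moreover have "r * p \<le> p * r + m" "p * r + m < (r + 1) * p" using vm(4) by (auto simp: algebra_simps)
    moreover have "last v \<noteq> letter v0 (p * r + m)" if "v \<noteq> []" using vm(3) that letter_period by simp
    ultimately show "u \<in> block n v0 r" using blockI[OF vm(2)] by simp
  qed
qed

lemma principal_component_eq: "principal_component n v0 k = (\<Union>r<k. block n v0 r)"
proof -
  have "m < k * p \<longleftrightarrow> (\<exists>r<k. r * p \<le> m \<and> m < (r + 1) * p)" for m
  proof
    assume "m < k * p"
    then have "m div p < k" by (simp add: div_less_iff_less_mult)
    moreover have "m div p * p \<le> m" "m < (m div p + 1) * p"
      using dividend_less_div_times[of p m] by (auto simp: algebra_simps)
    ultimately show "\<exists>r<k. r * p \<le> m \<and> m < (r + 1) * p" by blast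
  next
    assume "\<exists>r<k. r * p \<le> m \<and> m < (r + 1) * p"
    then obtain r where "r < k" "m < (r + 1) * p" by blast
    moreover from this have "(r + 1) * p \<le> k * p" by (intro mult_le_mono1) simp
    ultimately show "m < k * p" by linarith
  qed
  then show ?thesis
    unfolding principal_component_def component_elt set_eq_iff UN_iff in_block_iff mem_Collect_eq lessThan_iff by simp blast
qed

text \<open>Cancel the last letter of \<open>v\<close> against the letter of \<open>\<omega>\<close>
  with index \<open>m\<close> while they agree, wrapping from index 0 around to \<open>p\<close> at
  the price of one translation. Keeping \<open>m\<close> between 1 and \<open>p\<close> guarantees a
  letter to compare with.\<close>

lemma block_cover: "u \<in> F_omega n (cycle v0) \<Longrightarrow> \<exists>g\<in>block n v0 0. \<exists>l. u = act g l"
proof -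
  have "\<exists>g\<in>block n v0 0. \<exists>l. elt v m = act g l" if "v \<in> lists (letters n)" "1 \<le> m" "m \<le> p" for v m
    using that
  proof (induction v arbitrary: m rule: rev_induct)
    case Nil
    show ?case
    proof (cases "m < p")
      case True
      then have "elt [] m \<in> block n v0 0" by (intro blockI) auto
      moreover have "elt [] m = act (elt [] m) 0" by (rule act_0[symmetric]) (simp add: elt_in_F_omega)
      ultimately show ?thesis by blast
    next
      case False
      then have "elt [] m = act (elt [] 0) (- int 1)" using Nil elt_periods[of "[]" 1 0] by simp
      moreover have "elt [] 0 \<in> block n v0 0" by (intro blockI) auto
      ultimately show ?thesis by blast
    qed
  next
    case (snoc i v)
    then have v: "v \<in> lists (letters n)" and vi: "v @ [i] \<in> lists (letters n)" by auto
    obtain m' where m': "m = Suc m'" using snoc.prems(2) by (cases m) auto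
    show ?case
    proof (cases "i = cycle v0 !! m'")
      case True
      then have eq: "elt (v @ [i]) m = elt v m'" using elt_snoc[OF v, of m'] m' by simp
      show ?thesis
      proof (cases m')
        case 0
        have "elt v p = act (elt v 0) (- int 1)" using elt_periods[OF v, of 1 0] by simp
        then have "act (elt v p) 1 = elt v 0"
          using act_act[OF elt_in_F_omega[OF v], of 0 "-1" 1] act_0[OF elt_in_F_omega[OF v]] by simp
        moreover obtain g l where gl: "g \<in> block n v0 0" "elt v p = act g l"
          using snoc.IH[OF v, of p] by (metis One_nat_def Suc_leI length_greater_0_conv order_refl v0_Nil)
        ultimately have "elt (v @ [i]) m = act g (l + 1)"
          using eq 0 act_act[of g l 1] block_sub by fastforce
        with gl(1) show ?thesis by blast
      next
        case (Suc m'')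
        then show ?thesis using snoc.IH[OF v, of m'] eq m' snoc.prems by simp
      qed
    next
      case False
      show ?thesis
      proof (cases "m < p")
        case True
        then have "elt (v @ [i]) m \<in> block n v0 0"
          using False vi m' letter_Suc[of m'] by (intro blockI) auto
        moreover have "elt (v @ [i]) m = act (elt (v @ [i]) m) 0"
          by (rule act_0[symmetric]) (rule elt_in_F_omega[OF vi])
        ultimately show ?thesis by blast
      next
        case F: False
        then have mp: "m = p" using snoc.prems by simp
        have "elt (v @ [i]) m = act (elt (v @ [i]) 0) (- int 1)"
          using mp elt_periods[OF vi, of 1 0] by simp
        \<comment> \<open>Index \<open>p\<close> is outside the block, so the element is moved to
          index 0. The convention for \<open>letter v0 0\<close> makes the same word admissible
          there.\<close>
        moreover have "letter v0 0 = cycle v0 !! m'" using mp m' letter_def[of v0 0] by (metis diff_Suc_1)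
        then have "elt (v @ [i]) 0 \<in> block n v0 0"
          using False vi by (intro blockI) auto
        ultimately show ?thesis by blast
      qed
    qed
  qed
  note main = this
  assume "u \<in> F_omega n (cycle v0)"
  then obtain v m where v: "v \<in> lists (letters n)" "u = elt v m" by (auto simp: F_omega_elt)
  \<comment> \<open>The representative of \<open>m\<close> modulo \<open>p\<close> between 1 and
    \<open>p\<close>, as required by the induction above.\<close>
  define r where "r = (if m mod p = 0 then p else m mod p)"
  have p0: "0 < p" by simp
  have r: "1 \<le> r" "r \<le> p" using p0 mod_less_divisor[OF p0, of m] by (auto simp: r_def simp del: mod_less_divisor)
  have "\<exists>a. elt v m = act (elt v r) a"
  proof (cases "m mod p = 0")
    case True
    then obtain q where q: "m = p * q" by auto
    have "elt v p = act (elt v 0) (- int 1)" "elt v m = act (elt v 0) (- int q)"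
      using elt_periods[OF v(1), of 1 0] elt_periods[OF v(1), of q 0] q by simp_all
    then have "elt v m = act (elt v p) (1 - int q)"
      using act_act[OF elt_in_F_omega[OF v(1)], of 0 "-1" "1 - int q"] by simp
    then show ?thesis using True by (auto simp: r_def)
  next
    case False
    have "m = p * (m div p) + r" using False by (simp add: r_def)
    then show ?thesis using elt_periods[OF v(1), of "m div p" r] by metis
  qed
  then obtain a where a: "u = act (elt v r) a" using v(2) by blast
  obtain g l where gl: "g \<in> block n v0 0" "elt v r = act g l" using main[OF v(1) r] by blast
  have "u = act g (l + a)" using a gl act_act[of g l a] block_sub by auto
  with gl(1) show ?thesis by blast
qed

text \<open>After translating both sides to nonpositive powers, they become two representations
  \<open>elt\<close> with admissible words. Different indices would force the word with the larger
  index to end in the forbidden letter.\<close>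

lemma block_unique:
  assumes "g \<in> block n v0 0" "g' \<in> block n v0 0" "act g l = act g' l'"
  shows "g = g' \<and> l = l'"
proof -
  obtain v m where vm: "g = elt v m" "v \<in> lists (letters n)" "v \<noteq> [] \<longrightarrow> last v \<noteq> letter v0 m" "m < p"
    using assms(1) by (auto simp: in_block_iff)
  obtain v' m' where vm': "g' = elt v' m'" "v' \<in> lists (letters n)" "v' \<noteq> [] \<longrightarrow> last v' \<noteq> letter v0 m'" "m' < p"
    using assms(2) by (auto simp: in_block_iff)
  \<comment> \<open>Large enough to make both exponents \<open>l - N\<close> and
    \<open>l' - N\<close> nonpositive, since \<open>elt_periods\<close> covers only those.\<close>
  define N where "N = 1 + \<bar>l\<bar> + \<bar>l'\<bar>"
  define a where "a = nat (N - l)"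
  define b where "b = nat (N - l')"
  have "l \<le> N" "l' \<le> N" unfolding N_def by linarith+
  then have ab: "- int a = l - N" "- int b = l' - N" by (simp_all add: a_def b_def)
  have "act (act g l) (- N) = act (act g' l') (- N)" using assms(3) by simp
  then have "act g (- int a) = act g' (- int b)"
    using act_act[OF subsetD[OF block_sub assms(1)], of l "- N"]
      act_act[OF subsetD[OF block_sub assms(2)], of l' "- N"]
    by (simp add: ab)
  then have eq: "elt v (p * a + m) = elt v' (p * b + m')"
    using vm vm' elt_periods by simp
  \<comment> \<open>If the second index is the larger one, \<open>elt_eq_iff\<close> exhibits
    \<open>y\<close> as \<open>x\<close> followed by letters of the stream, the last of which is
    exactly the letter excluded for \<open>y\<close>.\<close>
  have ne: False if "x \<in> lists (letters n)" "y \<in> lists (letters n)" "y \<noteq> [] \<longrightarrow> last y \<noteq> letter v0 c"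
      "c < p" "s < p * b + c" "elt x s = elt y (p * b + c)" for x y s b c
  proof -
    have y: "y = x @ stake (p * b + c - s) (sdrop s (cycle v0))"
      using that elt_eq_iff[OF that(1,2), of s "p * b + c"] by simp
    have "\<exists>e. p * b + c = Suc (s + e)" using less_imp_Suc_add[OF that(5)] by simp
    then obtain e where e: "p * b + c = Suc (s + e)" by blast
    then have y': "y = x @ stake e (sdrop s (cycle v0)) @ [cycle v0 !! (s + e)]"
      using y by (simp add: stake_Suc sdrop_snth del: stake.simps)
    then have "last y = letter v0 (p * b + c)" by (simp add: e letter_Suc)
    with that(3) y' show False using letter_period by simp
  qed
  have pm: "p * a + m = p * b + m'"
    using ne[OF vm(2) vm'(2,3,4) _ eq] ne[OF vm'(2) vm(2,3,4) _ eq[symmetric]] by (meson linorder_neqE_nat)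
  then have "a = (p * b + m') div p" "m = (p * b + m') mod p" using vm(4) by (metis div_mult_self4 div_less add_0_right length_0_conv v0_Nil, metis mod_mult_self4 mod_less)
  then have "a = b" "m = m'" using vm'(4) by simp_all
  moreover from this eq have "v = v'" using elt_inj[OF vm(2) vm'(2)] by simp
  ultimately show ?thesis using vm(1) vm'(1) ab by simp
qed

end

section \<open>Matrices of the projections onto reducing subspaces\<close>

lemma proj_ket_hermitian:
  assumes H: "closed_subspace (ell2 X) H" and "u \<in> X" "v \<in> X"
  shows "proj (ell2 X) H (ket v) u = cnj (proj (ell2 X) H (ket u) v)"
  using proj_selfadjoint[OF H ket_ell2[OF assms(3)] ket_ell2[OF assms(2)]] by simp

text \<open>The projection is multiplication by \<open>c\<close>, and idempotence leaves
  \<open>c = 0\<close> or \<open>c = 1\<close>, unless the whole space is zero.\<close>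

lemma scalar_proj_trivial:
  assumes H: "closed_subspace (ell2 X) H"
    and P: "\<And>u v. u \<in> X \<Longrightarrow> v \<in> X \<Longrightarrow> proj (ell2 X) H (ket v) u = (if u = v then c else 0)"
  shows "\<not> nontrivial (ell2 X) H"
proof -
  let ?P = "proj (ell2 X) H"
  note bop = proj_bop[OF H]
  have ket: "?P (ket v) = (\<lambda>x. c * ket v x)" if v: "v \<in> X" for v
  proof
    fix x
    show "?P (ket v) x = c * ket v x"
    proof (cases "x \<in> X")
      case False
      then show ?thesis using ell2_outside[OF bop_maps[OF bop ket_ell2[OF v]]] v by (auto simp: ket_def)
    qed (use P v in \<open>simp add: ket_def\<close>)
  qed
  have Pf: "?P f = (\<lambda>x. c * f x)" if f: "f \<in> ell2 X" for f
  proof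
    fix x
    have "((\<lambda>u. f u * ?P (ket u) x) has_sum ?P f x) X" by (rule bop_has_sum[OF bop f])
    also have "?this \<longleftrightarrow> ((\<lambda>u. c * (f u * ket u x)) has_sum ?P f x) X"
      by (rule has_sum_cong) (simp add: ket)
    finally have 1: "((\<lambda>u. c * (f u * ket u x)) has_sum ?P f x) X" .
    have "((\<lambda>u. f u * (\<lambda>f\<in>ell2 X. f) (ket u) x) has_sum (\<lambda>f\<in>ell2 X. f) f x) X"
      by (rule bop_has_sum[OF bop_id f])
    also have "?this \<longleftrightarrow> ((\<lambda>u. f u * ket u x) has_sum (\<lambda>f\<in>ell2 X. f) f x) X"
      by (rule has_sum_cong) (simp add: ket_ell2)
    finally have "((\<lambda>u. c * (f u * ket u x)) has_sum c * f x) X"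
      using f by (intro has_sum_cmult_right) simp
    then show "?P f x = c * f x" by (rule has_sum_unique[OF 1])
  qed
  have "c = 0 \<or> c = 1" if "f \<in> ell2 X" "f \<noteq> (\<lambda>x. 0)" for f
  proof -
    have "?P (?P f) = ?P f" by (rule proj_fixed[OF H proj_in[OF H that(1)]])
    then have "(\<lambda>x. c * (c * f x)) = (\<lambda>x. c * f x)" using Pf that(1) ell2_scale by metis
    moreover have "\<exists>x. f x \<noteq> 0" using that(2) by auto
    then obtain x where x: "f x \<noteq> 0" by blast
    ultimately have "(c * c) * f x = c * f x" by (metis mult.assoc)
    then have "c * c = c" using x by simp
    then show ?thesis by simp
  qed
  moreover have "H = {\<lambda>x. 0}" if "c = 0"
  proof -
    have "f = (\<lambda>x. 0)" if "f \<in> H" for f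
      using proj_fixed[OF H that] Pf[OF closed_subspace_ell2[OF H that]] \<open>c = 0\<close> by simp
    then show ?thesis using closed_subspace_zero[OF H] by blast
  qed
  moreover have "H = ell2 X" if "c = 1"
    using Pf proj_in[OF H] closed_subspace_subset[OF H] \<open>c = 1\<close> by force
  moreover have "H = {\<lambda>x. 0}" if "\<And>f. f \<in> ell2 X \<Longrightarrow> f = (\<lambda>x. 0)"
    using that closed_subspace_zero[OF H] closed_subspace_subset[OF H] by blast
  ultimately show ?thesis unfolding nontrivial_def by blast
qed

section \<open>Commutation with the shifts in matrix form\<close>

context word_translates
begin

abbreviation X :: "fgword set" where "X \<equiv> F_omega n \<omega>"

lemma X_nonempty: "elt [] 0 \<in> X"
  by (simp add: elt_in_F_omega)

lemma weighted_shift_bop: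
  "weighted_shift n \<omega> \<Lambda> T \<Longrightarrow> i \<in> letters n \<Longrightarrow> T i \<in> bop (ell2 X) (ell2 X)"
  by (simp add: weighted_shift_def K_omega_def)

lemma weighted_shift_ket:
  "weighted_shift n \<omega> \<Lambda> T \<Longrightarrow> i \<in> letters n \<Longrightarrow> u \<in> X \<Longrightarrow>
    T i (ket u) = (\<lambda>x. complex_of_real (\<Lambda> (\<mu> i u)) * ket (\<mu> i u) x)"
  by (simp add: weighted_shift_def Let_def)

lemma weighted_shift_apply:
  assumes T: "weighted_shift n \<omega> \<Lambda> T" and i: "i \<in> letters n" and j: "j \<in> letters n"
    and u: "u \<in> X" and f: "f \<in> ell2 X"
  shows "T j f (\<mu> i u) = (if i = j then complex_of_real (\<Lambda> (\<mu> i u)) * f u else 0)"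
proof -
  have "((\<lambda>w. f w * T j (ket w) (\<mu> i u)) has_sum T j f (\<mu> i u)) X"
    by (rule bop_has_sum[OF weighted_shift_bop[OF T j] f])
  also have "?this \<longleftrightarrow>
      ((\<lambda>w. if i = j then complex_of_real (\<Lambda> (\<mu> i u)) * f u else 0) has_sum T j f (\<mu> i u)) {u}"
  proof (rule has_sum_cong_neutral)
    fix w assume "w \<in> X - {u}"
    then show "f w * T j (ket w) (\<mu> i u) = 0"
      using mu_inj[OF i j u, of w] by (auto simp: weighted_shift_ket[OF T j]) (auto simp: ket_def split: if_splits)
  next
    fix w assume "w \<in> X \<inter> {u}"
    then show "f w * T j (ket w) (\<mu> i u) = (if i = j then complex_of_real (\<Lambda> (\<mu> i u)) * f u else 0)"
      using mu_inj[OF i j u, of w] by (auto simp: weighted_shift_ket[OF T j]) (auto simp: ket_def split: if_splits)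
  qed (use u in auto)
  finally show ?thesis using has_sum_unique[OF _ has_sum_finite[of "{u}"]] by fastforce
qed

definition shift_kernel :: "(fgword \<Rightarrow> real) \<Rightarrow> fgword oper \<Rightarrow> bool" where
  "shift_kernel \<Lambda> P \<longleftrightarrow> (\<forall>u\<in>X. \<forall>v\<in>X. \<forall>i\<in>letters n. \<forall>j\<in>letters n.
    P (ket (\<mu> j v)) (\<mu> i u) = (if i = j then P (ket v) u else 0) \<and>
    (P (ket v) u \<noteq> 0 \<longrightarrow> \<Lambda> (\<mu> i u) = \<Lambda> (\<mu> i v)))"

text \<open>By \<open>mu_cover\<close> every coordinate in \<open>X\<close> has the form
  \<open>\<mu> i u\<close>, so commutation with the shifts can be read entry by entry.\<close>

lemma reduces_iff_shift_kernel:
  assumes T: "weighted_shift n \<omega> \<Lambda> T" and pos: "\<And>u. u \<in> X \<Longrightarrow> \<Lambda> u > 0"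
  shows "reduces (ell2 X) H (T ` letters n) \<longleftrightarrow>
    closed_subspace (ell2 X) H \<and> shift_kernel \<Lambda> (proj (ell2 X) H)"
proof (cases "closed_subspace (ell2 X) H")
  case H: True
  let ?P = "proj (ell2 X) H"
  have PT: "?P (T j (ket v)) (\<mu> i u) = complex_of_real (\<Lambda> (\<mu> j v)) * ?P (ket (\<mu> j v)) (\<mu> i u)"
    if "j \<in> letters n" "v \<in> X" for i j u v
    using bop_scale[OF proj_bop[OF H] ket_ell2[OF mu_closed[OF that]]]
    by (simp add: weighted_shift_ket[OF T that])
  have TP: "T j (?P (ket v)) (\<mu> i u) = (if i = j then complex_of_real (\<Lambda> (\<mu> i u)) * ?P (ket v) u else 0)"
    if "i \<in> letters n" "j \<in> letters n" "u \<in> X" "v \<in> X" for i j u v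
    by (rule weighted_shift_apply[OF T that(1-3) proj_ell2[OF H ket_ell2[OF that(4)]]])
  have "(\<forall>i\<in>letters n. commute (ell2 X) ?P (T i)) \<longleftrightarrow>
      (\<forall>j\<in>letters n. \<forall>v\<in>X. ?P (T j (ket v)) = T j (?P (ket v)))"
    using commute_proj_ket_iff[OF H weighted_shift_bop[OF T]] by simp
  also have "\<dots> \<longleftrightarrow> (\<forall>j\<in>letters n. \<forall>v\<in>X. \<forall>i\<in>letters n. \<forall>u\<in>X.
      ?P (T j (ket v)) (\<mu> i u) = T j (?P (ket v)) (\<mu> i u))" (is "?L = ?R")
  proof
    assume R: ?R
    show ?L
    proof (intro ballI ext)
      fix j v x assume jv: "j \<in> letters n" "v \<in> X"
      note k = ket_ell2[OF jv(2)]
      show "?P (T j (ket v)) x = T j (?P (ket v)) x"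
      proof (cases "x \<in> X")
        case True
        then obtain i u where "i \<in> letters n" "u \<in> X" "x = \<mu> i u" using mu_cover by blast
        then show ?thesis using R jv by simp
      next
        case False
        then show ?thesis
          using ell2_outside[OF bop_maps[OF proj_bop[OF H] bop_maps[OF weighted_shift_bop[OF T jv(1)] k]]]
            ell2_outside[OF bop_maps[OF weighted_shift_bop[OF T jv(1)] bop_maps[OF proj_bop[OF H] k]]]
          by simp
      qed
    qed
  qed auto
  also have "\<dots> \<longleftrightarrow> shift_kernel \<Lambda> ?P"
  proof
    assume ?R
    then have *: "complex_of_real (\<Lambda> (\<mu> j v)) * ?P (ket (\<mu> j v)) (\<mu> i u) =
        (if i = j then complex_of_real (\<Lambda> (\<mu> i u)) * ?P (ket v) u else 0)"
      if "i \<in> letters n" "j \<in> letters n" "u \<in> X" "v \<in> X" for i j u v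
      using that PT TP by simp
    show "shift_kernel \<Lambda> ?P"
      unfolding shift_kernel_def
    proof (intro ballI conjI)
      fix u v i j assume uv: "u \<in> X" "v \<in> X" and ij: "i \<in> letters n" "j \<in> letters n"
      let ?a = "complex_of_real (\<Lambda> (\<mu> i u))" and ?b = "complex_of_real (\<Lambda> (\<mu> i v))"
      let ?q = "?P (ket (\<mu> i v)) (\<mu> i u)" and ?p = "?P (ket v) u"
      have pa: "\<Lambda> (\<mu> i u) > 0" and pb: "\<Lambda> (\<mu> i v) > 0" using pos mu_closed[OF ij(1)] uv by blast+
      have 1: "?b * ?q = ?a * ?p" using *[OF ij(1) ij(1) uv] by simp
      \<comment> \<open>The same relation with \<open>u\<close> and \<open>v\<close> exchanged.
        Since the matrix is hermitian, conjugation turns it into a second relation between the same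
        entries \<open>?p\<close> and \<open>?q\<close>; eliminating \<open>?q\<close> gives
        \<open>?a^2 * ?p = ?b^2 * ?p\<close>, and positivity of the weights finishes.\<close>
      have "?a * ?P (ket (\<mu> i u)) (\<mu> i v) = ?b * ?P (ket u) v"
        using *[OF ij(1) ij(1) uv(2,1)] by simp
      then have "cnj (?a * ?P (ket (\<mu> i u)) (\<mu> i v)) = cnj (?b * ?P (ket u) v)" by (rule arg_cong)
      then have 2: "?a * ?q = ?b * ?p"
        using proj_ket_hermitian[OF H uv]
          proj_ket_hermitian[OF H mu_closed[OF ij(1) uv(1)] mu_closed[OF ij(1) uv(2)]] by simp
      have "?a * (?a * ?p) = ?a * (?b * ?q)" by (simp only: 1)
      also have "\<dots> = ?b * (?a * ?q)" by (rule mult.left_commute)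
      also have "\<dots> = ?b * (?b * ?p)" by (simp only: 2)
      finally have "?a * (?a * ?p) = ?b * (?b * ?p)" .
      then have sq: "?a\<^sup>2 * ?p = ?b\<^sup>2 * ?p" by (simp only: power2_eq_square mult.assoc)
      have 3: "?p \<noteq> 0 \<longrightarrow> \<Lambda> (\<mu> i u) = \<Lambda> (\<mu> i v)"
      proof
        assume "?p \<noteq> 0"
        then have "?a\<^sup>2 = ?b\<^sup>2" using sq by (rule mult_right_cancel[THEN iffD1])
        then have "(\<Lambda> (\<mu> i u))\<^sup>2 = (\<Lambda> (\<mu> i v))\<^sup>2"
          unfolding of_real_power[symmetric] of_real_eq_iff .
        then show "\<Lambda> (\<mu> i u) = \<Lambda> (\<mu> i v)"
          by (rule power2_eq_imp_eq) (use pa pb in simp_all)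
      qed
      then show "?p \<noteq> 0 \<longrightarrow> \<Lambda> (\<mu> i u) = \<Lambda> (\<mu> i v)" .
      have "?q = ?p"
      proof (cases "?p = 0")
        case True
        then show ?thesis using 1 pb by simp
      next
        case False
        then have "?a = ?b" using 3 by simp
        then show ?thesis using 1 pb by simp
      qed
      moreover have "?P (ket (\<mu> j v)) (\<mu> i u) = 0" if "i \<noteq> j"
        using *[OF ij uv] that pos[OF mu_closed[OF ij(2) uv(2)]] by simp
      ultimately show "?P (ket (\<mu> j v)) (\<mu> i u) = (if i = j then ?p else 0)"
        by (cases "i = j") auto
    qed
  next
    assume k: "shift_kernel \<Lambda> ?P"
    show ?R
    proof (intro ballI)
      fix j v i u assume *: "j \<in> letters n" "v \<in> X" "i \<in> letters n" "u \<in> X"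
      then show "?P (T j (ket v)) (\<mu> i u) = T j (?P (ket v)) (\<mu> i u)"
        using k[unfolded shift_kernel_def, rule_format, OF *(4,2,3,1)]
        by (cases "?P (ket v) u = 0"; cases "i = j") (auto simp: PT TP)
    qed
  qed
  finally show ?thesis using H by (auto simp: reduces_def)
qed (simp add: reduces_def)

text \<open>This reduces the location of the nonzero entries to a question about words.\<close>

lemma shift_kernel_back_closed:
  assumes "shift_kernel \<Lambda> P"
  shows "back_closed (\<lambda>u v. u \<in> X \<and> v \<in> X \<and> P (ket v) u \<noteq> 0)"
  unfolding back_closed_def
proof (intro allI impI)
  fix u v assume uv: "u \<in> X \<and> v \<in> X \<and> P (ket v) u \<noteq> 0"
  obtain i u' where i: "i \<in> letters n" "u' \<in> X" "u = \<mu> i u'" using mu_cover uv by blast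
  obtain j v' where j: "j \<in> letters n" "v' \<in> X" "v = \<mu> j v'" using mu_cover uv by blast
  have "P (ket (\<mu> j v')) (\<mu> i u') = (if i = j then P (ket v') u' else 0)"
    using assms i j unfolding shift_kernel_def by blast
  then have "i = j" "P (ket v') u' \<noteq> 0" using uv i(3) j(3) by (auto split: if_splits)
  then show "\<exists>i\<in>letters n. \<exists>u'\<in>X. \<exists>w'\<in>X. u = \<mu> i u' \<and> v = \<mu> i w' \<and>
      (u' \<in> X \<and> w' \<in> X \<and> P (ket w') u' \<noteq> 0)"
    using i j by blast
qed

lemma aperiodic_irreducible:
  assumes aper: "\<not> eventually_periodic \<omega>" and k: "shift_kernel \<Lambda> (proj (ell2 X) H)"
    and H: "closed_subspace (ell2 X) H"
  shows "\<not> nontrivial (ell2 X) H"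
proof (rule scalar_proj_trivial[OF H])
  fix u v assume uv: "u \<in> X" "v \<in> X"
  let ?P = "proj (ell2 X) H"
  have "?P (ket u) u = ?P (ket (elt [] 0)) (elt [] 0)"
  proof -
    have "?P (ket (\<mu> i w)) (\<mu> i w) = ?P (ket w) w" if "i \<in> letters n" "w \<in> X" for i w
      using k that unfolding shift_kernel_def by simp
    then show ?thesis
      using F_omega_connected[of "\<lambda>w. ?P (ket w) w = ?P (ket (elt [] 0)) (elt [] 0)", OF _ uv(1) X_nonempty]
      by simp
  qed
  moreover have "u = v" if "?P (ket v) u \<noteq> 0"
    using aperiodic_back_closed[OF aper shift_kernel_back_closed[OF k]] uv that by blast
  ultimately show "?P (ket v) u = (if u = v then ?P (ket (elt [] 0)) (elt [] 0) else 0)" by auto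
qed

end

section \<open>Projections as convolutions along the orbits of the translation\<close>

context periodic_translates
begin

definition period :: "(fgword \<Rightarrow> real) \<Rightarrow> int \<Rightarrow> bool" where
  "period \<Lambda> j \<longleftrightarrow> (\<forall>x\<in>X. \<Lambda> (act x j) = \<Lambda> x)"

lemma period_0: "period \<Lambda> 0"
  by (simp add: period_def act_0)

lemma period_add: "period \<Lambda> a \<Longrightarrow> period \<Lambda> b \<Longrightarrow> period \<Lambda> (a + b)"
  unfolding period_def using act_act act_closed by metis

lemma period_minus: "period \<Lambda> a \<Longrightarrow> period \<Lambda> (- a)"
  unfolding period_def
proof
  fix x assume "\<forall>x\<in>X. \<Lambda> (act x a) = \<Lambda> x" and x: "x \<in> X"
  then have "\<Lambda> (act (act x (- a)) a) = \<Lambda> (act x (- a))" using act_closed by blast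
  then show "\<Lambda> (act x (- a)) = \<Lambda> x" using act_act[OF x, of "- a" a] act_0[OF x] by simp
qed

lemma period_mult: "period \<Lambda> a \<Longrightarrow> period \<Lambda> (a * l)"
proof (induction l rule: int_induct[where k = 0])
  case (step1 i)
  then show ?case using period_add[of \<Lambda> "a * i" a] by (simp add: distrib_left)
next
  case (step2 i)
  then show ?case using period_add[of \<Lambda> "a * i" "- a"] period_minus by (simp add: right_diff_distrib)
qed (simp add: period_0)

lemma act_inj:
  assumes "u \<in> X"
  shows "act u a = act u b \<longleftrightarrow> a = b"
proof -
  obtain g l where g: "g \<in> block n v0 0" "u = act g l" using block_cover[OF assms] by blast
  then have "g \<in> X" using block_sub by blast
  then show ?thesis using g block_unique[OF g(1) g(1), of "l + a" "l + b"] act_act by auto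
qed

lemma mu_orbit_iff:
  assumes "i \<in> letters n" "j \<in> letters n" "u \<in> X" "v \<in> X"
  shows "\<mu> j v = act (\<mu> i u) a \<longleftrightarrow> i = j \<and> v = act u a"
  using mu_inj[of j i v "act u a"] mu_act[OF assms(1,3), of a] act_closed[OF assms(3), of a] assms by auto

text \<open>Different orbits are not coupled, and along each orbit the entry in row
  \<open>act u a\<close> and column \<open>act u b\<close> is \<open>c (b - a)\<close>, with the
  same \<open>c\<close> for all orbits.\<close>

definition conv_kernel :: "fgword oper \<Rightarrow> (int \<Rightarrow> complex) \<Rightarrow> bool" where
  "conv_kernel P c \<longleftrightarrow> (\<forall>u\<in>X. \<forall>j. P (ket (act u j)) u = c j) \<and>
    (\<forall>u\<in>X. \<forall>v\<in>X. P (ket v) u \<noteq> 0 \<longrightarrow> (\<exists>j. v = act u j))"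

text \<open>Translation commutes with \<open>\<mu> i\<close>, so the entry in row \<open>u\<close>
  and column \<open>act u j\<close> is unchanged when \<open>u\<close> is replaced by
  \<open>\<mu> i u\<close>; by \<open>F_omega_connected\<close> it depends on \<open>j\<close>
  alone. The condition on the weights becomes a condition on those \<open>j\<close> with nonzero
  coefficient.\<close>

lemma shift_kernel_iff_conv_kernel:
  "shift_kernel \<Lambda> P \<longleftrightarrow> (\<exists>c. conv_kernel P c \<and> (\<forall>j. c j \<noteq> 0 \<longrightarrow> period \<Lambda> j))"
proof
  assume k: "shift_kernel \<Lambda> P"
  define c where "c j = P (ket (act (elt [] 0) j)) (elt [] 0)" for j
  have eq: "P (ket (act u j)) u = c j" if u: "u \<in> X" for u j
  proof -
    have "P (ket (act (\<mu> i w) j)) (\<mu> i w) = P (ket (act w j)) w" if "i \<in> letters n" "w \<in> X" for i w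
    proof -
      have "P (ket (\<mu> i (act w j))) (\<mu> i w) = P (ket (act w j)) w"
        using k that act_closed[OF that(2), of j] unfolding shift_kernel_def by simp
      then show ?thesis using mu_act[OF that] by simp
    qed
    then show ?thesis
      using F_omega_connected[of "\<lambda>w. P (ket (act w j)) w = c j", OF _ u X_nonempty]
      by (simp add: c_def)
  qed
  have "\<exists>j. v = act u j" if "u \<in> X" "v \<in> X" "P (ket v) u \<noteq> 0" for u v
    by (rule periodic_back_closed[OF shift_kernel_back_closed[OF k]]) (use that in simp)
  with eq have "conv_kernel P c" by (simp add: conv_kernel_def)
  moreover have "period \<Lambda> j" if c: "c j \<noteq> 0" for j
    unfolding period_def
  proof
    fix x assume "x \<in> X"
    then obtain i u where iu: "i \<in> letters n" "u \<in> X" "x = \<mu> i u" using mu_cover by blast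
    have "P (ket (act u j)) u \<noteq> 0" using eq[OF iu(2)] c by simp
    then have "\<Lambda> (\<mu> i u) = \<Lambda> (\<mu> i (act u j))"
      using k iu act_closed[OF iu(2), of j] unfolding shift_kernel_def by blast
    then show "\<Lambda> (act x j) = \<Lambda> x" using iu mu_act by simp
  qed
  ultimately show "\<exists>c. conv_kernel P c \<and> (\<forall>j. c j \<noteq> 0 \<longrightarrow> period \<Lambda> j)" by blast
next
  assume "\<exists>c. conv_kernel P c \<and> (\<forall>j. c j \<noteq> 0 \<longrightarrow> period \<Lambda> j)"
  then obtain c where eq: "\<And>u j. u \<in> X \<Longrightarrow> P (ket (act u j)) u = c j"
    and off: "\<And>u v. u \<in> X \<Longrightarrow> v \<in> X \<Longrightarrow> P (ket v) u \<noteq> 0 \<Longrightarrow> \<exists>j. v = act u j"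
    and per: "\<And>j. c j \<noteq> 0 \<Longrightarrow> period \<Lambda> j"
    unfolding conv_kernel_def by blast
  show "shift_kernel \<Lambda> P"
    unfolding shift_kernel_def
  proof (intro ballI conjI impI)
    fix u v i j assume *: "u \<in> X" "v \<in> X" "i \<in> letters n" "j \<in> letters n"
    show "P (ket (\<mu> j v)) (\<mu> i u) = (if i = j then P (ket v) u else 0)"
    proof (cases "\<exists>a. \<mu> j v = act (\<mu> i u) a")
      case True
      then obtain a where a: "\<mu> j v = act (\<mu> i u) a" by blast
      have "P (ket (\<mu> j v)) (\<mu> i u) = c a" unfolding a by (rule eq[OF mu_closed[OF *(3,1)]])
      moreover have "i = j" "v = act u a" using mu_orbit_iff[OF *(3,4,1,2)] a by blast+
      ultimately show ?thesis using eq[OF *(1), of a] by simp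
    next
      case False
      then have "P (ket (\<mu> j v)) (\<mu> i u) = 0"
        using off[OF mu_closed[OF *(3,1)] mu_closed[OF *(4,2)]] by blast
      moreover have "i = j \<Longrightarrow> P (ket v) u = 0"
        using off[OF *(1,2)] False mu_orbit_iff[OF *(3,4,1,2)] by blast
      ultimately show ?thesis by simp
    qed
    assume "P (ket v) u \<noteq> 0"
    moreover from this obtain a where "v = act u a" using off *(1,2) by blast
    ultimately show "\<Lambda> (\<mu> i u) = \<Lambda> (\<mu> i v)"
      using eq[OF *(1)] per[of a] mu_closed[OF *(3,1)] mu_act[OF *(3,1)] by (simp add: period_def)
  qed
qed

lemma reduces_iff_conv_kernel:
  assumes "weighted_shift n (cycle v0) \<Lambda> T" "\<And>u. u \<in> X \<Longrightarrow> \<Lambda> u > 0"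
  shows "reduces (ell2 X) H (T ` letters n) \<longleftrightarrow> closed_subspace (ell2 X) H \<and>
    (\<exists>c. conv_kernel (proj (ell2 X) H) c \<and> (\<forall>j. c j \<noteq> 0 \<longrightarrow> period \<Lambda> j))"
  using reduces_iff_shift_kernel[OF assms] shift_kernel_iff_conv_kernel by simp

lemma orbit_has_sum:
  assumes u: "u \<in> X" and "A \<subseteq> X \<or> A = UNIV" "\<And>j. act u j \<in> A" "\<And>x. x \<in> A \<Longrightarrow> \<phi> x \<noteq> 0 \<Longrightarrow> \<exists>j. x = act u j"
  shows "(\<phi> has_sum s) A \<longleftrightarrow> ((\<lambda>j. \<phi> (act u j)) has_sum s) UNIV"
proof -
  have "(\<phi> has_sum s) A \<longleftrightarrow> (\<phi> has_sum s) (range (act u))"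
    by (rule has_sum_cong_neutral) (use assms in auto)
  also have "\<dots> \<longleftrightarrow> ((\<phi> \<circ> act u) has_sum s) UNIV"
    by (rule has_sum_reindex) (use act_inj[OF u] in \<open>simp add: inj_def\<close>)
  finally show ?thesis by (simp add: comp_def)
qed

lemma conv_kernel_compose_has_sum:
  assumes A: "A \<in> bop (ell2 X) (ell2 X)" "conv_kernel A a" and B: "B \<in> bop (ell2 X) (ell2 X)" "conv_kernel B b"
    and u: "u \<in> X"
  shows "((\<lambda>i. b (j - i) * a i) has_sum A (B (ket (act u j))) u) UNIV"
proof -
  let ?v = "act u j"
  have v: "?v \<in> X" by (rule act_closed[OF u])
  have "((\<lambda>w. B (ket ?v) w * A (ket w) u) has_sum A (B (ket ?v)) u) X"
    by (rule bop_has_sum[OF A(1) bop_maps[OF B(1) ket_ell2[OF v]]])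
  also have "?this \<longleftrightarrow> ((\<lambda>i. B (ket ?v) (act u i) * A (ket (act u i)) u) has_sum A (B (ket ?v)) u) UNIV"
    by (rule orbit_has_sum[OF u]) (use A(2) u act_closed in \<open>auto simp: conv_kernel_def\<close>)
  also have "\<dots> \<longleftrightarrow> ((\<lambda>i. b (j - i) * a i) has_sum A (B (ket ?v)) u) UNIV"
  proof (rule has_sum_cong)
    fix i
    have "?v = act (act u i) (j - i)" using act_act[OF u] by simp
    then have "B (ket ?v) (act u i) = b (j - i)"
      using B(2) act_closed[OF u, of i] unfolding conv_kernel_def by metis
    then show "B (ket ?v) (act u i) * A (ket (act u i)) u = b (j - i) * a i"
      using A(2) u by (simp add: conv_kernel_def)
  qed
  finally show ?thesis .
qed

text \<open>Convolution on the integers is commutative: substitute \<open>j - i\<close> for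
  \<open>i\<close> in the sum. Entries between different orbits vanish for both products.\<close>

lemma conv_kernel_commute:
  assumes A: "A \<in> bop (ell2 X) (ell2 X)" "conv_kernel A a" and B: "B \<in> bop (ell2 X) (ell2 X)" "conv_kernel B b"
  shows "commute (ell2 X) A B"
  unfolding commute_def
proof (rule bop_eqI_ket[OF bop_compose[OF A(1) B(1)] bop_compose[OF B(1) A(1)]])
  fix v assume v: "v \<in> X"
  note k = ket_ell2[OF v]
  have off: "A (B (ket v)) u = 0"
    if AB: "A \<in> bop (ell2 X) (ell2 X)" "conv_kernel A a" "B \<in> bop (ell2 X) (ell2 X)" "conv_kernel B b"
      and u: "u \<in> X" and orb: "\<nexists>j. v = act u j" for A B a b u
  proof -
    have z: "B (ket v) w * A (ket w) u = 0" if w: "w \<in> X" for w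
    proof (rule ccontr)
      assume "\<not> ?thesis"
      then obtain i j where "w = act u i" "v = act w j"
        using AB(2,4) u v w unfolding conv_kernel_def by (metis mult_eq_0_iff)
      then show False using orb act_act[OF u] by blast
    qed
    have "((\<lambda>w. B (ket v) w * A (ket w) u) has_sum A (B (ket v)) u) X"
      by (rule bop_has_sum[OF AB(1) bop_maps[OF AB(3) k]])
    moreover have "((\<lambda>w. B (ket v) w * A (ket w) u) has_sum 0) X" by (rule has_sum_0) (rule z)
    ultimately show ?thesis by (rule has_sum_unique)
  qed
  have "A (B (ket v)) u = B (A (ket v)) u" for u
  proof (cases "u \<in> X")
    case u: True
    show ?thesis
    proof (cases "\<exists>j. v = act u j")
      case True
      then obtain j where j: "v = act u j" by blast
      have 1: "((\<lambda>i. b (j - i) * a i) has_sum A (B (ket v)) u) UNIV"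
        unfolding j by (rule conv_kernel_compose_has_sum[OF A B u])
      have "((\<lambda>i. a (j - i) * b i) has_sum B (A (ket v)) u) UNIV"
        unfolding j by (rule conv_kernel_compose_has_sum[OF B A u])
      also have "?this \<longleftrightarrow> ((\<lambda>i. a (j - (j - i)) * b (j - i)) has_sum B (A (ket v)) u) UNIV"
        by (rule has_sum_reindex_bij_betw[symmetric])
          (rule bij_betw_byWitness[where f' = "\<lambda>i. j - i"], auto)
      finally show ?thesis using has_sum_unique[OF 1] by (simp add: mult.commute)
    next
      case False
      then show ?thesis using off[OF A B u] off[OF B A u] by simp
    qed
  next
    case False
    then show ?thesis
      using ell2_outside[OF bop_maps[OF A(1) bop_maps[OF B(1) k]]]
        ell2_outside[OF bop_maps[OF B(1) bop_maps[OF A(1) k]]] by simp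
  qed
  then show "compose (ell2 X) A B (ket v) = compose (ell2 X) B A (ket v)"
    using k by (auto simp: compose_eq)
qed

text \<open>If only \<open>c 0\<close> were nonzero, the projection would be scalar. Any other
  nonzero coefficient supplies a period, whose absolute value is taken.\<close>

lemma nontrivial_reducing_period:
  assumes "weighted_shift n (cycle v0) \<Lambda> T" "\<And>u. u \<in> X \<Longrightarrow> \<Lambda> u > 0"
    and "reduces (ell2 X) H (T ` letters n)" "nontrivial (ell2 X) H"
  shows "\<exists>k\<ge>1. period \<Lambda> (int k)"
proof -
  obtain c where H: "closed_subspace (ell2 X) H" and c: "conv_kernel (proj (ell2 X) H) c"
    and per: "\<And>j. c j \<noteq> 0 \<Longrightarrow> period \<Lambda> j"
    using assms reduces_iff_conv_kernel by blast
  have "\<exists>j. j \<noteq> 0 \<and> c j \<noteq> 0"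
  proof (rule ccontr)
    assume no: "\<not> ?thesis"
    have "\<not> nontrivial (ell2 X) H"
    proof (rule scalar_proj_trivial[OF H])
      fix u v assume uv: "u \<in> X" "v \<in> X"
      show "proj (ell2 X) H (ket v) u = (if u = v then c 0 else 0)"
      proof (cases "\<exists>j. v = act u j")
        case True
        then obtain j where j: "v = act u j" by blast
        then have "u = v \<longleftrightarrow> j = 0" using act_inj[OF uv(1), of j 0] act_0[OF uv(1)] by auto
        moreover have "proj (ell2 X) H (ket v) u = c j" using c uv(1) j by (simp add: conv_kernel_def)
        ultimately show ?thesis using no by auto
      next
        case False
        then have "u \<noteq> v" using act_0[OF uv(1)] by metis
        moreover have "proj (ell2 X) H (ket v) u = 0"
          using False c uv unfolding conv_kernel_def by blast
        ultimately show ?thesis by simp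
      qed
    qed
    with assms(4) show False by simp
  qed
  then obtain j where "j \<noteq> 0" "period \<Lambda> j" using per by blast
  then have "period \<Lambda> \<bar>j\<bar>" using period_minus[of \<Lambda> j] by (simp add: abs_if)
  then show ?thesis using \<open>j \<noteq> 0\<close> by (intro exI[of _ "nat \<bar>j\<bar>"]) auto
qed

end

section \<open>Reducing subspaces of the unweighted shift\<close>

text \<open>The discrete Hilbert transform: with \<open>\<beta> i = 1 / (2 i + 1)\<close>, distinct integer translates of
  \<open>\<beta>\<close> are orthogonal, since \<open>2 q \<cdot> \<beta> i \<cdot> \<beta> (i - q) = \<beta> (i - q) - \<beta> i\<close> telescopes to 0.\<close>

definition hilbert :: "int \<Rightarrow> real" where
  "hilbert i = 1 / (2 * real_of_int i + 1)"

lemma odd_nonzero: "2 * real_of_int i + 1 \<noteq> 0"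
proof -
  have "2 * i + 1 \<noteq> 0" by presburger
  then have "real_of_int (2 * i + 1) \<noteq> 0" by (simp only: of_int_eq_0_iff not_False_eq_True)
  then show ?thesis by simp
qed

lemma hilbert_mult: "2 * real_of_int q * (hilbert i * hilbert (i - q)) = hilbert (i - q) - hilbert i"
  using odd_nonzero[of i] odd_nonzero[of "i - q"]
  by (simp add: hilbert_def divide_simps)

text \<open>The terms with \<open>i \<ge> 1\<close> telescope to 1, those with
  \<open>i \<le> -1\<close> equal them by the symmetry under negation, and the term at 0 is
  \<open>-2\<close>. The terms off 0 are nonnegative, which upgrades the series to an unconditional
  sum.\<close>

lemma has_sum_hilbert_1: "((\<lambda>i. hilbert (i - 1) - hilbert i) has_sum 0) UNIV"
proof -
  let ?t = "\<lambda>i. hilbert (i - 1) - hilbert i"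
  have lim: "(\<lambda>k. hilbert (int k)) \<longlonglongrightarrow> 0"
    unfolding hilbert_def of_int_of_nat_eq by real_asymp
  have "(\<lambda>k. hilbert (int k) - hilbert (int (Suc k))) sums (hilbert (int 0) - 0)"
    by (rule telescope_sums'[OF lim])
  then have "(\<lambda>k. ?t (int (Suc k))) sums 1"
    by (simp add: hilbert_def)
  moreover have "0 \<le> ?t (int (Suc k))" for k
    by (simp add: hilbert_def frac_le)
  ultimately have nat: "((\<lambda>k. ?t (int (Suc k))) has_sum 1) UNIV"
    by (rule sums_nonneg_imp_has_sum)
  have pos: "(?t has_sum 1) {1..}"
  proof -
    have "bij_betw (\<lambda>k. int (Suc k)) UNIV {1..}"
      by (rule bij_betw_byWitness[where f' = "\<lambda>i. nat (i - 1)"]) auto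
    from has_sum_reindex_bij_betw[OF this, of ?t] nat show ?thesis by simp
  qed
  have "?t (- i) = ?t i" for i
    using odd_nonzero[of i] odd_nonzero[of "- i"] odd_nonzero[of "i - 1"] odd_nonzero[of "- i - 1"]
    by (simp add: hilbert_def divide_simps) (simp add: algebra_simps)
  moreover have "bij_betw uminus {1..} {..-1 :: int}"
    by (rule bij_betw_byWitness[where f' = uminus]) auto
  ultimately have neg: "(?t has_sum 1) {..-1}"
    using has_sum_reindex_bij_betw[of uminus "{1..}" "{..-1 :: int}" ?t] pos by simp
  have "(?t has_sum -2) {0}"
    by (rule has_sum_finiteI) (simp_all add: hilbert_def)
  from has_sum_Un_disjoint[OF neg this] have "(?t has_sum -1) ({..-1} \<union> {0})" by simp
  from has_sum_Un_disjoint[OF this pos] have "(?t has_sum -1 + 1) ({..-1} \<union> {0} \<union> {1..})" by force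
  also have "{..-1} \<union> {0} \<union> {1..} = (UNIV :: int set)" by auto
  finally show ?thesis by simp
qed

lemma has_sum_translate:
  fixes f :: "int \<Rightarrow> 'a :: {comm_monoid_add, topological_space}"
  shows "((\<lambda>i. f (i + a)) has_sum s) UNIV \<longleftrightarrow> (f has_sum s) UNIV"
  by (rule has_sum_reindex_bij_betw) (rule bij_betw_byWitness[where f' = "\<lambda>i. i - a"], auto)

lemma has_sum_hilbert_diff: "((\<lambda>i. hilbert (i - q) - hilbert i) has_sum 0) UNIV"
proof -
  have nat: "((\<lambda>i. hilbert (i - int m) - hilbert i) has_sum 0) UNIV" for m
  proof (induction m)
    case (Suc m)
    have "((\<lambda>i. hilbert (i - int m - 1) - hilbert (i - int m)) has_sum 0) UNIV"
      using has_sum_translate[of "\<lambda>i. hilbert (i - 1) - hilbert i" "- int m" 0] has_sum_hilbert_1 by simp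
    from has_sum_add[OF this Suc] show ?case by (simp add: algebra_simps)
  qed simp
  show ?thesis
  proof (cases "q \<ge> 0")
    case True
    then show ?thesis using nat[of "nat q"] by simp
  next
    case False
    then have "((\<lambda>i. hilbert (i + q) - hilbert i) has_sum 0) UNIV" using nat[of "nat (- q)"] by simp
    then have "((\<lambda>i. hilbert i - hilbert (i - q)) has_sum 0) UNIV"
      using has_sum_translate[of "\<lambda>i. hilbert (i + q) - hilbert i" "- q" 0] by simp
    from has_sum_cmult_right[OF this, of "-1"] show ?thesis by simp
  qed
qed

lemma has_sum_hilbert_mult:
  assumes "q \<noteq> 0"
  shows "((\<lambda>i. hilbert i * hilbert (i - q)) has_sum 0) UNIV"
proof -
  have "((\<lambda>i. inverse (2 * real_of_int q) * (hilbert (i - q) - hilbert i)) has_sum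
      inverse (2 * real_of_int q) * 0) UNIV"
    by (rule has_sum_cmult_right[OF has_sum_hilbert_diff])
  moreover have "inverse (2 * real_of_int q) * (hilbert (i - q) - hilbert i) = hilbert i * hilbert (i - q)" for i
    using assms by (simp add: hilbert_mult[symmetric])
  ultimately show ?thesis by simp
qed

lemma summable_hilbert_square: "(\<lambda>i. hilbert i * hilbert i) summable_on UNIV"
proof (rule summable_on_comparison_test)
  have "(\<lambda>i. hilbert i * hilbert (i - 1)) summable_on UNIV"
    using has_sum_hilbert_mult[of 1] by (auto simp: summable_on_def)
  then have "(\<lambda>i. \<bar>hilbert i * hilbert (i - 1)\<bar>) summable_on UNIV"
    using summable_on_iff_abs_summable_on_real by fastforce
  then show "(\<lambda>i. 3 * \<bar>hilbert i * hilbert (i - 1)\<bar>) summable_on UNIV"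
    by (rule summable_on_cmult_right)
  fix i :: int
  \<comment> \<open>Comparison with the product of two neighbouring translates, already known to be
    summable. Equality at \<open>i = -1\<close> explains the constant 3.\<close>
  have "\<bar>2 * i - 1\<bar> \<le> 3 * \<bar>2 * i + 1\<bar>" by presburger
  then have "real_of_int \<bar>2 * i - 1\<bar> \<le> real_of_int (3 * \<bar>2 * i + 1\<bar>)" by (simp only: of_int_le_iff)
  then have le: "\<bar>2 * real_of_int i - 1\<bar> \<le> 3 * \<bar>2 * real_of_int i + 1\<bar>" by simp
  have "\<bar>hilbert i\<bar> \<le> 3 * \<bar>hilbert (i - 1)\<bar>"
    using le odd_nonzero[of i] odd_nonzero[of "i - 1"] by (simp add: hilbert_def divide_simps)
  then have "\<bar>hilbert i\<bar> * \<bar>hilbert i\<bar> \<le> \<bar>hilbert i\<bar> * (3 * \<bar>hilbert (i - 1)\<bar>)"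
    by (rule mult_left_mono) simp
  then show "hilbert i * hilbert i \<le> 3 * \<bar>hilbert i * hilbert (i - 1)\<bar>"
    by (simp add: abs_mult)
qed simp

text \<open>Up to a constant factor these are the Fourier coefficients of the square wave. They
  carry \<open>hilbert i\<close> at the position \<open>2 * i + 1\<close>.\<close>

definition odd_recip :: "int \<Rightarrow> real" where
  "odd_recip j = (if even j then 0 else 1 / real_of_int j)"

lemma odd_recip_minus: "odd_recip (- j) = - odd_recip j"
  by (simp add: odd_recip_def)

lemma has_sum_odd_recip:
  "((\<lambda>j. odd_recip j * odd_recip (j - 2 * q)) has_sum s) UNIV \<longleftrightarrow>
    ((\<lambda>i. hilbert i * hilbert (i - q)) has_sum s) UNIV"
proof -
  have "((\<lambda>j. odd_recip j * odd_recip (j - 2 * q)) has_sum s) UNIV \<longleftrightarrow>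
      ((\<lambda>j. odd_recip j * odd_recip (j - 2 * q)) has_sum s) (range (\<lambda>i. 2 * i + 1))"
    by (rule has_sum_cong_neutral) (auto simp: odd_recip_def elim!: oddE)
  also have "\<dots> \<longleftrightarrow> (((\<lambda>j. odd_recip j * odd_recip (j - 2 * q)) \<circ> (\<lambda>i. 2 * i + 1)) has_sum s) UNIV"
    by (rule has_sum_reindex) (simp add: inj_def)
  also have "(\<lambda>j. odd_recip j * odd_recip (j - 2 * q)) \<circ> (\<lambda>i. 2 * i + 1) = (\<lambda>i. hilbert i * hilbert (i - q))"
    by (auto simp: odd_recip_def hilbert_def)
  finally show ?thesis .
qed

text \<open>For even \<open>m\<close> this is the orthogonality of integer translates of
  \<open>hilbert\<close>; for odd \<open>m\<close> the two supports are disjoint.\<close>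

lemma has_sum_odd_recip_translate:
  assumes "m \<noteq> 0"
  shows "((\<lambda>j. odd_recip j * odd_recip (j - m)) has_sum 0) UNIV"
proof (cases "even m")
  case True
  then obtain q where "m = 2 * q" by blast
  then show ?thesis using has_sum_odd_recip[of q 0] has_sum_hilbert_mult[of q] assms by simp
next
  case False
  then show ?thesis by (intro has_sum_0) (auto simp: odd_recip_def)
qed

text \<open>The conclusion covers the case in which neither side is summable and both values are the
  default, so users need not establish summability.\<close>

lemma infsum_eq_has_sum:
  fixes f :: "'a \<Rightarrow> 'c :: {topological_comm_monoid_add, t2_space}" and g :: "'b \<Rightarrow> 'c"
  assumes "\<And>s. (f has_sum s) A \<longleftrightarrow> (g has_sum s) B"
  shows "infsum f A = infsum g B"
proof (cases "f summable_on A")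
  case True
  then have "(g has_sum infsum f A) B" using has_sum_infsum assms by blast
  then show ?thesis by (rule infsumI[symmetric])
next
  case False
  then have "\<not> g summable_on B" using assms by (simp add: summable_on_def)
  with False show ?thesis by (simp add: infsum_not_exists)
qed

lemma has_sum_if_eq: "((\<lambda>j. if j = a then f j else 0) has_sum f a) UNIV"
  by (rule has_sum_finite_neutralI[of "{a}"]) auto

text \<open>The square wave plus or minus a suitable constant is a multiple of the indicator of one
  of two complementary half circles. \<open>f\<close> and \<open>g\<close> are the corresponding
  coefficient sequences, and disjointness of the half circles is the orthogonality of all
  translates.\<close>

lemma orthogonal_translates_exist:
  "\<exists>f g :: int \<Rightarrow> complex. (\<lambda>j. (cmod (f j))\<^sup>2) summable_on UNIV \<and> (\<lambda>j. (cmod (g j))\<^sup>2) summable_on UNIV \<and>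
    f 1 \<noteq> 0 \<and> g 1 \<noteq> 0 \<and> (\<forall>m. ((\<lambda>j. g j * cnj (f (j - m))) has_sum 0) UNIV)"
proof -
  let ?b = "\<lambda>j. complex_of_real (odd_recip j)"
  have summ: "(\<lambda>j. odd_recip j * odd_recip j) summable_on UNIV"
    using has_sum_odd_recip[of 0] summable_hilbert_square by (auto simp: summable_on_def)
  define s where "s = (\<Sum>\<^sub>\<infinity>j. odd_recip j * odd_recip j)"
  have s: "((\<lambda>j. odd_recip j * odd_recip j) has_sum s) UNIV"
    unfolding s_def by (rule has_sum_infsum[OF summ])
  have s0: "s \<ge> 0" unfolding s_def by (rule infsum_nonneg) simp
  \<comment> \<open>\<open>d * d = - s\<close> cancels the term at \<open>m = 0\<close>, and
    \<open>d\<close> is imaginary so that conjugating \<open>f\<close> changes its constant from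
    \<open>- d\<close> to \<open>d\<close>. The cross terms cancel because \<open>odd_recip\<close>
    is odd.\<close>
  define d where "d = \<i> * complex_of_real (sqrt s)"
  have d: "cnj d = - d" "d * d = - complex_of_real s"
    using s0 by (simp_all add: d_def complex_eq_iff)
  define f where "f j = ?b j - (if j = 0 then d else 0)" for j
  define g where "g j = ?b j + (if j = 0 then d else 0)" for j
  have sq: "(\<lambda>j. (cmod (?b j + (if j = 0 then c else 0)))\<^sup>2) summable_on UNIV" for c
  proof -
    have "(\<lambda>j. odd_recip j * odd_recip j + (if j = 0 then (cmod c)\<^sup>2 else 0)) summable_on UNIV"
      using has_sum_if_eq[of 0 "\<lambda>_. (cmod c)\<^sup>2"] by (intro summable_on_add summ) (auto simp: summable_on_def)
    also have "(\<lambda>j. odd_recip j * odd_recip j + (if j = 0 then (cmod c)\<^sup>2 else 0)) =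
        (\<lambda>j. (cmod (?b j + (if j = 0 then c else 0)))\<^sup>2)"
      by (auto simp: odd_recip_def power2_eq_square)
    finally show ?thesis .
  qed
  have "((\<lambda>j. g j * cnj (f (j - m))) has_sum 0) UNIV" for m
  proof -
    have b: "((\<lambda>j. ?b j * ?b (j - m)) has_sum (if m = 0 then complex_of_real s else 0)) UNIV"
      using has_sum_of_real[OF has_sum_odd_recip_translate[of m]] has_sum_of_real[OF s]
      by auto
    have "((\<lambda>j. ?b j * ?b (j - m) + (if j = m then d * ?b j else 0) +
        (if j = 0 then d * ?b (j - m) else 0) + (if j = 0 then (if m = 0 then d * d else 0) else 0))
        has_sum ((if m = 0 then complex_of_real s else 0) + d * ?b m + d * ?b (0 - m) + (if m = 0 then d * d else 0))) UNIV"
      by (intro has_sum_add b has_sum_if_eq)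
    also have "(if m = 0 then complex_of_real s else 0) + d * ?b m + d * ?b (0 - m) + (if m = 0 then d * d else 0) = 0"
      using d(2) by (simp add: odd_recip_minus)
    also have "(\<lambda>j. ?b j * ?b (j - m) + (if j = m then d * ?b j else 0) +
        (if j = 0 then d * ?b (j - m) else 0) + (if j = 0 then (if m = 0 then d * d else 0) else 0)) =
        (\<lambda>j. g j * cnj (f (j - m)))"
      using d(1) by (auto simp: f_def g_def algebra_simps)
    finally show ?thesis .
  qed
  moreover have "f 1 \<noteq> 0" "g 1 \<noteq> 0" by (simp_all add: f_def g_def odd_recip_def)
  moreover have "(\<lambda>j. (cmod (f j))\<^sup>2) summable_on UNIV" "(\<lambda>j. (cmod (g j))\<^sup>2) summable_on UNIV"
    using sq[of "- d"] sq[of d] by (simp_all add: f_def g_def if_distrib cong: if_cong)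
  ultimately show ?thesis by blast
qed

section \<open>Transport of sequences to orbits, and a reducing subspace for the unweighted
  shift\<close>

context periodic_translates
begin

definition spread :: "(int \<Rightarrow> complex) \<Rightarrow> fgword \<Rightarrow> fgword vec" where
  "spread f u x = (if \<exists>j. x = act u j then f (THE j. x = act u j) else 0)"

lemma spread_act: "u \<in> X \<Longrightarrow> spread f u (act u j) = f j"
  using act_inj[of u] by (auto simp: spread_def)

lemma spread_off: "\<nexists>j. x = act u j \<Longrightarrow> spread f u x = 0"
  by (simp add: spread_def)

lemma spread_ell2:
  assumes f: "(\<lambda>j. (cmod (f j))\<^sup>2) summable_on UNIV" and u: "u \<in> X"
  shows "spread f u \<in> ell2 X"
proof -
  have "((\<lambda>x. (cmod (spread f u x))\<^sup>2) has_sum s) UNIV \<longleftrightarrow> ((\<lambda>j. (cmod (f j))\<^sup>2) has_sum s) UNIV" for s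
    using orbit_has_sum[OF u, of UNIV "\<lambda>x. (cmod (spread f u x))\<^sup>2" s] spread_off[of _ u f]
    by (auto simp: spread_act[OF u])
  then have "(\<lambda>x. (cmod (spread f u x))\<^sup>2) summable_on UNIV" using f by (simp add: summable_on_def)
  moreover have "spread f u x = 0" if "x \<notin> X" for x
    by (rule spread_off) (use act_closed[OF u] that in blast)
  ultimately show ?thesis by (simp add: ell2_def)
qed

lemma cinner_spread:
  assumes u: "u \<in> X"
  shows "cinner h (spread f u) = (\<Sum>\<^sub>\<infinity>j. h (act u j) * cnj (f j))"
  unfolding cinner_def
proof (rule infsum_eq_has_sum)
  fix s
  show "((\<lambda>x. h x * cnj (spread f u x)) has_sum s) UNIV \<longleftrightarrow> ((\<lambda>j. h (act u j) * cnj (f j)) has_sum s) UNIV"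
    using orbit_has_sum[OF u, of UNIV "\<lambda>x. h x * cnj (spread f u x)" s] spread_off[of _ u f]
    by (auto simp: spread_act[OF u])
qed

lemma mu_inj_on: "i \<in> letters n \<Longrightarrow> inj_on (\<mu> i) X"
  using mu_inj by (auto intro: inj_onI)

lemma mu_image_sub: "i \<in> letters n \<Longrightarrow> \<mu> i ` X \<subseteq> X"
  using mu_closed by blast

lemma unweighted_shift_push:
  assumes S: "weighted_shift n (cycle v0) (\<lambda>_. 1) S" and i: "i \<in> letters n"
  shows "S i = (\<lambda>f\<in>ell2 X. push X (\<mu> i) f)"
  by (rule bop_eqI_ket[OF weighted_shift_bop[OF S i] push_bop[OF mu_inj_on[OF i] mu_image_sub[OF i]]])
    (simp add: weighted_shift_ket[OF S i] ket_ell2 push_ket[OF mu_inj_on[OF i] mu_image_sub[OF i]])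

text \<open>\<open>H\<close> consists of the vectors orthogonal to \<open>f\<close> placed along
  every orbit with every starting point. It contains \<open>g\<close> placed along an orbit but not
  \<open>f\<close> itself, which makes it non-trivial.\<close>

lemma unweighted_shift_reducible:
  assumes S: "weighted_shift n (cycle v0) (\<lambda>_. 1) S"
  shows "\<exists>H. reduces (ell2 X) H (S ` letters n) \<and> nontrivial (ell2 X) H"
proof -
  obtain f g :: "int \<Rightarrow> complex" where f: "(\<lambda>j. (cmod (f j))\<^sup>2) summable_on UNIV" "f 1 \<noteq> 0"
    and g: "(\<lambda>j. (cmod (g j))\<^sup>2) summable_on UNIV" "g 1 \<noteq> 0"
    and orth: "\<And>m. ((\<lambda>j. g j * cnj (f (j - m))) has_sum 0) UNIV"
    using orthogonal_translates_exist by blast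
  define H where "H = {h \<in> ell2 X. \<forall>\<phi>\<in>spread f ` X. cinner h \<phi> = 0}"
  have H: "closed_subspace (ell2 X) H"
    unfolding H_def by (rule closed_subspace_orthogonal) (use spread_ell2[OF f(1)] in blast)
  have memH: "h \<in> H \<longleftrightarrow> h \<in> ell2 X \<and> (\<forall>u\<in>X. (\<Sum>\<^sub>\<infinity>j. h (act u j) * cnj (f j)) = 0)" for h
    by (auto simp: H_def cinner_spread)
  have "commute (ell2 X) (proj (ell2 X) H) (S i)" if i: "i \<in> letters n" for i
  proof (rule commute_projI[OF H weighted_shift_bop[OF S i]])
    note io = mu_inj_on[OF i] mu_image_sub[OF i]
    show "cinner (S i a) b = cinner a (pull X (\<mu> i) b)" if "a \<in> ell2 X" "b \<in> ell2 X" for a b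
      using that cinner_push[OF io] by (simp add: unweighted_shift_push[OF S i])
    fix h assume h: "h \<in> H"
    then have hX: "h \<in> ell2 X" and h0: "\<And>u. u \<in> X \<Longrightarrow> (\<Sum>\<^sub>\<infinity>j. h (act u j) * cnj (f j)) = 0"
      by (auto simp: memH)
    show "S i h \<in> H"
      unfolding memH
    proof (intro conjI ballI)
      show "S i h \<in> ell2 X" by (rule bop_maps[OF weighted_shift_bop[OF S i] hX])
      fix u assume "u \<in> X"
      \<comment> \<open>Left multiplication by a letter carries orbits onto orbits, so the pairing
        along the orbit of \<open>\<mu> j w\<close> is either the one of \<open>h\<close> along the
        orbit of \<open>w\<close> or zero.\<close>
      then obtain j w where w: "j \<in> letters n" "w \<in> X" "u = \<mu> j w" using mu_cover by blast
      have "S i h (act u a) = (if j = i then h (act w a) else 0)" for a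
        using weighted_shift_apply[OF S w(1) i act_closed[OF w(2)] hX, of a] mu_act[OF w(1,2), of a] w(3)
        by simp
      then show "(\<Sum>\<^sub>\<infinity>a. S i h (act u a) * cnj (f a)) = 0"
        using h0[OF w(2)] by (cases "j = i") simp_all
    qed
    show "pull X (\<mu> i) h \<in> H"
      unfolding memH
    proof (intro conjI ballI)
      show "pull X (\<mu> i) h \<in> ell2 X" by (rule pull_ell2[OF io hX])
      fix u assume u: "u \<in> X"
      have "pull X (\<mu> i) h (act u a) = h (act (\<mu> i u) a)" for a
        using act_closed[OF u, of a] mu_act[OF i u, of a] by (simp add: pull_def)
      then show "(\<Sum>\<^sub>\<infinity>a. pull X (\<mu> i) h (act u a) * cnj (f a)) = 0"
        using h0[OF mu_closed[OF i u]] by simp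
    qed
  qed
  with H have "reduces (ell2 X) H (S ` letters n)" by (auto simp: reduces_def)
  moreover have "nontrivial (ell2 X) H"
    unfolding nontrivial_def
  proof
    let ?u = "elt [] 0"
    note u = X_nonempty
    have "spread g ?u \<in> H"
      unfolding memH
    proof (intro conjI ballI)
      show "spread g ?u \<in> ell2 X" by (rule spread_ell2[OF g(1) u])
      fix w assume w: "w \<in> X"
      show "(\<Sum>\<^sub>\<infinity>j. spread g ?u (act w j) * cnj (f j)) = 0"
      proof (cases "\<exists>m. w = act ?u m")
        case True
        then obtain m where m: "w = act ?u m" by blast
        have "spread g ?u (act w j) = g (m + j)" for j
          using spread_act[OF u, of g "m + j"] act_act[OF u, of m j] m by simp
        moreover have "((\<lambda>j. g (j + m) * cnj (f (j + m - m))) has_sum 0) UNIV"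
          using has_sum_translate[of "\<lambda>j. g j * cnj (f (j - m))" m 0] orth[of m] by simp
        ultimately show ?thesis by (simp add: add.commute infsumI)
      next
        case False
        have "spread g ?u (act w j) = 0" for j
        proof (rule spread_off, rule notI)
          assume "\<exists>a. act w j = act ?u a"
          then obtain a where "act w j = act ?u a" by blast
          then have "act (act w j) (- j) = act (act ?u a) (- j)" by simp
          then have "w = act ?u (a - j)" using act_act[OF w] act_act[OF u] act_0[OF w] by simp
          with False show False by blast
        qed
        then show ?thesis by simp
      qed
    qed
    moreover have "spread g ?u (act ?u 1) \<noteq> 0" using spread_act[OF u] g(2) by simp
    ultimately show "H \<noteq> {\<lambda>x. 0}" by auto
    have sf: "spread f ?u \<in> ell2 X" by (rule spread_ell2[OF f(1) u])
    have "spread f ?u (act ?u 1) \<noteq> 0" using spread_act[OF u] f(2) by simp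
    then have "cinner (spread f ?u) (spread f ?u) \<noteq> 0"
      using cinner_self_eq_0_iff[OF sf] by (metis)
    then have "spread f ?u \<notin> H" using u unfolding H_def by blast
    with sf show "H \<noteq> ell2 X" by blast
  qed
  ultimately show ?thesis by blast
qed

end

section \<open>Coordinates along the orbits\<close>

lemma cinner_sum_left:
  assumes "\<And>i. i \<in> I \<Longrightarrow> f i \<in> ell2 Y" "h \<in> ell2 Z"
  shows "cinner (\<lambda>x. \<Sum>i\<in>I. f i x) h = (\<Sum>i\<in>I. cinner (f i) h)"
  using assms(1)
proof (induction I rule: infinite_finite_induct)
  case (insert i I)
  have "(\<lambda>x. \<Sum>i\<in>I. f i x) \<in> ell2 Y" by (rule ell2_sum) (use insert.prems in simp)
  then show ?case
    using insert cinner_add_left[of "f i" Y "\<lambda>x. \<Sum>i\<in>I. f i x" Y h Z] assms(2) by simp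
qed simp_all

lemma takeWhile_pos_neg: "takeWhile snd (pos v @ neg w) = pos v"
  by (induction v) (cases w rule: rev_cases, auto simp: pos_def neg_def)

lemma dropWhile_pos_neg: "dropWhile snd (pos v @ neg w) = neg w"
  by (induction v) (cases w rule: rev_cases, auto simp: pos_def neg_def)

context word_translates
begin

interpretation FG: group "FG n"
  by (rule group_free_group)

lemma lmul_closed: "w \<in> lists (letters n) \<Longrightarrow> x \<in> X \<Longrightarrow> pos w \<otimes>\<^bsub>FG n\<^esub> x \<in> X"
proof (induction w)
  case Nil
  then show ?case by (simp add: pos_Nil F_omega_carrier)
next
  case (Cons i w)
  then have "pos (i # w) \<otimes>\<^bsub>FG n\<^esub> x = \<mu> i (pos w \<otimes>\<^bsub>FG n\<^esub> x)"
    using pos_append[of "[i]" w] by (simp add: FG.m_assoc F_omega_carrier)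
  with Cons show ?case using mu_closed by simp
qed

lemma lmul_inj_on: "w \<in> lists (letters n) \<Longrightarrow> inj_on (\<lambda>x. pos w \<otimes>\<^bsub>FG n\<^esub> x) X"
  by (rule inj_onI) (simp add: F_omega_carrier)

lemma lmul_image: "w \<in> lists (letters n) \<Longrightarrow> (\<lambda>x. pos w \<otimes>\<^bsub>FG n\<^esub> x) ` X \<subseteq> X"
  using lmul_closed by blast

lemma word_op_push:
  assumes S: "weighted_shift n \<omega> (\<lambda>_. 1) S" and w: "w \<in> lists (letters n)"
  shows "word_op (ell2 X) S w = (\<lambda>f\<in>ell2 X. push X (\<lambda>x. pos w \<otimes>\<^bsub>FG n\<^esub> x) f)"
proof -
  have "word_op (ell2 X) S w \<in> bop (ell2 X) (ell2 X) \<and>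
      (\<forall>u\<in>X. word_op (ell2 X) S w (ket u) = ket (pos w \<otimes>\<^bsub>FG n\<^esub> u))"
    using w
  proof (induction w)
    case Nil
    have "word_op (ell2 X) S [] = (\<lambda>f\<in>ell2 X. f)" by (simp add: word_op_def)
    then show ?case
      using bop_id[of X] by (auto simp only: restrict_apply' ket_ell2 pos_Nil F_omega_carrier FG.l_one)
  next
    case (Cons i w)
    then have i: "i \<in> letters n" and w: "w \<in> lists (letters n)" by auto
    have IH: "word_op (ell2 X) S w \<in> bop (ell2 X) (ell2 X)"
      "\<And>u. u \<in> X \<Longrightarrow> word_op (ell2 X) S w (ket u) = ket (pos w \<otimes>\<^bsub>FG n\<^esub> u)"
      using Cons.IH by auto
    have eq: "word_op (ell2 X) S (i # w) = compose (ell2 X) (S i) (word_op (ell2 X) S w)"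
      by (simp add: word_op_def)
    have "pos (i # w) \<otimes>\<^bsub>FG n\<^esub> u = \<mu> i (pos w \<otimes>\<^bsub>FG n\<^esub> u)" if "u \<in> X" for u
      using pos_append[of "[i]" w] i w that by (simp add: FG.m_assoc F_omega_carrier)
    then show ?case
      using bop_compose[OF weighted_shift_bop[OF S i] IH(1)] IH(2) lmul_closed[OF w]
      by (simp add: eq compose_eq ket_ell2 weighted_shift_ket[OF S i])
  qed
  then show ?thesis
    by (intro bop_eqI_ket[OF _ push_bop[OF lmul_inj_on[OF w] lmul_image[OF w]]])
      (simp_all add: ket_ell2 push_ket[OF lmul_inj_on[OF w] lmul_image[OF w]])
qed

lemma adj_word_op:
  assumes S: "weighted_shift n \<omega> (\<lambda>_. 1) S" and w: "w \<in> lists (letters n)"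
  shows "adj (ell2 X) (ell2 X) (word_op (ell2 X) S w) = (\<lambda>f\<in>ell2 X. pull X (\<lambda>x. pos w \<otimes>\<^bsub>FG n\<^esub> x) f)"
  unfolding word_op_push[OF S w]
  by (rule adj_eqI[OF push_bop[OF lmul_inj_on[OF w] lmul_image[OF w]]
        pull_bop[OF lmul_inj_on[OF w] lmul_image[OF w]]])
    (simp add: cinner_push[OF lmul_inj_on[OF w] lmul_image[OF w]])

end

context periodic_translates
begin

interpretation FG: group "FG n"
  by (rule group_free_group)

text \<open>Together with \<open>expo\<close> this gives coordinates identifying \<open>X\<close>
  with the product of \<open>block n v0 0\<close> and the integers, on which \<open>act\<close> adds
  to the second coordinate. The description is unique by \<open>block_unique\<close>.\<close>

definition base :: "fgword \<Rightarrow> fgword" where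
  "base x = (THE g. g \<in> block n v0 0 \<and> (\<exists>l. x = act g l))"

definition expo :: "fgword \<Rightarrow> int" where
  "expo x = (THE l. \<exists>g\<in>block n v0 0. x = act g l)"

lemma base_act: "g \<in> block n v0 0 \<Longrightarrow> base (act g l) = g"
  unfolding base_def by (rule the_equality) (use block_unique in blast)+

lemma expo_act: "g \<in> block n v0 0 \<Longrightarrow> expo (act g l) = l"
  unfolding expo_def by (rule the_equality) (use block_unique in blast)+

lemma base_block: "x \<in> X \<Longrightarrow> base x \<in> block n v0 0"
  using block_cover[of x] base_act by auto

lemma act_base_expo: "x \<in> X \<Longrightarrow> act (base x) (expo x) = x"
  using block_cover[of x] base_act expo_act by auto

lemma base_X: "x \<in> X \<Longrightarrow> base x \<in> X"
  using base_block block_sub by blast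

lemma coords_act:
  assumes "x \<in> X"
  shows "base (act x j) = base x" and "expo (act x j) = expo x + j"
proof -
  have "act x j = act (base x) (expo x + j)"
    using act_act[OF base_X[OF assms]] act_base_expo[OF assms] by metis
  then show "base (act x j) = base x" "expo (act x j) = expo x + j"
    using base_act expo_act base_block[OF assms] by simp_all
qed

lemma coords_eqI: "x \<in> X \<Longrightarrow> y \<in> X \<Longrightarrow> base x = base y \<Longrightarrow> expo x = expo y \<Longrightarrow> x = y"
  using act_base_expo by metis

lemma J_phi_eq: "J_phi n v0 k = {pos v0 [^]\<^bsub>FG n\<^esub> (int k * l) | l. True}"
proof -
  have "(pos v0 [^]\<^bsub>FG n\<^esub> k) [^]\<^bsub>FG n\<^esub> l = pos v0 [^]\<^bsub>FG n\<^esub> (int k * l)" for l :: int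
    using FG.int_pow_pow[of "pos v0" "int k" l] by (simp add: int_pow_int)
  then show ?thesis by (simp add: J_phi_def)
qed

lemma J_eq: "J n v0 k u = {act u (int k * l) | l. True}"
  by (auto simp: J_def l_coset_def J_phi_eq act_def)

lemma J_sub: "u \<in> X \<Longrightarrow> J n v0 k u \<subseteq> X"
  by (auto simp: J_eq act_closed)

end

locale k_periodic_translates = periodic_translates n v0 for n v0 +
  fixes k :: nat
  assumes k: "1 \<le> k"
begin

interpretation FG: group "FG n"
  by (rule group_free_group)

text \<open>The range of \<open>block_proj n v0 k r\<close> in coordinates. The sign comes from
  \<open>block n v0 r\<close> being the translate of block 0 by \<open>- r\<close>.\<close>

definition layer :: "nat \<Rightarrow> fgword set" where
  "layer r = {x \<in> X. int k dvd expo x + int r}"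

lemma layer_sub: "layer r \<subseteq> X"
  by (auto simp: layer_def)

lemma layer_act: "x \<in> X \<Longrightarrow> act x (int k * l) \<in> layer r \<longleftrightarrow> x \<in> layer r"
proof -
  assume x: "x \<in> X"
  have "expo x + int k * l + int r = (expo x + int r) + int k * l" by simp
  then have "int k dvd expo x + int k * l + int r \<longleftrightarrow> int k dvd expo x + int r" by (simp only: dvd_add_times_triv_right_iff mult.commute[of "int k"])
  then show ?thesis using x act_closed[OF x] coords_act[OF x] by (simp add: layer_def)
qed

lemma dvd_residue_eq:
  assumes "int k dvd a + int r" "int k dvd a + int s" "r < k" "s < k"
  shows "r = s"
proof -
  have "int k dvd int r - int s" using dvd_diff[OF assms(1,2)] by simp
  then have "int r mod int k = int s mod int k" by (simp add: mod_eq_dvd_iff)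
  then show ?thesis using assms(3,4) by simp
qed

lemma layer_disjoint: "r < k \<Longrightarrow> s < k \<Longrightarrow> r \<noteq> s \<Longrightarrow> layer r \<inter> layer s = {}"
  using dvd_residue_eq by (auto simp: layer_def)

lemma layer_cover: "(\<Union>r<k. layer r) = X"
proof
  show "X \<subseteq> (\<Union>r<k. layer r)"
  proof
    fix x assume x: "x \<in> X"
    define r where "r = nat ((- expo x) mod int k)"
    have "int r = (- expo x) mod int k" using k by (simp add: r_def)
    then have "expo x + int r = int k * (- ((- expo x) div int k))"
      using minus_mult_div_eq_mod[of "- expo x" "int k"] by simp
    then have "int k dvd expo x + int r" by (rule dvdI)
    moreover have "r < k" using k by (simp add: r_def nat_less_iff)
    ultimately show "x \<in> (\<Union>r<k. layer r)" using x by (auto simp: layer_def)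
  qed
qed (use layer_sub in blast)

lemma block_coords:
  "u \<in> block n v0 r \<longleftrightarrow> u \<in> X \<and> expo u = - int r"
proof
  assume "u \<in> block n v0 r"
  then obtain g where "g \<in> block n v0 0" "u = act g (- int r)" using block_eq by blast
  then show "u \<in> X \<and> expo u = - int r" using expo_act block_sub act_closed by blast
next
  assume "u \<in> X \<and> expo u = - int r"
  then have "u = act (base u) (- int r)" "base u \<in> block n v0 0" using act_base_expo base_block by metis+
  then show "u \<in> block n v0 r" using block_eq by blast
qed

lemma J_coords:
  assumes "u \<in> X"
  shows "x \<in> J n v0 k u \<longleftrightarrow> x \<in> X \<and> base x = base u \<and> int k dvd expo x - expo u"
proof
  assume "x \<in> J n v0 k u"
  then show "x \<in> X \<and> base x = base u \<and> int k dvd expo x - expo u"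
    using coords_act[OF assms] act_closed[OF assms] by (auto simp: J_eq)
next
  assume x: "x \<in> X \<and> base x = base u \<and> int k dvd expo x - expo u"
  then obtain l where "expo x - expo u = int k * l" by blast
  then have l: "expo x = expo u + int k * l" by linarith
  have "x = act u (int k * l)"
    by (rule coords_eqI) (use x l coords_act[OF assms, of "int k * l"] act_closed[OF assms] in simp_all)
  then show "x \<in> J n v0 k u" by (auto simp: J_eq)
qed

lemma Union_J_block: "(\<Union>u\<in>block n v0 r. J n v0 k u) = layer r"
proof
  show "(\<Union>u\<in>block n v0 r. J n v0 k u) \<subseteq> layer r"
    by (auto simp: block_coords J_coords layer_def)
  show "layer r \<subseteq> (\<Union>u\<in>block n v0 r. J n v0 k u)"
  proof
    fix x assume x: "x \<in> layer r"
    then have xX: "x \<in> X" using layer_sub by blast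
    let ?u = "act (base x) (- int r)"
    have "?u \<in> block n v0 r" using block_eq base_block[OF xX] by blast
    moreover have "x \<in> J n v0 k ?u"
      using x xX act_closed[OF base_X[OF xX]] base_act[OF base_block[OF xX]] expo_act[OF base_block[OF xX]]
      by (subst J_coords) (auto simp: layer_def)
    ultimately show "x \<in> (\<Union>u\<in>block n v0 r. J n v0 k u)" by blast
  qed
qed

lemma principal_sub: "principal_component n v0 k \<subseteq> X"
  unfolding principal_component_eq using block_sub by blast

lemma Union_J_principal: "(\<Union>u\<in>principal_component n v0 k. J n v0 k u) = X"
proof -
  have "(\<Union>u\<in>principal_component n v0 k. J n v0 k u) = (\<Union>r<k. \<Union>u\<in>block n v0 r. J n v0 k u)"
    by (auto simp: principal_component_eq)
  also have "\<dots> = X" by (simp only: Union_J_block layer_cover)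
  finally show ?thesis .
qed

lemma J_disjoint:
  assumes "u \<in> principal_component n v0 k" "w \<in> principal_component n v0 k" "u \<noteq> w"
  shows "J n v0 k u \<inter> J n v0 k w = {}"
proof (rule ccontr)
  assume "\<not> ?thesis"
  then obtain x where x: "x \<in> J n v0 k u" "x \<in> J n v0 k w" by blast
  obtain r where r: "r < k" "u \<in> X" "expo u = - int r"
    using assms(1) by (auto simp: principal_component_eq block_coords)
  obtain s where s: "s < k" "w \<in> X" "expo w = - int s"
    using assms(2) by (auto simp: principal_component_eq block_coords)
  have xu: "base x = base u" "int k dvd expo x - expo u" using x(1) J_coords[OF r(2)] by blast+
  have xw: "base x = base w" "int k dvd expo x - expo w" using x(2) J_coords[OF s(2)] by blast+
  have "r = s"
    using dvd_residue_eq[of "expo x" r s] xu(2) xw(2) r s by simp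
  then have "u = w" using xu(1) xw(1) r s by (intro coords_eqI[OF r(2) s(2)]) simp_all
  with assms(3) show False by simp
qed

lemma J_disjoint_block:
  assumes "u \<in> block n v0 r" "w \<in> block n v0 r" "u \<noteq> w"
  shows "J n v0 k u \<inter> J n v0 k w = {}"
proof (rule ccontr)
  assume "\<not> ?thesis"
  then obtain x where x: "x \<in> J n v0 k u" "x \<in> J n v0 k w" by blast
  have uw: "u \<in> X" "w \<in> X" "expo u = expo w" using assms(1,2) block_coords by simp_all
  have "base u = base w" using x J_coords[OF uw(1)] J_coords[OF uw(2)] by metis
  then have "u = w" using uw by (intro coords_eqI[OF uw(1,2)])
  with assms(3) show False by simp
qed

lemma Q_J_eq:
  assumes "u \<in> X"
  shows "Q n (cycle v0) (J n v0 k u) = (\<lambda>f\<in>ell2 X. restr (J n v0 k u) f)"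
  unfolding Q_def K_omega_def closed_span_ket[OF J_sub[OF assms]] by (rule proj_ell2_subset[OF J_sub[OF assms]])

lemma block_proj_eq: "block_proj n v0 k r = (\<lambda>f\<in>ell2 X. restr (layer r) f)"
  and has_orth_proj_sum_block:
    "has_orth_proj_sum (ell2 X) (block n v0 r) (\<lambda>u. Q n (cycle v0) (J n v0 k u)) (block_proj n v0 k r)"
proof -
  have *: "has_orth_proj_sum (ell2 X) (block n v0 r) (\<lambda>u. Q n (cycle v0) (J n v0 k u))
      (\<lambda>f\<in>ell2 X. restr (\<Union>u\<in>block n v0 r. J n v0 k u) f)"
    by (rule has_orth_proj_sum_restr) (use block_sub J_sub Q_J_eq J_disjoint_block in blast)+
  show eq: "block_proj n v0 k r = (\<lambda>f\<in>ell2 X. restr (layer r) f)"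
    unfolding block_proj_def K_omega_def Union_J_block[symmetric]
  proof (rule the_equality)
    show "has_orth_proj_sum (ell2 X) (block n v0 r) (\<lambda>u. Q n (cycle v0) (J n v0 k u))
      (\<lambda>f\<in>ell2 X. restr (\<Union>u\<in>block n v0 r. J n v0 k u) f)" by (rule *)
  qed (rule has_orth_proj_sum_unique[OF _ *])
  show "has_orth_proj_sum (ell2 X) (block n v0 r) (\<lambda>u. Q n (cycle v0) (J n v0 k u)) (block_proj n v0 k r)"
    using * unfolding eq Union_J_block .
qed

text \<open>For \<open>u = v w^-1\<close> the operator \<open>u(S)\<close> is the partial isometry
  sending \<open>ket (w y)\<close> to \<open>ket (v y)\<close>. Conjugating a coordinate projection
  by it moves the index set along this correspondence.\<close>

lemma elem_op_conjugation:
  assumes S: "weighted_shift n (cycle v0) (\<lambda>_. 1) S" and u: "u \<in> block n v0 r"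
  shows "compose (ell2 X) (elem_op (ell2 X) S u)
      (compose (ell2 X) (Q n (cycle v0) (J_phi n v0 k)) (adj (ell2 X) (ell2 X) (elem_op (ell2 X) S u))) =
    (\<lambda>f\<in>ell2 X. restr (J n v0 k u) f)"
proof -
  obtain v m where vm: "u = elt v m" "v \<in> lists (letters n)" "v \<noteq> [] \<longrightarrow> last v \<noteq> letter v0 m"
    using u unfolding in_block_iff by blast
  define w where "w = stake m (cycle v0)"
  have w: "w \<in> lists (letters n)" by (simp add: w_def)
  let ?v = "\<lambda>x. pos v \<otimes>\<^bsub>FG n\<^esub> x" and ?w = "\<lambda>x. pos w \<otimes>\<^bsub>FG n\<^esub> x"
  note iv = lmul_inj_on[OF vm(2)] lmul_image[OF vm(2)] and iw = lmul_inj_on[OF w] lmul_image[OF w]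
  have "u = pos v @ neg w"
    unfolding vm(1) w_def by (rule elt_reduced[OF vm(2)]) (use vm(3) in \<open>cases m; auto simp: letter_def\<close>)
  moreover have "map fst (pos v) = v" "rev (map fst (neg w)) = w" for v w
    by (simp_all add: pos_def neg_def comp_def rev_map)
  ultimately have eo: "elem_op (ell2 X) S u = compose (ell2 X) (\<lambda>f\<in>ell2 X. push X ?v f) (\<lambda>f\<in>ell2 X. pull X ?w f)"
    by (simp add: elem_op_def takeWhile_pos_neg dropWhile_pos_neg word_op_push[OF S vm(2)] adj_word_op[OF S w])
  have aeo: "adj (ell2 X) (ell2 X) (elem_op (ell2 X) S u) =
      compose (ell2 X) (\<lambda>f\<in>ell2 X. push X ?w f) (\<lambda>f\<in>ell2 X. pull X ?v f)"
    unfolding eo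
    by (rule adj_eqI[OF bop_compose[OF push_bop[OF iv] pull_bop[OF iw]] bop_compose[OF push_bop[OF iw] pull_bop[OF iv]]])
      (simp add: compose_eq pull_ell2[OF iv] pull_ell2[OF iw] cinner_push[OF iv] cinner_pull[OF iw])
  have one: "J_phi n v0 k = J n v0 k (elt [] 0)"
    by (simp add: J_eq J_phi_eq act_def elt_def pos_Nil)
  have Qp: "Q n (cycle v0) (J_phi n v0 k) = (\<lambda>f\<in>ell2 X. restr (J_phi n v0 k) f)"
    unfolding one by (rule Q_J_eq[OF X_nonempty])
  \<comment> \<open>For \<open>h\<close> in \<open>J_phi\<close> the element \<open>u h\<close>
    equals \<open>v y\<close> with \<open>y = w^-1 h\<close>; this \<open>y\<close> lies in
    \<open>X\<close>, and \<open>w y = h\<close>.\<close>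
  have Ju: "J n v0 k u = ?v ` {y \<in> X. ?w y \<in> J_phi n v0 k}"
  proof
    show "J n v0 k u \<subseteq> ?v ` {y \<in> X. ?w y \<in> J_phi n v0 k}"
    proof
      fix x assume "x \<in> J n v0 k u"
      then obtain l where x: "x = act (elt v m) (int k * l)" by (auto simp: J_eq vm(1))
      let ?h = "pos v0 [^]\<^bsub>FG n\<^esub> (int k * l)"
      define y where "y = act (elt [] m) (int k * l)"
      have y: "y \<in> X" unfolding y_def by (rule act_closed) (simp add: elt_in_F_omega)
      have y': "y = inv\<^bsub>FG n\<^esub> (pos w) \<otimes>\<^bsub>FG n\<^esub> ?h" using w by (simp add: y_def act_def elt_def pos_Nil w_def)
      have "?w y = ?h" using w by (simp add: y' flip: FG.m_assoc)
      moreover have "?v y = x"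
        using vm(2) w by (simp add: x y' act_def elt_def w_def[symmetric] FG.m_assoc)
      ultimately show "x \<in> ?v ` {y \<in> X. ?w y \<in> J_phi n v0 k}" using y by (auto simp: J_phi_eq)
    qed
    show "?v ` {y \<in> X. ?w y \<in> J_phi n v0 k} \<subseteq> J n v0 k u"
    proof clarify
      fix y assume y: "y \<in> X" "?w y \<in> J_phi n v0 k"
      then obtain l where l: "?w y = pos v0 [^]\<^bsub>FG n\<^esub> (int k * l)" by (auto simp: J_phi_eq)
      have "y = inv\<^bsub>FG n\<^esub> (pos w) \<otimes>\<^bsub>FG n\<^esub> ?w y"
        using w F_omega_carrier[OF y(1)] by (simp flip: FG.m_assoc)
      then have "?v y = act u (int k * l)"
        using l vm(2) w by (simp add: vm(1) act_def elt_def w_def[symmetric] FG.m_assoc)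
      then show "?v y \<in> J n v0 k u" by (auto simp: J_eq)
    qed
  qed
  show ?thesis
  proof (rule extensionalityI)
    fix f assume f: "f \<in> ell2 X"
    let ?g = "push X ?w (pull X ?v f)"
    have g: "?g \<in> ell2 X" by (rule push_ell2[OF iw pull_ell2(1)[OF iv f]])
    have rg: "restr (J_phi n v0 k) ?g \<in> ell2 X" by (rule restr_ell2[OF g])
    have "push X ?v (pull X ?w (restr (J_phi n v0 k) ?g)) = restr (J n v0 k u) f"
    proof
      fix x
      show "push X ?v (pull X ?w (restr (J_phi n v0 k) ?g)) x = restr (J n v0 k u) f x"
      proof (cases "x \<in> ?v ` X")
        case True
        then obtain y where y: "y \<in> X" "x = ?v y" by blast
        have "x \<in> J n v0 k u \<longleftrightarrow> ?w y \<in> J_phi n v0 k"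
          unfolding Ju using y iv(1) by (auto simp: inj_on_def)
        then show ?thesis
          using y push_at[OF iv y(1)] push_at[OF iw y(1)] by (simp add: pull_def restr_def)
      next
        case False
        then have "x \<notin> J n v0 k u" unfolding Ju by blast
        with False show ?thesis by (simp add: push_def restr_def)
      qed
    qed
    then show "compose (ell2 X) (elem_op (ell2 X) S u)
        (compose (ell2 X) (Q n (cycle v0) (J_phi n v0 k)) (adj (ell2 X) (ell2 X) (elem_op (ell2 X) S u))) f =
      (\<lambda>f\<in>ell2 X. restr (J n v0 k u) f) f"
      unfolding aeo unfolding Qp eo
      by (simp only: compose_eq restrict_apply' f g rg pull_ell2(1)[OF iv f] pull_ell2(1)[OF iw rg])
  qed (auto simp: compose_def)
qed

lemma has_orth_proj_sum_elem_op:
  assumes S: "weighted_shift n (cycle v0) (\<lambda>_. 1) S"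
  shows "has_orth_proj_sum (ell2 X) (block n v0 r)
    (\<lambda>u. compose (ell2 X) (elem_op (ell2 X) S u)
      (compose (ell2 X) (Q n (cycle v0) (J_phi n v0 k)) (adj (ell2 X) (ell2 X) (elem_op (ell2 X) S u))))
    (block_proj n v0 k r)"
  unfolding block_proj_eq Union_J_block[symmetric]
  by (rule has_orth_proj_sum_restr)
    (use elem_op_conjugation[OF S] block_sub J_sub J_disjoint_block in blast)+

text \<open>The definition speaks of elements \<open>\<mu> i v\<close>, which by
  \<open>mu_cover\<close> are all elements. Being constant on the classes \<open>J\<close> is then
  invariance under translation by \<open>k\<close>.\<close>

lemma weights_of_period_iff: "weights_of_period n v0 k \<Lambda> \<longleftrightarrow> period \<Lambda> (int k)"
proof
  assume wp: "weights_of_period n v0 k \<Lambda>"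
  have eq: "\<Lambda> x = \<Lambda> u" if "u \<in> principal_component n v0 k" "x \<in> J n v0 k u" for x u
  proof -
    have "x \<in> X" using that principal_sub J_sub by blast
    then obtain i y where "i \<in> letters n" "y \<in> X" "x = \<mu> i y" using mu_cover by blast
    then show ?thesis using wp that unfolding weights_of_period_def by blast
  qed
  show "period \<Lambda> (int k)"
    unfolding period_def
  proof
    fix x assume x: "x \<in> X"
    then obtain u where u: "u \<in> principal_component n v0 k" "x \<in> J n v0 k u"
      using Union_J_principal by blast
    then obtain l where l: "x = act u (int k * l)" by (auto simp: J_eq)
    have uX: "u \<in> X" using u(1) principal_sub by blast
    have "act x (int k) = act u (int k * (l + 1))"
      using act_act[OF uX, of "int k * l" "int k"] l by (simp add: distrib_left)
    then have "act x (int k) \<in> J n v0 k u" unfolding J_eq by blast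
    with u eq show "\<Lambda> (act x (int k)) = \<Lambda> x" by metis
  qed
next
  assume p: "period \<Lambda> (int k)"
  show "weights_of_period n v0 k \<Lambda>"
    unfolding weights_of_period_def
  proof (intro ballI impI)
    fix v i u assume u: "u \<in> principal_component n v0 k" and "\<mu> i v \<in> J n v0 k u"
    then obtain l where "\<mu> i v = act u (int k * l)" by (auto simp: J_eq)
    then show "\<Lambda> (\<mu> i v) = \<Lambda> u"
      using period_mult[OF p, of l] u principal_sub by (auto simp: period_def)
  qed
qed

end

section \<open>Modulations\<close>

lemma cinner_modulate: "cinner (\<lambda>x. w x * f x) g = cinner f (\<lambda>x. cnj (w x) * g x)"
  unfolding cinner_def by (rule infsum_cong) (simp add: mult_ac)

lemma modulate_ell2:
  assumes "\<And>x. cmod (w x) = 1" "f \<in> ell2 X"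
  shows "(\<lambda>x. w x * f x) \<in> ell2 X"
  by (rule ell2_dominated[OF assms(2)]) (simp add: norm_mult assms(1))

lemma cnj_mult_self:
  assumes "cmod c = 1"
  shows "cnj c * c = 1" "c * cnj c = 1"
  using assms by (simp_all add: complex_norm_square[symmetric] mult.commute[of "cnj c"])

text \<open>Multiplication by a unimodular function is unitary, so the projection onto the modulated
  subspace is the conjugate of the original one.\<close>

lemma modulate_subspace:
  assumes H: "closed_subspace (ell2 X) H" and w: "\<And>x. cmod (w x) = 1"
  defines "W \<equiv> \<lambda>f x. w x * f x"
  shows "closed_subspace (ell2 X) (W ` H)"
    and "f \<in> ell2 X \<Longrightarrow> proj (ell2 X) (W ` H) f = (\<lambda>x. w x * proj (ell2 X) H (\<lambda>y. cnj (w y) * f y) x)"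
proof -
  let ?P = "\<lambda>f x. w x * proj (ell2 X) H (\<lambda>y. cnj (w y) * f y) x"
  have w': "cmod (cnj (w x)) = 1" for x by (simp add: w)
  have P: "?P f \<in> W ` H" if f: "f \<in> ell2 X" for f
    unfolding W_def by (rule imageI) (rule proj_in[OF H modulate_ell2[OF w' f]])
  have orth: "cinner (\<lambda>x. f x - ?P f x) h = 0" if f: "f \<in> ell2 X" and h: "h \<in> W ` H" for f h
  proof -
    obtain g where g: "g \<in> H" "h = (\<lambda>x. w x * g x)" using h by (auto simp: W_def)
    let ?f = "\<lambda>y. cnj (w y) * f y"
    have f': "?f \<in> ell2 X" by (rule modulate_ell2[OF w' f])
    have "(\<lambda>x. f x - ?P f x) = (\<lambda>x. w x * (?f x - proj (ell2 X) H ?f x))"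
    proof
      fix x
      have "w x * (cnj (w x) * f x) = f x"
        using cnj_mult_self(2)[OF w, of x] by (simp flip: mult.assoc)
      then show "f x - ?P f x = w x * (?f x - proj (ell2 X) H ?f x)" by (simp add: right_diff_distrib)
    qed
    moreover have "(\<lambda>x. cnj (w x) * h x) = g"
      using cnj_mult_self(1)[OF w] by (auto simp: g(2) simp flip: mult.assoc)
    ultimately have "cinner (\<lambda>x. f x - ?P f x) h = cinner (\<lambda>x. ?f x - proj (ell2 X) H ?f x) g"
      by (simp only: cinner_modulate)
    then show ?thesis using proj_orthogonal[OF H f' g(1)] by simp
  qed
  show WH: "closed_subspace (ell2 X) (W ` H)"
  proof (rule closed_subspace_projectable[where P = ?P, OF _ _ _ _ P orth])
    have "W f \<in> ell2 X" if "f \<in> H" for f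
      unfolding W_def by (rule modulate_ell2[OF w closed_subspace_ell2[OF H that]])
    then show "W ` H \<subseteq> ell2 X" by blast
    show "(\<lambda>x. 0) \<in> W ` H" using closed_subspace_zero[OF H] by (force simp: W_def)
  next
    fix f g assume "f \<in> W ` H" "g \<in> W ` H"
    then obtain a b where "a \<in> H" "b \<in> H" "f = (\<lambda>x. w x * a x)" "g = (\<lambda>x. w x * b x)" by (auto simp: W_def)
    then show "(\<lambda>x. f x + g x) \<in> W ` H"
      using closed_subspace_add[OF H, of a b] by (auto simp: W_def distrib_left intro!: image_eqI[of _ _ "\<lambda>x. a x + b x"])
  next
    fix c f assume "f \<in> W ` H"
    then obtain a where "a \<in> H" "f = (\<lambda>x. w x * a x)" by (auto simp: W_def)
    then show "(\<lambda>x. c * f x) \<in> W ` H"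
      using closed_subspace_scale[OF H, of a c] by (auto simp: W_def intro!: image_eqI[of _ _ "\<lambda>x. c * a x"])
  qed
  show "proj (ell2 X) (W ` H) f = ?P f" if "f \<in> ell2 X"
    by (rule proj_eqI[OF WH that P[OF that] orth[OF that]])
qed

context k_periodic_translates
begin

section \<open>Reducing subspaces of periodic weights\<close>

definition act_invariant :: "fgword set \<Rightarrow> bool" where
  "act_invariant B \<longleftrightarrow> (\<forall>x\<in>X. \<forall>l. act x (int k * l) \<in> B \<longleftrightarrow> x \<in> B)"

lemma layer_invariant: "act_invariant (layer r)"
  using layer_act by (simp add: act_invariant_def)

lemma J_invariant:
  assumes "u \<in> X"
  shows "act_invariant (J n v0 k u)"
  unfolding act_invariant_def
proof (intro ballI allI)
  fix x l assume x: "x \<in> X"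
  have "expo x + int k * l - expo u = (expo x - expo u) + int k * l" by simp
  then have "int k dvd expo x + int k * l - expo u \<longleftrightarrow> int k dvd expo x - expo u"
    by (simp only: dvd_add_times_triv_right_iff mult.commute[of "int k"])
  then show "act x (int k * l) \<in> J n v0 k u \<longleftrightarrow> x \<in> J n v0 k u"
    using x act_closed[OF x] coords_act[OF x] by (simp add: J_coords[OF assms])
qed

text \<open>Coefficients supported on multiples of \<open>k\<close> couple only elements that differ
  by such a translation. The set \<open>B\<close> is a union of classes of this kind, so the matrix
  has no entry between \<open>B\<close> and its complement.\<close>

lemma commute_restr:
  assumes H: "closed_subspace (ell2 X) H" and c: "conv_kernel (proj (ell2 X) H) c"
    and supp: "\<And>j. c j \<noteq> 0 \<Longrightarrow> int k dvd j" and B: "act_invariant B"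
  shows "commute (ell2 X) (proj (ell2 X) H) (\<lambda>f\<in>ell2 X. restr B f)"
  unfolding commute_proj_ket_iff[OF H restr_bop]
proof
  fix u assume u: "u \<in> X"
  let ?P = "proj (ell2 X) H"
  have zero: "?P (ket u) x = 0" if "(x \<in> B) \<noteq> (u \<in> B)" for x
  proof (rule ccontr)
    assume nz: "?P (ket u) x \<noteq> 0"
    have x: "x \<in> X" using nz ell2_outside[OF proj_ell2[OF H ket_ell2[OF u]]] by blast
    obtain j where j: "u = act x j" using c x u nz unfolding conv_kernel_def by blast
    then have "c j \<noteq> 0" using c x nz unfolding conv_kernel_def by metis
    then obtain l where "j = int k * l" using supp by blast
    with that j B x show False unfolding act_invariant_def by blast
  qed
  have "?P (restr B (ket u)) = restr B (?P (ket u))"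
  proof (cases "u \<in> B")
    case True
    then have "restr B (ket u) = ket u" by (auto simp: restr_def ket_def)
    then show ?thesis using zero True by (auto simp: restr_def)
  next
    case False
    then have "restr B (ket u) = (\<lambda>x. 0)" by (auto simp: restr_def ket_def)
    moreover have "restr B (?P (ket u)) = (\<lambda>x. 0)" using zero False by (auto simp: restr_def)
    ultimately show ?thesis using bop_zero[OF proj_bop[OF H]] by simp
  qed
  then show "?P ((\<lambda>f\<in>ell2 X. restr B f) (ket u)) = (\<lambda>f\<in>ell2 X. restr B f) (?P (ket u))"
    using ket_ell2[OF u] proj_ell2[OF H] by simp
qed

lemma restr_invariant:
  assumes "closed_subspace (ell2 X) H" "conv_kernel (proj (ell2 X) H) c"
    "\<And>j. c j \<noteq> 0 \<Longrightarrow> int k dvd j" "act_invariant B" "f \<in> H"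
  shows "restr B f \<in> H"
  using commute_proj_invariant[OF assms(1) commute_restr[OF assms(1-4)] restr_bop assms(5)]
    closed_subspace_ell2[OF assms(1,5)] by simp

lemma reducing_decomposition:
  assumes H: "closed_subspace (ell2 X) H" and c: "conv_kernel (proj (ell2 X) H) c"
    and supp: "\<And>j. c j \<noteq> 0 \<Longrightarrow> int k dvd j"
  shows "orth_sum (ell2 X) (principal_component n v0 k) (\<lambda>u. Q n (cycle v0) (J n v0 k u) ` H) H"
    and "orth_sum (ell2 X) {..<k} (\<lambda>r. block_proj n v0 k r ` H) H"
    and "commute (ell2 X) (block_proj n v0 k r) (proj (ell2 X) H)"
proof -
  note inv = restr_invariant[OF H c supp]
  show "orth_sum (ell2 X) (principal_component n v0 k) (\<lambda>u. Q n (cycle v0) (J n v0 k u) ` H) H"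
  proof (rule orth_sum_restr[where B = "J n v0 k", OF H Union_J_principal J_disjoint])
    fix u f assume u: "u \<in> principal_component n v0 k"
    then have uX: "u \<in> X" using principal_sub by blast
    show "restr (J n v0 k u) f \<in> H" if "f \<in> H" by (rule inv[OF _ J_invariant[OF uX] that])
    show "Q n (cycle v0) (J n v0 k u) f = restr (J n v0 k u) f" if "f \<in> ell2 X"
      using that by (simp add: Q_J_eq[OF uX])
  qed
  show "orth_sum (ell2 X) {..<k} (\<lambda>r. block_proj n v0 k r ` H) H"
  proof (rule orth_sum_restr[where B = layer, OF H layer_cover])
    fix r f assume "r \<in> {..<k}"
    show "restr (layer r) f \<in> H" if "f \<in> H" by (rule inv[OF _ layer_invariant that])
    show "block_proj n v0 k r f = restr (layer r) f" if "f \<in> ell2 X"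
      using that by (simp add: block_proj_eq)
  qed (simp add: layer_disjoint)
  show "commute (ell2 X) (block_proj n v0 k r) (proj (ell2 X) H)"
    unfolding block_proj_eq commute_sym[of _ _ "proj (ell2 X) H"]
    by (rule commute_restr[OF H c supp layer_invariant])
qed

text \<open>Dilation of the orbit coordinate by \<open>k\<close>, followed by the shift into
  \<open>layer r\<close>: a bijection from \<open>X\<close> onto that layer. For
  \<open>r = 0\<close> it is inverse to the relabelling of basis vectors behind
  \<open>U_per\<close>.\<close>

definition theta :: "nat \<Rightarrow> fgword \<Rightarrow> fgword" where
  "theta r x = act (base x) (int k * expo x - int r)"

lemma theta_coords:
  assumes "x \<in> X"
  shows "theta r x \<in> X" "base (theta r x) = base x" "expo (theta r x) = int k * expo x - int r"
  unfolding theta_def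
  using act_closed[OF base_X[OF assms]] base_act[OF base_block[OF assms]] expo_act[OF base_block[OF assms]]
  by simp_all

lemma theta_inj_on: "inj_on (theta r) X"
proof (rule inj_onI)
  fix x y assume xy: "x \<in> X" "y \<in> X" and eq: "theta r x = theta r y"
  have "int k * expo x - int r = int k * expo y - int r"
    using arg_cong[OF eq, of expo] theta_coords(3)[OF xy(1)] theta_coords(3)[OF xy(2)] by simp
  moreover have "base x = base y"
    using arg_cong[OF eq, of base] theta_coords(2)[OF xy(1)] theta_coords(2)[OF xy(2)] by simp
  ultimately show "x = y" using k by (intro coords_eqI[OF xy]) simp_all
qed

lemma theta_image: "theta r ` X = layer r"
proof
  show "theta r ` X \<subseteq> layer r" by (auto simp: layer_def theta_coords)
  show "layer r \<subseteq> theta r ` X"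
  proof
    fix z assume z: "z \<in> layer r"
    then have zX: "z \<in> X" using layer_sub by blast
    obtain l where "expo z + int r = int k * l" using z by (auto simp: layer_def)
    then have l: "expo z = int k * l - int r" by simp
    let ?x = "act (base z) l"
    have x: "?x \<in> X" by (rule act_closed[OF base_X[OF zX]])
    have "theta r ?x = z"
      by (rule coords_eqI[OF theta_coords(1)[OF x] zX])
        (simp_all add: theta_coords[OF x] base_act[OF base_block[OF zX]] expo_act[OF base_block[OF zX]] l)
    with x show "z \<in> theta r ` X" by (metis imageI)
  qed
qed

lemma theta_sub: "theta r ` X \<subseteq> X"
  using theta_image layer_sub by simp

lemma theta_act:
  assumes "x \<in> X"
  shows "theta r (act x j) = act (theta r x) (int k * j)"
proof (rule coords_eqI)
  note t = theta_coords[OF assms] theta_coords[OF act_closed[OF assms]] coords_act[OF assms]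
    coords_act[OF theta_coords(1)[OF assms]]
  show "theta r (act x j) \<in> X" "act (theta r x) (int k * j) \<in> X"
    using t act_closed by blast+
  show "base (theta r (act x j)) = base (act (theta r x) (int k * j))"
    "expo (theta r (act x j)) = expo (act (theta r x) (int k * j))"
    by (simp_all add: t algebra_simps)
qed

lemma theta_orbit:
  assumes "x \<in> X" "y \<in> X" "theta r y = act (theta r x) (int k * j)"
  shows "y = act x j"
  using assms theta_act[OF assms(1), of r j] theta_inj_on[of r] act_closed[OF assms(1), of j]
  by (metis inj_onD)

lemma K_per_eq: "K_per n v0 k = ell2 (layer 0)"
proof -
  have "{ket (u \<otimes>\<^bsub>FG n\<^esub> (pos v0 [^]\<^bsub>FG n\<^esub> (int k * l))) | u l. u \<in> block n v0 0} =
      ket ` (\<Union>u\<in>block n v0 0. J n v0 k u)"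
    by (auto simp: J_eq act_def)
  then show ?thesis
    unfolding K_per_def K_omega_def Union_J_block using closed_span_ket[OF layer_sub] by simp
qed

text \<open>The prescribed values say that \<open>ket (theta 0 x)\<close> goes to
  \<open>ket x\<close>, which is what \<open>pull\<close> does. A bounded operator is determined by
  its values on basis vectors, hence uniqueness.\<close>

lemma U_per_eq: "U_per n v0 k = (\<lambda>f\<in>ell2 (layer 0). pull X (theta 0) f)"
  unfolding U_per_def K_per_eq K_omega_def act_def[symmetric]
proof (rule the_equality)
  have io: "inj_on (theta 0) X" "theta 0 ` X \<subseteq> layer 0" using theta_inj_on theta_image by simp_all
  let ?U = "\<lambda>f\<in>ell2 (layer 0). pull X (theta 0) f"
  have bop: "?U \<in> bop (ell2 (layer 0)) (ell2 X)" by (rule pull_bop[OF io])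
  have th: "act u (int k * l) = theta 0 (act u l)" if "u \<in> block n v0 0" for u l
    using base_act[OF that] expo_act[OF that] by (simp add: theta_def)
  have ket: "?U (ket (act u (int k * l))) = ket (act u l)" if "u \<in> block n v0 0" for u l
  proof -
    have x: "act u l \<in> X" using that block_sub act_closed by blast
    then have "theta 0 (act u l) \<in> layer 0" using io(2) by blast
    then show ?thesis using pull_ket[OF io x] by (simp add: th[OF that] ket_ell2)
  qed
  have "?U ` ell2 (layer 0) = ell2 X"
  proof
    show "?U ` ell2 (layer 0) \<subseteq> ell2 X" using bop_maps[OF bop] by blast
    show "ell2 X \<subseteq> ?U ` ell2 (layer 0)"
    proof
      fix g assume g: "g \<in> ell2 X"
      then have "?U (push X (theta 0) g) = g" using push_ell2[OF io g] pull_push[OF io g] by simp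
      then show "g \<in> ?U ` ell2 (layer 0)" using push_ell2[OF io g] by (metis imageI)
    qed
  qed
  moreover have "cinner (?U f) (?U g) = cinner f g" if "f \<in> ell2 (layer 0)" "g \<in> ell2 (layer 0)" for f g
    using that cinner_pull[OF io pull_ell2(1)[OF io that(2)], of f] push_pull[OF io, of g] restr_eq[OF that(2)]
    by (simp add: theta_image)
  ultimately show "unitary (ell2 (layer 0)) (ell2 X) ?U \<and>
      (\<forall>u\<in>block n v0 0. \<forall>l. ?U (ket (act u (int k * l))) = ket (act u l))"
    using bop ket by (simp add: unitary_def)
  fix V assume V: "unitary (ell2 (layer 0)) (ell2 X) V \<and>
      (\<forall>u\<in>block n v0 0. \<forall>l. V (ket (act u (int k * l))) = ket (act u l))"
  show "V = ?U"
  proof (rule bop_eqI_ket[OF _ bop])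
    show "V \<in> bop (ell2 (layer 0)) (ell2 X)" using V by (simp add: unitary_def)
    fix z assume "z \<in> layer 0"
    then obtain u where u: "u \<in> block n v0 0" "z \<in> J n v0 k u" using Union_J_block[of 0] by blast
    then obtain l where "z = act u (int k * l)" by (auto simp: J_eq)
    with u(1) V ket show "V (ket z) = ?U (ket z)" by metis
  qed
qed

lemma adj_U_per: "adj (ell2 (layer 0)) (ell2 X) (U_per n v0 k) = (\<lambda>g\<in>ell2 X. push X (theta 0) g)"
proof -
  have io: "inj_on (theta 0) X" "theta 0 ` X \<subseteq> layer 0" using theta_inj_on theta_image by simp_all
  show ?thesis
    unfolding U_per_eq
    by (rule adj_eqI[OF pull_bop[OF io] push_bop[OF io]]) (simp add: cinner_pull[OF io])
qed

text \<open>A character of the orbit coordinate with values in the \<open>k\<close>-th roots of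
  unity. It is 1 on \<open>layer 0\<close>, so modulating by it is invisible there.\<close>

definition chi :: "fgword \<Rightarrow> complex" where
  "chi x = cis (2 * pi * (real_of_int (expo x) / real k))"

lemma cmod_chi: "cmod (chi x) = 1" "cmod (chi x ^ t) = 1"
  by (simp_all add: chi_def norm_power)

lemma chi_act: "x \<in> X \<Longrightarrow> chi (act x j) = chi x * cis (2 * pi * (real_of_int j / real k))"
  by (simp add: chi_def coords_act cis_mult add_divide_distrib distrib_left)

lemma cis_root_1_iff: "cis (2 * pi * (real_of_int j / real k)) = 1 \<longleftrightarrow> int k dvd j"
proof
  assume "cis (2 * pi * (real_of_int j / real k)) = 1"
  then have "cos (2 * pi * (real_of_int j / real k)) = 1" by (simp add: complex_eq_iff)
  then obtain m :: int where "2 * pi * (real_of_int j / real k) = real_of_int m * 2 * pi"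
    using cos_one_2pi_int by blast
  then have "real_of_int j = real_of_int (int k * m)" using k by (simp add: field_simps)
  then show "int k dvd j" by (simp only: of_int_eq_iff dvd_triv_left)
next
  assume "int k dvd j"
  then obtain m where "j = int k * m" by blast
  then have "real_of_int j / real k = real_of_int m" using k by simp
  then show "cis (2 * pi * (real_of_int j / real k)) = 1" by (simp add: cis_multiple_2pi)
qed

lemma chi_power: "chi x ^ k = 1"
proof -
  have "real k * (2 * pi * (real_of_int (expo x) / real k)) = 2 * pi * real_of_int (expo x)"
    using k by simp
  then have "chi x ^ k = cis (2 * pi * real_of_int (expo x))"
    using Complex.DeMoivre[of "2 * pi * (real_of_int (expo x) / real k)" k] unfolding chi_def by metis
  then show ?thesis by (simp add: cis_multiple_2pi)
qed

lemma chi_layer_0: "x \<in> layer 0 \<Longrightarrow> chi x = 1"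
  unfolding chi_def by (subst cis_root_1_iff) (simp add: layer_def)

text \<open>Modulation multiplies each coefficient \<open>c j\<close> by a root of unity. The
  support of the coefficients stays inside the periods of the weights.\<close>

lemma reducing_modulated:
  assumes T: "weighted_shift n (cycle v0) \<Lambda> T" "\<And>u. u \<in> X \<Longrightarrow> \<Lambda> u > 0"
    and H: "reduces (ell2 X) H (T ` letters n)"
  shows "reduces (ell2 X) ((\<lambda>f x. chi x ^ t * f x) ` H) (T ` letters n)"
proof -
  let ?H = "(\<lambda>f x. chi x ^ t * f x) ` H"
  obtain c where Hc: "closed_subspace (ell2 X) H" and c: "conv_kernel (proj (ell2 X) H) c"
    and per: "\<And>j. c j \<noteq> 0 \<Longrightarrow> period \<Lambda> j"
    using H reduces_iff_conv_kernel[OF T] by blast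
  note mod = modulate_subspace[OF Hc, of "\<lambda>x. chi x ^ t", OF cmod_chi(2)]
  have ker: "proj (ell2 X) ?H (ket v) u = chi u ^ t * (cnj (chi v ^ t) * proj (ell2 X) H (ket v) u)"
    if v: "v \<in> X" for u v
  proof -
    have "(\<lambda>y. cnj (chi y ^ t) * ket v y) = (\<lambda>y. cnj (chi v ^ t) * ket v y)" by (auto simp: ket_def)
    then show ?thesis
      using mod(2)[OF ket_ell2[OF v]] bop_scale[OF proj_bop[OF Hc] ket_ell2[OF v], of "cnj (chi v ^ t)"]
      by simp
  qed
  define d where "d j = cnj (cis (2 * pi * (real_of_int j / real k))) ^ t * c j" for j
  have "conv_kernel (proj (ell2 X) ?H) d"
    unfolding conv_kernel_def
  proof (intro conjI ballI allI impI)
    fix u j assume u: "u \<in> X"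
    have "chi u ^ t * cnj (chi u ^ t) = 1" by (rule cnj_mult_self(2)[OF cmod_chi(2)])
    moreover have "proj (ell2 X) H (ket (act u j)) u = c j" using c u by (simp add: conv_kernel_def)
    ultimately show "proj (ell2 X) ?H (ket (act u j)) u = d j"
      unfolding ker[OF act_closed[OF u]] chi_act[OF u] d_def
      by (simp add: power_mult_distrib)
  next
    fix u v assume "u \<in> X" "v \<in> X" "proj (ell2 X) ?H (ket v) u \<noteq> 0"
    then show "\<exists>j. v = act u j" using c ker[of v u] unfolding conv_kernel_def by auto
  qed
  moreover have "period \<Lambda> j" if "d j \<noteq> 0" for j using that per by (simp add: d_def)
  ultimately show ?thesis using mod(1) reduces_iff_conv_kernel[OF T] by blast
qed

text \<open>Both projections are convolutions and therefore commute, so the algebraic sum is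
  closed.\<close>

lemma reducing_plus:
  assumes T: "weighted_shift n (cycle v0) \<Lambda> T" "\<And>u. u \<in> X \<Longrightarrow> \<Lambda> u > 0"
    and M: "reduces (ell2 X) M (T ` letters n)" and N: "reduces (ell2 X) N (T ` letters n)"
  shows "reduces (ell2 X) {\<lambda>x. f x + g x | f g. f \<in> M \<and> g \<in> N} (T ` letters n)"
proof -
  obtain c where Mc: "closed_subspace (ell2 X) M" and c: "conv_kernel (proj (ell2 X) M) c"
    using M reduces_iff_conv_kernel[OF T] by blast
  obtain d where Nc: "closed_subspace (ell2 X) N" and d: "conv_kernel (proj (ell2 X) N) d"
    using N reduces_iff_conv_kernel[OF T] by blast
  have comm: "commute (ell2 X) (proj (ell2 X) M) (proj (ell2 X) N)"
    by (rule conv_kernel_commute[OF proj_bop[OF Mc] c proj_bop[OF Nc] d])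
  show ?thesis
    unfolding reduces_def
    using closed_subspace_plus(1)[OF Mc Nc comm] commute_proj_plus[OF Mc Nc comm weighted_shift_bop[OF T(1)]]
      M N by (auto simp: reduces_def)
qed

text \<open>Stated for any number \<open>t\<close> of modulations, so that closedness can be proved
  by adding one commuting projection at a time.\<close>

definition modulated_sum :: "nat \<Rightarrow> fgword vec set \<Rightarrow> fgword vec set" where
  "modulated_sum t H = {\<lambda>x. \<Sum>s<t. chi x ^ s * f s x | f. \<forall>s. f s \<in> H}"

lemma reducing_modulated_sum:
  assumes T: "weighted_shift n (cycle v0) \<Lambda> T" "\<And>u. u \<in> X \<Longrightarrow> \<Lambda> u > 0"
    and H: "reduces (ell2 X) H (T ` letters n)"
  shows "reduces (ell2 X) (modulated_sum t H) (T ` letters n)"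
proof (induction t)
  case 0
  have z: "closed_subspace (ell2 X) {\<lambda>x. 0}" by (rule closed_subspace_trivial)
  have Hc: "closed_subspace (ell2 X) H" using H by (simp add: reduces_def)
  have "proj (ell2 X) {\<lambda>x. 0} f = (\<lambda>x. 0)" if "f \<in> ell2 X" for f using proj_in[OF z that] by simp
  then have "commute (ell2 X) (proj (ell2 X) {\<lambda>x. 0}) (T i)" if "i \<in> letters n" for i
    using bop_maps[OF weighted_shift_bop[OF T(1) that]] bop_zero[OF weighted_shift_bop[OF T(1) that]]
    by (simp add: commute_iff)
  moreover have "modulated_sum 0 H = {\<lambda>x. 0}"
    using closed_subspace_zero[OF Hc] by (auto simp: modulated_sum_def)
  ultimately show ?case using z by (auto simp: reduces_def)
next
  case (Suc t)
  have "modulated_sum (Suc t) H =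
      {\<lambda>x. a x + b x | a b. a \<in> modulated_sum t H \<and> b \<in> (\<lambda>f x. chi x ^ t * f x) ` H}" (is "_ = ?S")
  proof
    show "modulated_sum (Suc t) H \<subseteq> ?S"
    proof
      fix h assume "h \<in> modulated_sum (Suc t) H"
      then obtain f where f: "\<forall>s. f s \<in> H" and h: "h = (\<lambda>x. \<Sum>s<Suc t. chi x ^ s * f s x)"
        by (auto simp: modulated_sum_def)
      have "h = (\<lambda>x. (\<Sum>s<t. chi x ^ s * f s x) + chi x ^ t * f t x)" by (simp add: h)
      moreover have "(\<lambda>x. \<Sum>s<t. chi x ^ s * f s x) \<in> modulated_sum t H"
        using f unfolding modulated_sum_def by blast
      moreover have "(\<lambda>x. chi x ^ t * f t x) \<in> (\<lambda>f x. chi x ^ t * f x) ` H" using f by blast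
      ultimately show "h \<in> ?S"
        by (intro CollectI exI[of _ "\<lambda>x. \<Sum>s<t. chi x ^ s * f s x"] exI[of _ "\<lambda>x. chi x ^ t * f t x"] conjI)
    qed
    show "?S \<subseteq> modulated_sum (Suc t) H"
    proof
      fix h assume "h \<in> ?S"
      then obtain f g where f: "\<forall>s. f s \<in> H" and g: "g \<in> H"
        and h: "h = (\<lambda>x. (\<Sum>s<t. chi x ^ s * f s x) + chi x ^ t * g x)"
        by (auto simp: modulated_sum_def)
      have "h = (\<lambda>x. \<Sum>s<Suc t. chi x ^ s * (f(t := g)) s x)" by (simp add: h)
      moreover have "\<forall>s. (f(t := g)) s \<in> H" using f g by simp
      ultimately show "h \<in> modulated_sum (Suc t) H" unfolding modulated_sum_def by blast
    qed
  qed
  then show ?case using reducing_plus[OF T Suc reducing_modulated[OF T H]] by simp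
qed

text \<open>Multiplication by \<open>chi\<close> permutes the \<open>k\<close> summands cyclically
  because \<open>chi ^ k = 1\<close>.\<close>

lemma modulated_sum_chi:
  assumes "h \<in> modulated_sum k H"
  shows "(\<lambda>x. chi x * h x) \<in> modulated_sum k H"
proof -
  obtain f where f: "\<forall>s. f s \<in> H" and h: "h = (\<lambda>x. \<Sum>s<k. chi x ^ s * f s x)"
    using assms by (auto simp: modulated_sum_def)
  obtain m where m: "k = Suc m" using k by (cases k) auto
  \<comment> \<open>The last summand \<open>f m\<close> acquires the factor
    \<open>chi ^ k = 1\<close> and becomes the summand with index 0.\<close>
  define g where "g s = (case s of 0 \<Rightarrow> f m | Suc s' \<Rightarrow> f s')" for s
  have "chi x * h x = (\<Sum>s<k. chi x ^ s * g s x)" for x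
  proof -
    have "chi x * h x = (\<Sum>s<m. chi x ^ Suc s * f s x) + chi x ^ k * f m x"
      by (simp add: h m sum_distrib_left distrib_left mult.assoc)
    also have "\<dots> = f m x + (\<Sum>s<m. chi x ^ Suc s * f s x)" by (simp add: chi_power)
    also have "\<dots> = (\<Sum>s<k. chi x ^ s * g s x)"
      unfolding m by (subst sum.lessThan_Suc_shift) (simp add: g_def)
    finally show ?thesis .
  qed
  moreover have "\<forall>s. g s \<in> H" using f by (simp add: g_def split: nat.split)
  ultimately show ?thesis unfolding modulated_sum_def by blast
qed

lemma modulated_sum_chi_power:
  "h \<in> modulated_sum k H \<Longrightarrow> (\<lambda>x. chi x ^ t * h x) \<in> modulated_sum k H"
proof (induction t)
  case (Suc t)
  have "(\<lambda>x. chi x ^ Suc t * h x) = (\<lambda>x. chi x * (chi x ^ t * h x))" by (simp add: mult.assoc)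
  then show ?case using modulated_sum_chi[OF Suc.IH[OF Suc.prems]] by simp
qed simp

text \<open>Writing the conjugate as a power of \<open>chi\<close> shows that the adjoint of the
  modulation preserves the modulated sum as well.\<close>

lemma cnj_chi: "cnj (chi x) = chi x ^ (k - 1)"
proof -
  have "chi x * cnj (chi x) = chi x * chi x ^ (k - 1)"
    using cnj_mult_self(2)[OF cmod_chi(1)] chi_power[of x] k by (simp flip: power_Suc)
  moreover have "chi x \<noteq> 0" using cmod_chi(1)[of x] by auto
  ultimately show ?thesis by simp
qed

text \<open>The projection commutes with multiplication by \<open>chi\<close>. Comparing one entry,
  \<open>c j \<noteq> 0\<close> forces \<open>chi\<close> to agree at an element and at its
  translate by \<open>j\<close>, so \<open>k\<close> divides \<open>j\<close>.\<close>

lemma modulated_sum_supported: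
  assumes N: "closed_subspace (ell2 X) (modulated_sum k H)"
    and c: "conv_kernel (proj (ell2 X) (modulated_sum k H)) c" and j: "c j \<noteq> 0"
  shows "int k dvd j"
proof -
  let ?N = "modulated_sum k H"
  let ?P = "proj (ell2 X) ?N" and ?W = "\<lambda>f\<in>ell2 X. \<lambda>x. chi x * f x"
  note ch = modulate_ell2[of chi, OF cmod_chi(1)]
  have W: "?W \<in> bop (ell2 X) (ell2 X)"
    by (rule bopI[where C = 1])
      (auto simp: ch ell2_add ell2_scale distrib_left mult.left_commute l2norm_def norm_mult cmod_chi)
  have "commute (ell2 X) ?P ?W"
  proof (rule commute_projI[OF N W])
    show "cinner (?W f) g = cinner f (\<lambda>x. cnj (chi x) * g x)" if "f \<in> ell2 X" for f g
      using that by (simp add: cinner_modulate)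
    show "?W f \<in> ?N" if "f \<in> ?N" for f
      using modulated_sum_chi[OF that] closed_subspace_ell2[OF N that] by simp
    show "(\<lambda>x. cnj (chi x) * f x) \<in> ?N" if "f \<in> ?N" for f
      unfolding cnj_chi by (rule modulated_sum_chi_power[OF that])
  qed
  let ?u = "elt [] 0" and ?v = "act (elt [] 0) j"
  note u = X_nonempty
  have v: "?v \<in> X" by (rule act_closed[OF u])
  note kv = ket_ell2[OF v]
  have "?W (ket ?v) = (\<lambda>x. chi ?v * ket ?v x)" using kv by (auto simp: ket_def)
  then have "?P (?W (ket ?v)) ?u = chi ?v * ?P (ket ?v) ?u"
    using bop_scale[OF proj_bop[OF N] kv] by simp
  moreover have "?W (?P (ket ?v)) ?u = chi ?u * ?P (ket ?v) ?u" using proj_ell2[OF N kv] by simp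
  moreover have "?P (ket ?v) ?u = c j" using c u by (simp add: conv_kernel_def)
  moreover have "?P (?W (ket ?v)) = ?W (?P (ket ?v))"
    using \<open>commute (ell2 X) ?P ?W\<close> kv unfolding commute_iff by (rule bspec)
  ultimately have "chi ?v * c j = chi ?u * c j" by metis
  then have "chi ?u * cis (2 * pi * (real_of_int j / real k)) = chi ?u" using j chi_act[OF u] by simp
  moreover have "chi ?u \<noteq> 0" using cmod_chi(1)[of ?u] by auto
  ultimately show ?thesis using cis_root_1_iff by simp
qed

text \<open>On \<open>layer 0\<close> the factors \<open>chi ^ s\<close> are 1, so there a modulated
  sum looks like an ordinary sum of elements of \<open>H\<close>.\<close>

lemma restr_modulated_sum:
  assumes H: "closed_subspace (ell2 X) H"
  shows "restr (layer 0) ` modulated_sum k H = restr (layer 0) ` H"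
proof
  show "restr (layer 0) ` modulated_sum k H \<subseteq> restr (layer 0) ` H"
  proof clarify
    fix h assume "h \<in> modulated_sum k H"
    then obtain f where f: "\<forall>s. f s \<in> H" and h: "h = (\<lambda>x. \<Sum>s<k. chi x ^ s * f s x)"
      by (auto simp: modulated_sum_def)
    have "restr (layer 0) h = restr (layer 0) (\<lambda>x. \<Sum>s<k. f s x)"
      by (auto simp: restr_def h chi_layer_0)
    moreover have "(\<lambda>x. \<Sum>s<k. f s x) \<in> H" by (rule closed_subspace_sum[OF H]) (use f in simp)
    ultimately show "restr (layer 0) h \<in> restr (layer 0) ` H" by blast
  qed
  have "H \<subseteq> modulated_sum k H"
  proof
    fix h assume h: "h \<in> H"
    obtain m where m: "k = Suc m" using k by (cases k) auto
    let ?f = "\<lambda>s. if s = 0 then h else (\<lambda>x. 0)"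
    have "h = (\<lambda>x. \<Sum>s<k. chi x ^ s * ?f s x)"
      unfolding m by (subst sum.lessThan_Suc_shift) simp
    moreover have "\<forall>s. ?f s \<in> H" using h closed_subspace_zero[OF H] by simp
    ultimately show "h \<in> modulated_sum k H"
      unfolding modulated_sum_def by (intro CollectI exI[of _ ?f] conjI)
  qed
  then show "restr (layer 0) ` H \<subseteq> restr (layer 0) ` modulated_sum k H" by blast
qed

end

section \<open>Passage between reducing subspaces of the weighted and of the unweighted
  shift\<close>

context k_periodic_translates
begin

lemma theta_io: "inj_on (theta r) X" "theta r ` X \<subseteq> X"
  using theta_inj_on theta_sub by blast+

lemma push_theta_layer: "g \<in> ell2 X \<Longrightarrow> push X (theta r) g \<in> ell2 (layer r)"
  using push_norm(1)[OF theta_inj_on subset_refl, of g r] by (simp add: theta_image)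

lemma block_proj_image:
  "H \<subseteq> ell2 X \<Longrightarrow> block_proj n v0 k r ` H = restr (layer r) ` H"
  unfolding block_proj_eq by (rule image_cong) auto

lemma block_proj_K_per:
  assumes "H \<subseteq> ell2 X"
  shows "block_proj n v0 k 0 ` H \<subseteq> K_per n v0 k"
  unfolding block_proj_image[OF assms] K_per_eq using assms restr_ell2' by blast

lemma U_per_image:
  assumes "H \<subseteq> ell2 X"
  shows "U_per n v0 k ` block_proj n v0 k 0 ` H = pull X (theta 0) ` restr (layer 0) ` H"
  unfolding block_proj_image[OF assms] U_per_eq
  by (rule image_cong) (use assms restr_ell2' in auto)

text \<open>If \<open>k\<close> is not the least period, then \<open>P\<^sub>0 H\<close> need not be contained in \<open>H\<close>. However
  \<open>P\<^sub>0 H = P\<^sub>0 N\<close>, where \<open>N\<close> is the sum of the modulations of \<open>H\<close> by the \<open>k\<close>-th roots of unity;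
  \<open>N\<close> is closed because the projections onto the modulations commute, and \<open>P\<^sub>0 N \<subseteq> N\<close>.\<close>

lemma reducing_compression:
  assumes T: "weighted_shift n (cycle v0) \<Lambda> T" "\<And>u. u \<in> X \<Longrightarrow> \<Lambda> u > 0"
    and S: "weighted_shift n (cycle v0) (\<lambda>_. 1) S"
    and H: "reduces (ell2 X) H (T ` letters n)"
  shows "reduces (ell2 X) (U_per n v0 k ` block_proj n v0 k 0 ` H) (S ` letters n)"
proof -
  let ?\<theta> = "theta 0"
  note io = theta_io[of 0]
  define N where "N = modulated_sum k H"
  have Hc: "closed_subspace (ell2 X) H" using H by (simp add: reduces_def)
  obtain c where N: "closed_subspace (ell2 X) N" and c: "conv_kernel (proj (ell2 X) N) c"
    using reducing_modulated_sum[OF T H, of k] reduces_iff_conv_kernel[OF T] unfolding N_def by blast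
  have supp: "\<And>j. c j \<noteq> 0 \<Longrightarrow> int k dvd j"
    using modulated_sum_supported N c unfolding N_def by blast
  have inv: "restr (layer 0) f \<in> N" if "f \<in> N" for f
    by (rule restr_invariant[OF N c supp layer_invariant that])
  let ?P = "proj (ell2 X) N"
  \<comment> \<open>Since \<open>N\<close> contains the cutoffs of its elements to
    \<open>layer 0\<close>, the image under \<open>U_per\<close> is the preimage of \<open>N\<close>
    under the isometry \<open>push X ?\<theta>\<close>.\<close>
  define N0 where "N0 = {g \<in> ell2 X. push X ?\<theta> g \<in> N}"
  have img: "U_per n v0 k ` block_proj n v0 k 0 ` H = N0"
  proof -
    have "U_per n v0 k ` block_proj n v0 k 0 ` H = pull X ?\<theta> ` restr (layer 0) ` N"
      using U_per_image[OF closed_subspace_subset[OF Hc]] restr_modulated_sum[OF Hc] by (simp add: N_def)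
    also have "\<dots> = N0"
    proof
      show "pull X ?\<theta> ` restr (layer 0) ` N \<subseteq> N0"
      proof clarify
        fix f assume f: "f \<in> N"
        note fX = closed_subspace_ell2[OF N f]
        have "push X ?\<theta> (pull X ?\<theta> (restr (layer 0) f)) = restr (layer 0) f"
          unfolding push_pull[OF io] theta_image by (auto simp: restr_def)
        then show "pull X ?\<theta> (restr (layer 0) f) \<in> N0"
          using inv[OF f] pull_ell2(1)[OF io restr_ell2[OF fX]] by (simp add: N0_def)
      qed
      show "N0 \<subseteq> pull X ?\<theta> ` restr (layer 0) ` N"
      proof
        fix g assume "g \<in> N0"
        then have g: "g \<in> ell2 X" "push X ?\<theta> g \<in> N" by (auto simp: N0_def)
        have "restr (layer 0) (push X ?\<theta> g) = push X ?\<theta> g"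
          by (rule restr_eq[OF push_theta_layer[OF g(1)]])
        then show "g \<in> pull X ?\<theta> ` restr (layer 0) ` N"
          using g(2) pull_push[OF io g(1)] by (metis imageI)
      qed
    qed
    finally show ?thesis .
  qed
  \<comment> \<open>The compression of the projection onto \<open>N\<close> by this isometry. It
    lands in \<open>N0\<close> because \<open>N\<close> is invariant under the cutoff to
    \<open>layer 0\<close>.\<close>
  let ?R = "\<lambda>g. pull X ?\<theta> (?P (push X ?\<theta> g))"
  have P0: "?R g \<in> N0" if g: "g \<in> ell2 X" for g
  proof -
    have 1: "?P (push X ?\<theta> g) \<in> N" by (rule proj_in[OF N push_ell2[OF io g]])
    then show ?thesis
      using inv[OF 1] pull_ell2(1)[OF io closed_subspace_ell2[OF N 1]]
      by (simp add: N0_def push_pull[OF io] theta_image)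
  qed
  have orth: "cinner (\<lambda>x. g x - ?R g x) h = 0" if g: "g \<in> ell2 X" and h: "h \<in> N0" for g h
  proof -
    have h': "h \<in> ell2 X" "push X ?\<theta> h \<in> N" using h by (auto simp: N0_def)
    note pg = push_ell2[OF io g]
    have "cinner (?R g) h = cinner (?P (push X ?\<theta> g)) (push X ?\<theta> h)" by (rule cinner_pull[OF io h'(1)])
    also have "\<dots> = cinner (push X ?\<theta> g) (push X ?\<theta> h)" by (rule cinner_proj[OF N pg h'(2)])
    also have "\<dots> = cinner g h" using cinner_push[OF io g] pull_push[OF io h'(1)] by simp
    finally show ?thesis
      using cinner_diff_left[OF g pull_ell2(1)[OF io proj_ell2[OF N pg]] h'(1)] by simp
  qed
  have N0: "closed_subspace (ell2 X) N0"
  proof (rule closed_subspace_projectable[where P = ?R, OF _ _ _ _ P0 orth])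
    have "push X ?\<theta> (\<lambda>x. 0) = (\<lambda>x. 0)" by (auto simp: push_def)
    then show "(\<lambda>x. 0) \<in> N0" using closed_subspace_zero[OF N] by (simp add: N0_def ell2_zero)
  qed (auto simp: N0_def push_add[OF io] push_scale[OF io] ell2_add ell2_scale
      closed_subspace_add[OF N] closed_subspace_scale[OF N])
  have ker: "proj (ell2 X) N0 (ket v) u = ?P (ket (?\<theta> v)) (?\<theta> u)" if "u \<in> X" "v \<in> X" for u v
    using proj_eqI[OF N0 ket_ell2[OF that(2)] P0[OF ket_ell2[OF that(2)]] orth[OF ket_ell2[OF that(2)]]]
      push_ket[OF io that(2)] that(1) by (simp add: pull_def)
  \<comment> \<open>Translation by \<open>j\<close> on \<open>X\<close> corresponds under
    \<open>theta 0\<close> to translation by \<open>k * j\<close>. No coefficient is lost, since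
    \<open>c\<close> is supported on the multiples of \<open>k\<close>.\<close>
  have "conv_kernel (proj (ell2 X) N0) (\<lambda>j. c (int k * j))"
    unfolding conv_kernel_def
  proof (intro conjI ballI allI impI)
    fix u j assume u: "u \<in> X"
    show "proj (ell2 X) N0 (ket (act u j)) u = c (int k * j)"
      using ker[OF u act_closed[OF u]] theta_act[OF u] c theta_coords(1)[OF u] by (simp add: conv_kernel_def)
  next
    fix u v assume u: "u \<in> X" and v: "v \<in> X" and nz: "proj (ell2 X) N0 (ket v) u \<noteq> 0"
    then have nz': "?P (ket (?\<theta> v)) (?\<theta> u) \<noteq> 0" using ker by simp
    then obtain i where i: "?\<theta> v = act (?\<theta> u) i"
      using c theta_coords(1)[OF u] theta_coords(1)[OF v] unfolding conv_kernel_def by blast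
    then have "c i \<noteq> 0" using c nz' theta_coords(1)[OF u] unfolding conv_kernel_def by metis
    then obtain j where "i = int k * j" using supp by blast
    then show "\<exists>j. v = act u j" using theta_orbit[OF u v] i by blast
  qed
  \<comment> \<open>For constant weights every integer is a period, so a convolution kernel alone
    makes the subspace reducing for \<open>S\<close>.\<close>
  moreover have "period (\<lambda>_. 1) j" for j by (simp add: period_def)
  ultimately show ?thesis
    unfolding img using reduces_iff_conv_kernel[OF S] N0 by auto
qed

text \<open>The maps \<open>push X (theta r)\<close>, \<open>r < k\<close>, are isometries with
  mutually orthogonal ranges, one for each layer; the layers fill \<open>X\<close>.\<close>

lemma pull_theta_push_theta:
  assumes "g \<in> ell2 X" "r < k" "s < k"
  shows "pull X (theta s) (push X (theta r) g) = (if r = s then g else (\<lambda>x. 0))"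
proof (cases "r = s")
  case True
  then show ?thesis using pull_push[OF theta_io assms(1)] by simp
next
  case False
  have "push X (theta r) g (theta s x) = 0" if "x \<in> X" for x
  proof -
    have "theta s x \<in> layer s" using that theta_image by blast
    then have "theta s x \<notin> layer r" using layer_disjoint[OF assms(2,3) False] by blast
    then show ?thesis by (rule ell2_outside[OF push_theta_layer[OF assms(1)]])
  qed
  with False show ?thesis by (auto simp: pull_def)
qed

lemma restr_layers: "f \<in> ell2 X \<Longrightarrow> (\<Sum>r<k. restr (layer r) f x) = f x"
  using sum_restr[of "{..<k}" layer f x] layer_disjoint layer_cover restr_eq[of f X] by simp

text \<open>\<open>H\<close> is the sum of one copy of \<open>H'\<close> on each layer. Its
  projection is the sum of the conjugates of the projection onto \<open>H'\<close>, and its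
  coefficients are those of \<open>H'\<close> placed at the multiples of \<open>k\<close>, all of
  which are periods of the weights.\<close>

lemma reducing_extension:
  assumes T: "weighted_shift n (cycle v0) \<Lambda> T" "\<And>u. u \<in> X \<Longrightarrow> \<Lambda> u > 0" "period \<Lambda> (int k)"
    and S: "weighted_shift n (cycle v0) (\<lambda>_. 1) S"
    and H': "reduces (ell2 X) H' (S ` letters n)"
  defines "H \<equiv> {f \<in> ell2 X. \<forall>r<k. pull X (theta r) f \<in> H'}"
  shows "reduces (ell2 X) H (T ` letters n)"
    and "orth_sum (ell2 X) (principal_component n v0 k) (\<lambda>u. Q n (cycle v0) (J n v0 k u) ` H) H"
    and "orth_sum (ell2 X) {..<k} (\<lambda>r. block_proj n v0 k r ` H) H"
    and "block_proj n v0 k 0 ` H = push X (theta 0) ` H'"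
proof -
  obtain c' where Hc': "closed_subspace (ell2 X) H'" and c': "conv_kernel (proj (ell2 X) H') c'"
    using H' reduces_iff_conv_kernel[OF S] by auto
  let ?P' = "proj (ell2 X) H'"
  note pl = pull_ell2(1)[OF theta_io] and ps = push_ell2[OF theta_io]
  have P'_pull: "?P' (pull X (theta r) f) \<in> H'" "?P' (pull X (theta r) f) \<in> ell2 X" if "f \<in> ell2 X" for f r
    using proj_in[OF Hc' pl[OF that]] proj_ell2[OF Hc' pl[OF that]] by blast+
  let ?t = "\<lambda>f r. push X (theta r) (?P' (pull X (theta r) f))"
  let ?P = "\<lambda>f x. \<Sum>r<k. ?t f r x"
  have t: "?t f r \<in> ell2 X" if "f \<in> ell2 X" for f r by (rule ps[OF P'_pull(2)[OF that]])
  have PX: "?P f \<in> ell2 X" if "f \<in> ell2 X" for f by (rule ell2_sum) (rule t[OF that])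
  have pullP: "pull X (theta s) (?P f) = ?P' (pull X (theta s) f)" if f: "f \<in> ell2 X" and s: "s < k" for f s
  proof
    fix x
    have "pull X (theta s) (?P f) x = (\<Sum>r<k. pull X (theta s) (?t f r) x)" by (simp add: pull_def)
    also have "\<dots> = (\<Sum>r<k. if r = s then ?P' (pull X (theta s) f) x else 0)"
      by (rule sum.cong) (simp_all add: pull_theta_push_theta[OF P'_pull(2)[OF f] _ s])
    also have "\<dots> = ?P' (pull X (theta s) f) x" using s by simp
    finally show "pull X (theta s) (?P f) x = ?P' (pull X (theta s) f) x" .
  qed
  have P: "?P f \<in> H" if "f \<in> ell2 X" for f
    using PX[OF that] pullP[OF that] P'_pull(1)[OF that] by (simp add: H_def)
  have orth: "cinner (\<lambda>x. f x - ?P f x) h = 0" if f: "f \<in> ell2 X" and h: "h \<in> H" for f h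
  proof -
    have h': "h \<in> ell2 X" "\<And>r. r < k \<Longrightarrow> pull X (theta r) h \<in> H'" using h by (auto simp: H_def)
    have "cinner (?P f) h = (\<Sum>r<k. cinner (?t f r) h)"
      by (rule cinner_sum_left[OF t[OF f] h'(1)])
    also have "\<dots> = (\<Sum>r<k. cinner (restr (layer r) f) h)"
    proof (rule sum.cong)
      fix r assume "r \<in> {..<k}"
      then have r: "r < k" by simp
      have "cinner (?t f r) h = cinner (?P' (pull X (theta r) f)) (pull X (theta r) h)"
        by (rule cinner_push[OF theta_io P'_pull(2)[OF f]])
      also have "\<dots> = cinner (pull X (theta r) f) (pull X (theta r) h)"
        by (rule cinner_proj[OF Hc' pl[OF f] h'(2)[OF r]])
      also have "\<dots> = cinner (push X (theta r) (pull X (theta r) f)) h"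
        by (rule cinner_push[OF theta_io pl[OF f], symmetric])
      finally show "cinner (?t f r) h = cinner (restr (layer r) f) h"
        by (simp add: push_pull[OF theta_io] theta_image)
    qed simp
    also have "\<dots> = cinner (\<lambda>x. \<Sum>r<k. restr (layer r) f x) h"
      by (rule cinner_sum_left[OF restr_ell2[OF f] h'(1), symmetric])
    also have "\<dots> = cinner f h" by (simp add: restr_layers[OF f])
    finally show ?thesis using cinner_diff_left[OF f PX[OF f] h'(1)] by simp
  qed
  have Hc: "closed_subspace (ell2 X) H"
  proof (rule closed_subspace_projectable[where P = ?P, OF _ _ _ _ P orth])
    have "pull X (theta r) (\<lambda>x. 0) = (\<lambda>x. 0)" for r by (auto simp: pull_def)
    then show "(\<lambda>x. 0) \<in> H" using closed_subspace_zero[OF Hc'] by (simp add: H_def ell2_zero)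
  qed (auto simp: H_def pull_add[OF theta_io] pull_scale[OF theta_io] ell2_add ell2_scale
      closed_subspace_add[OF Hc'] closed_subspace_scale[OF Hc'])
  have ker: "proj (ell2 X) H (ket (theta s y)) (theta r x) = (if r = s then ?P' (ket y) x else 0)"
    if "x \<in> X" "y \<in> X" "r < k" "s < k" for r s x y
  proof -
    have k: "ket (theta s y) \<in> ell2 X" by (rule ket_ell2[OF theta_coords(1)[OF that(2)]])
    have "proj (ell2 X) H (ket (theta s y)) = ?P (ket (theta s y))"
      by (rule proj_eqI[OF Hc k P[OF k] orth[OF k]])
    then have "proj (ell2 X) H (ket (theta s y)) (theta r x) = pull X (theta r) (?P (ket (theta s y))) x"
      using that(1) by (simp add: pull_def)
    also have "\<dots> = ?P' (pull X (theta r) (push X (theta s) (ket y))) x"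
      unfolding pullP[OF k that(3)] push_ket[OF theta_io that(2)] ..
    also have "\<dots> = (if r = s then ?P' (ket y) x else 0)"
      using bop_zero[OF proj_bop[OF Hc']] pull_theta_push_theta[OF ket_ell2[OF that(2)] that(4,3)] by simp
    finally show ?thesis .
  qed
  have rep: "\<exists>r<k. \<exists>x\<in>X. u = theta r x" if "u \<in> X" for u
    using that layer_cover theta_image by blast
  \<comment> \<open>Translation by a multiple of \<open>k\<close> stays inside a layer and acts
    there like the quotient; any other translation changes the layer, and different layers are not
    coupled.\<close>
  define c where "c j = (if int k dvd j then c' (j div int k) else 0)" for j
  have "conv_kernel (proj (ell2 X) H) c"
    unfolding conv_kernel_def
  proof (intro conjI ballI allI impI)
    fix u j assume u: "u \<in> X"
    obtain r x where r: "r < k" "x \<in> X" "u = theta r x" using rep[OF u] by blast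
    obtain s y where s: "s < k" "y \<in> X" "act u j = theta s y" using rep[OF act_closed[OF u]] by blast
    show "proj (ell2 X) H (ket (act u j)) u = c j"
    proof (cases "int k dvd j")
      case True
      then obtain i where i: "j = int k * i" by blast
      have "act u j = theta r (act x i)" unfolding r(3) i by (rule theta_act[OF r(2), symmetric])
      then have "proj (ell2 X) H (ket (act u j)) u = ?P' (ket (act x i)) x"
        using ker[OF r(2) act_closed[OF r(2)] r(1) r(1)] r(3) by simp
      then show ?thesis using c' r(2) k i by (simp add: conv_kernel_def c_def)
    next
      case False
      \<comment> \<open>Equal layers would make the orbit coordinates of \<open>u\<close> and
        \<open>act u j\<close> agree modulo \<open>k\<close>, so that \<open>k\<close> divides
        \<open>j\<close>.\<close>
      have "r \<noteq> s"
      proof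
        assume "r = s"
        have "expo (act u j) = int k * expo x - int r + j"
          using coords_act(2)[OF u] theta_coords(3)[OF r(2)] r(3) by simp
        moreover have "expo (act u j) = int k * expo y - int s" using theta_coords(3)[OF s(2)] s(3) by simp
        ultimately have "j = int k * (expo y - expo x)" using \<open>r = s\<close> by (simp add: algebra_simps)
        with False show False by simp
      qed
      then show ?thesis using ker[OF r(2) s(2) r(1) s(1)] r(3) s(3) False by (simp add: c_def)
    qed
  next
    fix u v assume u: "u \<in> X" and v: "v \<in> X" and nz: "proj (ell2 X) H (ket v) u \<noteq> 0"
    obtain r x where r: "r < k" "x \<in> X" "u = theta r x" using rep[OF u] by blast
    obtain s y where s: "s < k" "y \<in> X" "v = theta s y" using rep[OF v] by blast
    have "r = s" "?P' (ket y) x \<noteq> 0"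
      using ker[OF r(2) s(2) r(1) s(1)] nz r(3) s(3) by (simp_all split: if_splits)
    moreover from this obtain i where "y = act x i" using c' r(2) s(2) unfolding conv_kernel_def by blast
    ultimately show "\<exists>j. v = act u j" using theta_act[OF r(2)] r(3) s(3) by blast
  qed
  note c = this
  have supp: "int k dvd j" if "c j \<noteq> 0" for j using that by (simp add: c_def split: if_splits)
  have "period \<Lambda> j" if "c j \<noteq> 0" for j
    using supp[OF that] period_mult[OF T(3)] by auto
  then show "reduces (ell2 X) H (T ` letters n)" using reduces_iff_conv_kernel[OF T(1,2)] Hc c by blast
  show "orth_sum (ell2 X) (principal_component n v0 k) (\<lambda>u. Q n (cycle v0) (J n v0 k u) ` H) H"
    "orth_sum (ell2 X) {..<k} (\<lambda>r. block_proj n v0 k r ` H) H"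
    by (rule reducing_decomposition(1,2)[OF Hc c], erule supp)+
  show "block_proj n v0 k 0 ` H = push X (theta 0) ` H'"
    unfolding block_proj_image[OF closed_subspace_subset[OF Hc]]
  proof
    show "restr (layer 0) ` H \<subseteq> push X (theta 0) ` H'"
    proof clarify
      fix f assume "f \<in> H"
      then have "pull X (theta 0) f \<in> H'" using k by (simp add: H_def)
      moreover have "restr (layer 0) f = push X (theta 0) (pull X (theta 0) f)"
        by (simp add: push_pull[OF theta_io] theta_image)
      ultimately show "restr (layer 0) f \<in> push X (theta 0) ` H'" by blast
    qed
    show "push X (theta 0) ` H' \<subseteq> restr (layer 0) ` H"
    proof clarify
      fix g assume g: "g \<in> H'"
      note gX = closed_subspace_ell2[OF Hc' g]
      have "pull X (theta r) (push X (theta 0) g) \<in> H'" if "r < k" for r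
        using pull_theta_push_theta[OF gX _ that, of 0] k g closed_subspace_zero[OF Hc'] by auto
      then have "push X (theta 0) g \<in> H" using ps[OF gX] by (simp add: H_def)
      moreover have "restr (layer 0) (push X (theta 0) g) = push X (theta 0) g"
        by (rule restr_eq[OF push_theta_layer[OF gX]])
      ultimately show "push X (theta 0) g \<in> restr (layer 0) ` H" by (metis imageI)
    qed
  qed
qed

text \<open>The extension of a non-trivial reducing subspace of the unweighted shift is non-trivial,
  because \<open>H'\<close> can be recovered from layer 0.\<close>

lemma reducible_of_period:
  assumes T: "weighted_shift n (cycle v0) \<Lambda> T" "\<And>u. u \<in> X \<Longrightarrow> \<Lambda> u > 0" "period \<Lambda> (int k)"
  shows "\<exists>H. reduces (ell2 X) H (T ` letters n) \<and> nontrivial (ell2 X) H"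
proof -
  obtain S where S: "weighted_shift n (cycle v0) (\<lambda>_. 1) S" using unweighted_shift_exists[OF omega] by blast
  obtain H' where H': "reduces (ell2 X) H' (S ` letters n)" "nontrivial (ell2 X) H'"
    using unweighted_shift_reducible[OF S] by blast
  then have Hc': "closed_subspace (ell2 X) H'" by (simp add: reduces_def)
  define H where "H = {f \<in> ell2 X. \<forall>r<k. pull X (theta r) f \<in> H'}"
  have red: "reduces (ell2 X) H (T ` letters n)"
    unfolding H_def by (rule reducing_extension(1)[OF T S H'(1)])
  have im: "block_proj n v0 k 0 ` H = push X (theta 0) ` H'"
    unfolding H_def by (rule reducing_extension(4)[OF T S H'(1)])
  have "H \<noteq> {\<lambda>x. 0}"
  proof
    assume "H = {\<lambda>x. 0}"
    then have "push X (theta 0) ` H' = {\<lambda>x. 0}"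
      using im by (simp add: block_proj_eq ell2_zero restr_def)
    moreover have "g = (\<lambda>x. 0)" if "g \<in> H'" "push X (theta 0) g = (\<lambda>x. 0)" for g
      using pull_push[OF theta_io closed_subspace_ell2[OF Hc' that(1)], of 0] that(2) by (auto simp: pull_def)
    ultimately have "H' = {\<lambda>x. 0}" using closed_subspace_zero[OF Hc'] by blast
    then show False using H'(2) by (simp add: nontrivial_def)
  qed
  moreover have "H \<noteq> ell2 X"
  proof
    assume eq: "H = ell2 X"
    have "g \<in> H'" if g: "g \<in> ell2 X" for g
    proof -
      have "push X (theta 0) g \<in> H" using push_ell2[OF theta_io g] eq by simp
      then show ?thesis using k pull_push[OF theta_io g, of 0] by (auto simp: H_def)
    qed
    then have "H' = ell2 X" using closed_subspace_subset[OF Hc'] by blast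
    then show False using H'(2) by (simp add: nontrivial_def)
  qed
  ultimately show ?thesis using red by (auto simp: nontrivial_def)
qed

text \<open>The periods of the weights form a subgroup of the integers; division with remainder
  shows that its least positive element divides all others.\<close>

lemma minimal_period_supported:
  assumes min: "\<forall>j. 1 \<le> j \<and> j < k \<longrightarrow> \<not> weights_of_period n v0 j \<Lambda>"
    and per: "period \<Lambda> (int k)" "period \<Lambda> j"
  shows "int k dvd j"
proof (rule ccontr)
  assume "\<not> int k dvd j"
  then have "j mod int k \<noteq> 0" by (simp add: dvd_eq_mod_eq_0)
  moreover have "0 \<le> j mod int k" "j mod int k < int k" using k by simp_all
  ultimately have m: "1 \<le> nat (j mod int k)" "nat (j mod int k) < k" by linarith+
  \<comment> \<open>The remainder would be a smaller positive period. Instantiating the locale with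
    it makes \<open>weights_of_period_iff\<close> available for that number, in contradiction to
    \<open>min\<close>.\<close>
  then interpret m: k_periodic_translates n v0 "nat (j mod int k)"
    by unfold_locales
  have "j mod int k = j + int k * (- (j div int k))"
    using minus_mult_div_eq_mod[of j "int k"] by simp
  then have "period \<Lambda> (j mod int k)" using period_add[OF per(2) period_mult[OF per(1)]] by metis
  then have "weights_of_period n v0 (nat (j mod int k)) \<Lambda>"
    using m.weights_of_period_iff \<open>0 \<le> j mod int k\<close> by simp
  with min m show False by blast
qed

end

section \<open>Assembly of the equivalences and of the description of reducing subspaces\<close>

theorem theorem3p10:
  fixes n :: enat and \<omega> :: "nat stream" and \<Lambda> :: "fgword \<Rightarrow> real" and T :: "nat \<Rightarrow> fgword oper"
  assumes "2 \<le> n"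
    and "\<omega> \<in> streams (letters n)"
    and "\<not> eventually_periodic \<omega> \<or> periodic_word \<omega>"
    and "\<forall>u\<in>F_omega n \<omega>. 0 < \<Lambda> u"
    and "weighted_shift n \<omega> \<Lambda> T"
  shows
    "((\<exists>H. reduces (K_omega n \<omega>) H (shift_algebra n \<omega> T) \<and> nontrivial (K_omega n \<omega>) H)
        \<longleftrightarrow> (\<exists>H. reduces (K_omega n \<omega>) H (T ` letters n) \<and> nontrivial (K_omega n \<omega>) H)) \<and>
     ((\<exists>H. reduces (K_omega n \<omega>) H (T ` letters n) \<and> nontrivial (K_omega n \<omega>) H)
        \<longleftrightarrow> doubly_periodic n \<omega> \<Lambda>) \<and>
     (\<forall>v0 k S.
        primitive v0 \<and> \<omega> = cycle v0 \<and> 1 \<le> k \<and> weights_of_period n v0 k \<Lambda> \<and>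
        weighted_shift n \<omega> (\<lambda>_. 1) S \<longrightarrow>
        (\<forall>r<k.
           has_orth_proj_sum (K_omega n \<omega>) (block n v0 r)
             (\<lambda>u. Q n \<omega> (J n v0 k u)) (block_proj n v0 k r) \<and>
           has_orth_proj_sum (K_omega n \<omega>) (block n v0 r)
             (\<lambda>u. compose (K_omega n \<omega>) (elem_op (K_omega n \<omega>) S u)
                    (compose (K_omega n \<omega>) (Q n \<omega> (J_phi n v0 k))
                      (adj (K_omega n \<omega>) (K_omega n \<omega>) (elem_op (K_omega n \<omega>) S u))))
             (block_proj n v0 k r)) \<and>
        (\<forall>H. reduces (K_omega n \<omega>) H (shift_algebra n \<omega> T)
               \<longleftrightarrow> reduces (K_omega n \<omega>) H (T ` letters n)) \<and>
        (\<forall>H. reduces (K_omega n \<omega>) H (shift_algebra n \<omega> T) \<longrightarrow>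
           ((\<forall>j. 1 \<le> j \<and> j < k \<longrightarrow> \<not> weights_of_period n v0 j \<Lambda>) \<longrightarrow>
              orth_sum (K_omega n \<omega>) (principal_component n v0 k) (\<lambda>u. Q n \<omega> (J n v0 k u) ` H) H \<and>
              orth_sum (K_omega n \<omega>) {..<k} (\<lambda>r. block_proj n v0 k r ` H) H \<and>
              (\<forall>r<k. commute (K_omega n \<omega>) (block_proj n v0 k r) (proj (K_omega n \<omega>) H))) \<and>
           block_proj n v0 k 0 ` H \<subseteq> K_per n v0 k \<and>
           reduces (K_omega n \<omega>) (U_per n v0 k ` block_proj n v0 k 0 ` H)
             (shift_algebra n \<omega> S)) \<and>
        (\<forall>H'. reduces (K_omega n \<omega>) H' (shift_algebra n \<omega> S) \<longrightarrow>
           (\<exists>H. reduces (K_omega n \<omega>) H (shift_algebra n \<omega> T) \<and>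
              orth_sum (K_omega n \<omega>) (principal_component n v0 k) (\<lambda>u. Q n \<omega> (J n v0 k u) ` H) H \<and>
              orth_sum (K_omega n \<omega>) {..<k} (\<lambda>r. block_proj n v0 k r ` H) H \<and>
              block_proj n v0 k 0 ` H =
                adj (K_per n v0 k) (K_omega n \<omega>) (U_per n v0 k) ` H')))"
proof -
  interpret W: word_translates n \<omega>
    by unfold_locales (rule assms(2))
  let ?K = "ell2 (F_omega n \<omega>)"
  have alg: "reduces ?K H (shift_algebra n \<omega> R) \<longleftrightarrow> reduces ?K H (R ` letters n)"
    if "weighted_shift n \<omega> M R" for H M R
    unfolding shift_algebra_def K_omega_def
    by (rule reduces_wot_algebra_iff) (use W.weighted_shift_bop[OF that] in blast)
  note algT = alg[OF assms(5)]
  have pos: "\<And>u. u \<in> F_omega n \<omega> \<Longrightarrow> 0 < \<Lambda> u" using assms(4) by blast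
  have per: "(\<exists>H. reduces ?K H (T ` letters n) \<and> nontrivial ?K H) \<longleftrightarrow> doubly_periodic n \<omega> \<Lambda>"
  proof
    assume "\<exists>H. reduces ?K H (T ` letters n) \<and> nontrivial ?K H"
    then obtain H where H: "reduces ?K H (T ` letters n)" "nontrivial ?K H" by blast
    have "closed_subspace ?K H" "W.shift_kernel \<Lambda> (proj ?K H)"
      using W.reduces_iff_shift_kernel[OF assms(5) pos] H(1) by blast+
    \<comment> \<open>For aperiodic words a reducing projection is scalar, so the assumed
      alternative leaves only a periodic word.\<close>
    then have "periodic_word \<omega>" using W.aperiodic_irreducible H(2) assms(3) by blast
    then obtain v0 where vp: "primitive v0" "\<omega> = cycle v0"
      using primitive_root unfolding periodic_word_def by metis
    interpret P: periodic_translates n v0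
      by unfold_locales (use assms(2) vp in auto)
    obtain k where kp: "1 \<le> k" "P.period \<Lambda> (int k)"
      using P.nontrivial_reducing_period[of \<Lambda> T H] assms(5) pos H vp(2) by blast
    interpret k_periodic_translates n v0 k by unfold_locales (rule kp(1))
    have "weights_of_period n v0 k \<Lambda>" using weights_of_period_iff kp(2) by simp
    then show "doubly_periodic n \<omega> \<Lambda>"
      using vp kp(1) \<open>periodic_word \<omega>\<close> unfolding doubly_periodic_def periodic_weights_def by blast
  next
    assume "doubly_periodic n \<omega> \<Lambda>"
    then obtain v0 k where vp: "primitive v0" "\<omega> = cycle v0" and kp: "1 \<le> k" "weights_of_period n v0 k \<Lambda>"
      unfolding doubly_periodic_def periodic_weights_def by blast
    interpret k_periodic_translates n v0 k
      by unfold_locales (use assms(2) vp kp(1) in auto)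
    show "\<exists>H. reduces ?K H (T ` letters n) \<and> nontrivial ?K H"
      using reducible_of_period[of \<Lambda> T] assms(5) pos kp(2) weights_of_period_iff unfolding vp(2) by blast
  qed
  show ?thesis
    \<comment> \<open>After this rewriting all three conditions of the equivalence are the same
      formula, so \<open>refl\<close> disposes of them and only the periodic case remains.\<close>
    unfolding K_omega_def algT per[symmetric]
  proof (intro conjI allI impI refl)
    fix v0 k S
    assume "primitive v0 \<and> \<omega> = cycle v0 \<and> 1 \<le> k \<and> weights_of_period n v0 k \<Lambda> \<and>
      weighted_shift n \<omega> (\<lambda>_. 1) S"
    then have vp: "primitive v0" "\<omega> = cycle v0" and k: "1 \<le> k" and wp: "weights_of_period n v0 k \<Lambda>"
      and S: "weighted_shift n \<omega> (\<lambda>_. 1) S" by blast+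
    interpret k_periodic_translates n v0 k
      by unfold_locales (use assms(2) vp k in auto)
    note algS = alg[OF S]
    have S': "weighted_shift n (cycle v0) (\<lambda>_. 1) S" and T': "weighted_shift n (cycle v0) \<Lambda> T"
      and pos': "\<And>u. u \<in> F_omega n (cycle v0) \<Longrightarrow> 0 < \<Lambda> u"
      using S assms(5) pos unfolding vp(2) by blast+
    have pk: "period \<Lambda> (int k)" using wp weights_of_period_iff by simp
    show "has_orth_proj_sum ?K (block n v0 r) (\<lambda>u. Q n \<omega> (J n v0 k u)) (block_proj n v0 k r)" for r
      unfolding vp(2) by (rule has_orth_proj_sum_block)
    show "has_orth_proj_sum ?K (block n v0 r)
        (\<lambda>u. compose ?K (elem_op ?K S u) (compose ?K (Q n \<omega> (J_phi n v0 k)) (adj ?K ?K (elem_op ?K S u))))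
        (block_proj n v0 k r)" for r
      unfolding vp(2) by (rule has_orth_proj_sum_elem_op[OF S'])
    {
      fix H assume H: "reduces ?K H (T ` letters n)"
      then have Hc: "closed_subspace ?K H" by (simp add: reduces_def)
      show "block_proj n v0 k 0 ` H \<subseteq> K_per n v0 k"
        by (rule block_proj_K_per) (use closed_subspace_subset[OF Hc] vp(2) in simp)
      show "reduces ?K (U_per n v0 k ` block_proj n v0 k 0 ` H) (shift_algebra n \<omega> S)"
        unfolding algS using reducing_compression[OF T' pos' S'] H unfolding vp(2) by blast
      assume min: "\<forall>j. 1 \<le> j \<and> j < k \<longrightarrow> \<not> weights_of_period n v0 j \<Lambda>"
      obtain c where c: "conv_kernel (proj ?K H) c" and cp: "\<And>j. c j \<noteq> 0 \<Longrightarrow> period \<Lambda> j"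
        using reduces_iff_conv_kernel[OF T' pos'] H unfolding vp(2) by blast
      have supp: "int k dvd j" if "c j \<noteq> 0" for j
        by (rule minimal_period_supported[OF min pk cp[OF that]])
      note dec = reducing_decomposition[OF Hc[unfolded vp(2)] c[unfolded vp(2)]]
      show "orth_sum ?K (principal_component n v0 k) (\<lambda>u. Q n \<omega> (J n v0 k u) ` H) H"
        "orth_sum ?K {..<k} (\<lambda>r. block_proj n v0 k r ` H) H"
        unfolding vp(2) by (rule dec(1,2), erule supp)+
      show "commute ?K (block_proj n v0 k r) (proj ?K H)" for r
        unfolding vp(2) by (rule dec(3), erule supp)
    }
    fix H' assume H': "reduces ?K H' (shift_algebra n \<omega> S)"
    then have H'S: "reduces (ell2 (F_omega n (cycle v0))) H' (S ` letters n)" 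
      unfolding algS unfolding vp(2) .
    note ext = reducing_extension[OF T' pos' pk S' H'S]
    have "H' \<subseteq> ell2 (F_omega n (cycle v0))"
      using H'S closed_subspace_subset unfolding reduces_def by blast
    then have adj_U: "adj (K_per n v0 k) (ell2 (F_omega n (cycle v0))) (U_per n v0 k) ` H' = push (F_omega n (cycle v0)) (theta 0) ` H'"
      unfolding K_per_eq adj_U_per by (intro image_cong) auto
    show "\<exists>H. reduces ?K H (T ` letters n) \<and>
        orth_sum ?K (principal_component n v0 k) (\<lambda>u. Q n \<omega> (J n v0 k u) ` H) H \<and>
        orth_sum ?K {..<k} (\<lambda>r. block_proj n v0 k r ` H) H \<and>
        block_proj n v0 k 0 ` H = adj (K_per n v0 k) ?K (U_per n v0 k) ` H'"
      unfolding vp(2)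
      by (intro exI conjI, rule ext(1), assumption, rule ext(2), assumption, rule ext(3), assumption,
        rule trans[OF ext(4) adj_U[symmetric]])
  qed
qed

end
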